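(* Let $d\geqslant 1$ and let $\Omega$ be a bounded open set in $\mathbb{R}^{d}$. For $R>0$ and $x\in\mathbb{R}^d$ let $\mathcal{D}(R\Omega-x)=\sum_{k\in\mathbb{Z}^{d}}\chi_{R\Omega-x}(k)-R^{d}|\Omega|$, viewed as a function of $x\in\mathbb{T}^{d}=\mathbb{R}^d/\mathbb{Z}^d$. Then: (1) If $2\leqslant p<+\infty$ and $1/p+1/q=1$, then for every $R>0$ \[ \|\mathcal{D}(R\Omega-x)\|_{L^{p}(\mathbb{T}^{d})}\leqslant R^{d}\,\big\|\{\widehat{\chi_{\Omega}}(Rn)\}_{n\neq 0}\big\|_{L^{q}(\mathbb{Z}^{d})}. \] (2) If $2<p<+\infty$ and $1/p+1/q=1$, then there is a constant $C$ independent of $R$ such that for every $R>0$ \[ \|\mathcal{D}(R\Omega-x)\|_{\mathrm{Weak}\text{-}L^{p}(\mathbb{T}^{d})}\leqslant C R^{d}\,\big\|\{\widehat{\chi_{\Omega}}(Rn)\}_{n\neq 0}\big\|_{\mathrm{Weak}\text{-}L^{q}(\mathbb{Z}^{d})}. \] (3) If $2<p<+\infty$ and $1/p+1/q=1$, then there is a constant $C$ independent of $R$ such that for every $R>0$ \[ \|\mathcal{D}(R\Omega-x)\|_{L^{p}(\mathbb{T}^{d})}\leqslant C R^{d}\log^{1/p}(2+R)\,\big\|\{\widehat{\chi_{\Omega}}(Rn)\}_{n\neq 0}\big\|_{\mathrm{Weak}\text{-}L^{q}(\mathbb{Z}^{d})}. \] (4) If $1\leqslant p\leqslant+\infty$,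 then for every $R>0$ \[ \|\mathcal{D}(R\Omega-x)\|_{L^{p}(\mathbb{T}^{d})}\geqslant \sup_{n\neq 0}\big|R^{d}\widehat{\chi_{\Omega}}(Rn)\big|. \]
   Context: $\chi_A$ denotes the characteristic function of a set $A$, $|\Omega|$ the Lebesgue measure, and $\widehat{\chi_{\Omega}}(\xi)=\int_{\mathbb{R}^d}\chi_{\Omega}(y)e^{-2\pi i\xi\cdot y}\,dy$. The torus $\mathbb{T}^d$ carries normalized Lebesgue measure and $\mathbb{Z}^d$ counting measure; sequences indexed by $n\in\mathbb{Z}^d\setminus\{0\}$ are regarded as functions on $\mathbb{Z}^d$ (vanishing at $0$). For $0<p<\infty$, $\|f\|_{L^{p}(\mathbb{X},\mu)}=(\int|f|^{p}d\mu)^{1/p}$, $\|f\|_{\mathrm{Weak}\text{-}L^{p}(\mathbb{X},\mu)}=\sup_{t>0}(t^{p}\mu\{|f|>t\})^{1/p}$, and $\|f\|_{L^\infty}$ is the essential supremum. *)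

theory Defs
  imports "HOL-Analysis.Analysis"
begin

definition int_lattice :: "(real ^ 'n) set" where
  "int_lattice = {k. \<forall>i. k $ i \<in> \<int>}"

definition ft_char :: "(real ^ 'n) set \<Rightarrow> real ^ 'n \<Rightarrow> complex" where
  "ft_char \<Omega> \<xi> = (LINT y:\<Omega>|lebesgue. cis (- 2 * pi * (\<xi> \<bullet> y)))"

definition discrepancy :: "(real ^ 'n) set \<Rightarrow> real \<Rightarrow> real ^ 'n \<Rightarrow> real" where
  "discrepancy \<Omega> R x =
     real (card {k \<in> int_lattice. k \<in> (\<lambda>y. R *\<^sub>R y - x) ` \<Omega>})
     - R ^ CARD('n) * measure lebesgue \<Omega>"

text \<open>The torus T^d with normalized Lebesgue measure, realised as the unit cube
  (functions on T^d = Z^d-periodic functions on R^d).\<close>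
definition torus :: "(real ^ 'n) measure" where
  "torus = lebesgue_on (cbox 0 One)"

definition ft_seq :: "(real ^ 'n) set \<Rightarrow> real \<Rightarrow> real ^ 'n \<Rightarrow> complex" where
  "ft_seq \<Omega> R n = (if n \<in> int_lattice \<and> n \<noteq> 0 then ft_char \<Omega> (R *\<^sub>R n) else 0)"

definition lattice_measure :: "(real ^ 'n) measure" where
  "lattice_measure = count_space int_lattice"

definition enn_root :: "real \<Rightarrow> ennreal \<Rightarrow> ennreal" where
  "enn_root r x = (if x = \<infinity> then \<infinity> else ennreal (enn2real x powr (1 / r)))"

definition Lp_norm :: "real \<Rightarrow> 'a measure \<Rightarrow> ('a \<Rightarrow> 'b::real_normed_vector) \<Rightarrow> ennreal" where
  "Lp_norm p M f = enn_root p (\<integral>\<^sup>+ x. ennreal (norm (f x) powr p) \<partial>M)"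

definition weak_Lp_norm :: "real \<Rightarrow> 'a measure \<Rightarrow> ('a \<Rightarrow> 'b::real_normed_vector) \<Rightarrow> ennreal" where
  "weak_Lp_norm p M f =
     enn_root p (SUP t\<in>{0<..}. ennreal (t powr p) * emeasure M {x \<in> space M. norm (f x) > t})"

definition Linf_norm :: "'a measure \<Rightarrow> ('a \<Rightarrow> 'b::real_normed_vector) \<Rightarrow> ennreal" where
  "Linf_norm M f = Inf {c. AE x in M. ennreal (norm (f x)) \<le> c}"

end

theory Submission
  imports Defs "HOL-Probability.Probability" "HOL-Real_Asymp.Real_Asymp"
begin

text \<open>
  The function \<open>x \<mapsto> \<D>(R\<Omega> - x)\<close> has the Fourier coefficients \<open>R\<^sup>d \<chi>\<^sub>\<Omega>^(Rn)\<close>, \<open>n \<noteq> 0\<close>, and vanishing mean,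
  so (4) is the bound of a Fourier coefficient by the \<open>L\<^sup>1\<close> norm. The \<open>\<le>\<close> half of Parseval's identity
  follows by testing the autocorrelation of the lattice point counting function with the Fejer
  kernel; since \<open>\<Omega>\<close> is open the counting function is lower semicontinuous, which is all that is
  needed of the autocorrelation at the origin. Splitting the coefficients at a suitable height and
  using \<open>\<ell>\<^sup>1 \<rightarrow> L\<^sup>\<infinity>\<close> for the large ones and Parseval for the small ones gives (2). For a bounded function
  the \<open>L\<^sup>p\<close> norm exceeds the weak one by at most a logarithmic factor, which gives (3); applied to
  tensor powers, where this loss is negligible after taking roots, it also gives the
  Hausdorff-Young inequality (1) with constant one, without complex interpolation.
\<close>

section \<open>Hausdorff-Young inequalities for bounded orthonormal systems\<close>

text \<open>The estimates are proved for an abstract system of data, not for the torus, because the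
  tensor trick replaces the torus by its N-fold product. Two features carry the trick: the axioms of
  \<open>parseval_system\<close> survive products, and the weak-type constant depends on the
  exponents alone, hence not on N. Since the N-fold power is bounded by \<open>B ^ N\<close>, only
  O(N) dyadic levels separate this bound from the N-th power of the natural height. So the loss
  takes the form x^N \<le> y^N (1 + N A), which forces x \<le> y. An upper bound for the energy is
  obtained because lower semicontinuity keeps the Fejer means of the autocorrelation from falling
  below its value at 0 in the limit, while each such mean is at most the sum of the squared
  coefficients. In (3) the top height grows polynomially in R, so O(log(2 + R)) levels remain once
  the bottom height is fixed; integrality of the count takes care of what lies below it.\<close>

lemma borel_measurable_cnj [measurable]: "cnj \<in> borel_measurable borel"
  by (intro borel_measurable_continuous_onI continuous_intros)

text \<open>The axioms are those that pass to finite products in the same form: the bound 1 is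
  preserved, \<open>B\<close> becomes a power of itself and coefficients multiply.
  \<open>energy\<close> is the upper half of Parseval's identity; the other half is Bessel's
  inequality and follows from \<open>orthonormal\<close>.\<close>

locale parseval_system = prob_space M for M :: "'a measure" +
  fixes I :: "'i set" and \<phi> :: "'i \<Rightarrow> 'a \<Rightarrow> complex" and f :: "'a \<Rightarrow> complex"
    and c :: "'i \<Rightarrow> complex" and B :: real
  assumes countable_I: "countable I"
    and phi_measurable: "\<And>i. i \<in> I \<Longrightarrow> \<phi> i \<in> borel_measurable M"
    and phi_bound: "\<And>i x. i \<in> I \<Longrightarrow> x \<in> space M \<Longrightarrow> norm (\<phi> i x) \<le> 1"
    and orthonormal: "\<And>i j. i \<in> I \<Longrightarrow> j \<in> I \<Longrightarrow>
          (LINT x|M. \<phi> i x * cnj (\<phi> j x)) = (if i = j then 1 else 0)"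
    and f_measurable: "f \<in> borel_measurable M"
    and f_bound: "\<And>x. x \<in> space M \<Longrightarrow> norm (f x) \<le> B"
    and coeff: "\<And>i. i \<in> I \<Longrightarrow> (LINT x|M. f x * cnj (\<phi> i x)) = c i"
    and energy: "(\<integral>\<^sup>+x. ennreal ((norm (f x))\<^sup>2) \<partial>M) \<le> (\<integral>\<^sup>+i. ennreal ((norm (c i))\<^sup>2) \<partial>count_space I)"
begin

lemma integrable_bounded:
  fixes g :: "'a \<Rightarrow> 'b :: {banach, second_countable_topology}"
  assumes "g \<in> borel_measurable M" "\<And>x. x \<in> space M \<Longrightarrow> norm (g x) \<le> b"
  shows "integrable M g"
  using assms by (intro integrable_const_bound[of g b]) auto

lemma B_nonneg: "0 \<le> B"
  using f_bound not_empty norm_ge_zero order_trans by blast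

text \<open>Pythagoras: removing the partial sum over \<open>F\<close> lowers the energy of
  \<open>f\<close> by exactly the energy \<open>s\<close> of that sum. The same \<open>s\<close>
  splits off the series of squared coefficients and, being finite, can be cancelled in
  \<open>energy\<close>.\<close>

lemma energy_tail:
  assumes F: "finite F" "F \<subseteq> I"
  shows "(\<integral>\<^sup>+x. ennreal ((norm (f x - (\<Sum>i\<in>F. c i * \<phi> i x)))\<^sup>2) \<partial>M)
          \<le> (\<integral>\<^sup>+i. ennreal ((norm (c i))\<^sup>2) \<partial>count_space (I - F))"
proof -
  define g where "g x = (\<Sum>i\<in>F. c i * \<phi> i x)" for x
  define G where "G = (\<Sum>i\<in>F. norm (c i))"
  note [measurable] = f_measurable
  have phi [measurable]: "\<phi> i \<in> borel_measurable M" if "i \<in> F" for i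
    using phi_measurable that F by auto
  have g_meas [measurable]: "g \<in> borel_measurable M"
    unfolding g_def by measurable
  have gb: "norm (g x) \<le> G" if "x \<in> space M" for x
    unfolding g_def G_def
  proof (rule order_trans[OF norm_sum], rule sum_mono)
    fix i assume "i \<in> F"
    then show "norm (c i * \<phi> i x) \<le> norm (c i)"
      using phi_bound[of i x] F that by (auto simp: norm_mult intro!: mult_left_le)
  qed
  have if1: "integrable M (\<lambda>x. f x * cnj (\<phi> i x))" if "i \<in> F" for i
  proof (rule integrable_bounded[of _ "B * 1"])
    show "(\<lambda>x. f x * cnj (\<phi> i x)) \<in> borel_measurable M" using phi[OF that] by measurable
    show "norm (f x * cnj (\<phi> i x)) \<le> B * 1" if "x \<in> space M" for x
      unfolding norm_mult complex_mod_cnj using f_bound phi_bound F \<open>i \<in> F\<close> that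
      by (intro mult_mono B_nonneg) auto
  qed
  have ipp: "integrable M (\<lambda>x. \<phi> i x * cnj (\<phi> j x))" if "i \<in> F" "j \<in> F" for i j
  proof (rule integrable_bounded[of _ "1 * 1"])
    show "(\<lambda>x. \<phi> i x * cnj (\<phi> j x)) \<in> borel_measurable M" using phi that by measurable
    show "norm (\<phi> i x * cnj (\<phi> j x)) \<le> 1 * 1" if "x \<in> space M" for x
      unfolding norm_mult complex_mod_cnj using phi_bound F \<open>i \<in> F\<close> \<open>j \<in> F\<close> that
      by (intro mult_mono) auto
  qed
  define s where "s = (\<Sum>i\<in>F. (norm (c i))\<^sup>2)"
  have s0: "s \<ge> 0" unfolding s_def by (simp add: sum_nonneg)
  have fg: "(LINT x|M. f x * cnj (g x)) = of_real s" and ifg: "integrable M (\<lambda>x. f x * cnj (g x))"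
  proof -
    have eq: "(\<lambda>x. f x * cnj (g x)) = (\<lambda>x. \<Sum>i\<in>F. cnj (c i) * (f x * cnj (\<phi> i x)))"
      by (auto simp: g_def sum_distrib_left mult_ac)
    show "integrable M (\<lambda>x. f x * cnj (g x))"
      unfolding eq by (intro Bochner_Integration.integrable_sum integrable_mult_right if1)
    have "(LINT x|M. f x * cnj (g x)) = (\<Sum>i\<in>F. cnj (c i) * c i)"
      unfolding eq using if1 F by (subst Bochner_Integration.integral_sum) (auto intro!: sum.cong coeff)
    also have "\<dots> = of_real s"
      unfolding s_def of_real_sum by (intro sum.cong refl) (metis complex_norm_square mult.commute)
    finally show "(LINT x|M. f x * cnj (g x)) = of_real s" .
  qed
  have gg: "(LINT x|M. g x * cnj (g x)) = of_real s" and igg: "integrable M (\<lambda>x. g x * cnj (g x))"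
  proof -
    have eq: "(\<lambda>x. g x * cnj (g x)) = (\<lambda>x. \<Sum>i\<in>F. \<Sum>j\<in>F. (c i * cnj (c j)) * (\<phi> i x * cnj (\<phi> j x)))"
      by (auto simp: g_def sum_product mult_ac)
    show "integrable M (\<lambda>x. g x * cnj (g x))"
      unfolding eq by (intro Bochner_Integration.integrable_sum integrable_mult_right ipp)
    have "(LINT x|M. g x * cnj (g x)) = (\<Sum>i\<in>F. \<Sum>j\<in>F. (c i * cnj (c j)) * (if i = j then 1 else 0))"
    proof -
      have "(LINT x|M. (\<Sum>i\<in>F. \<Sum>j\<in>F. (c i * cnj (c j)) * (\<phi> i x * cnj (\<phi> j x))))
          = (\<Sum>i\<in>F. LINT x|M. (\<Sum>j\<in>F. (c i * cnj (c j)) * (\<phi> i x * cnj (\<phi> j x))))"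
        by (intro Bochner_Integration.integral_sum Bochner_Integration.integrable_sum integrable_mult_right ipp)
      also have "\<dots> = (\<Sum>i\<in>F. \<Sum>j\<in>F. LINT x|M. (c i * cnj (c j)) * (\<phi> i x * cnj (\<phi> j x)))"
        by (intro sum.cong refl Bochner_Integration.integral_sum integrable_mult_right ipp)
      also have "\<dots> = (\<Sum>i\<in>F. \<Sum>j\<in>F. (c i * cnj (c j)) * (if i = j then 1 else 0))"
        using F by (intro sum.cong refl) (auto simp: orthonormal subset_iff)
      finally show ?thesis unfolding eq .
    qed
    also have "\<dots> = (\<Sum>i\<in>F. c i * cnj (c i))"
      using F by (simp add: if_distrib[of "\<lambda>z. _ * z"] sum.delta cong: if_cong)
    also have "\<dots> = of_real s"
      unfolding s_def of_real_sum by (intro sum.cong refl) (metis complex_norm_square)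
    finally show "(LINT x|M. g x * cnj (g x)) = of_real s" .
  qed
  have iff: "integrable M (\<lambda>x. (norm (f x))\<^sup>2)"
    by (rule integrable_bounded[of _ "B\<^sup>2"]) (auto intro!: power_mono f_bound)
  have idiff: "integrable M (\<lambda>x. (norm (f x - g x))\<^sup>2)"
  proof (rule integrable_bounded[of _ "(B + G)\<^sup>2"])
    show "norm ((norm (f x - g x))\<^sup>2) \<le> (B + G)\<^sup>2" if "x \<in> space M" for x
      using norm_triangle_ineq4[of "f x" "g x"] f_bound[OF that] gb[OF that]
      by (auto intro!: power_mono)
  qed measurable
  \<comment> \<open>The cross term and the energy of \<open>g\<close> both have integral
    \<open>s\<close>, so this identity integrates to a surplus of 2 s - s.\<close>
  have pt: "(norm (f x))\<^sup>2 = (norm (f x - g x))\<^sup>2 + 2 * Re (f x * cnj (g x)) - Re (g x * cnj (g x))" for x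
    unfolding cmod_power2 by (simp add: power2_eq_square algebra_simps)
  have "(LINT x|M. (norm (f x))\<^sup>2)
      = (LINT x|M. (norm (f x - g x))\<^sup>2) + 2 * Re (LINT x|M. f x * cnj (g x)) - Re (LINT x|M. g x * cnj (g x))"
  proof -
    define u v where "u x = f x * cnj (g x)" and "v x = g x * cnj (g x)" for x
    have "integrable M u" "integrable M v" using ifg igg by (simp_all add: u_def[abs_def] v_def[abs_def])
    then show ?thesis
      unfolding pt using idiff unfolding u_def[symmetric] v_def[symmetric] by (simp add: integral_Re)
  qed
  also have "\<dots> = (LINT x|M. (norm (f x - g x))\<^sup>2) + s"
    by (simp add: fg gg)
  finally have real_eq: "(LINT x|M. (norm (f x))\<^sup>2) = (LINT x|M. (norm (f x - g x))\<^sup>2) + s" .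
  have "ennreal s + (\<integral>\<^sup>+x. ennreal ((norm (f x - g x))\<^sup>2) \<partial>M) = (\<integral>\<^sup>+x. ennreal ((norm (f x))\<^sup>2) \<partial>M)"
    using iff idiff real_eq s0 by (simp add: nn_integral_eq_integral ennreal_plus[symmetric] add.commute del: ennreal_plus)
  also note energy
  also have "(\<integral>\<^sup>+i. ennreal ((norm (c i))\<^sup>2) \<partial>count_space I)
      = (\<integral>\<^sup>+i. ennreal ((norm (c i))\<^sup>2) \<partial>count_space F) + (\<integral>\<^sup>+i. ennreal ((norm (c i))\<^sup>2) \<partial>count_space (I - F))"
    using F nn_integral_disjoint_pair_countspace[of F "I - F"  "\<lambda>i. ennreal ((norm (c i))\<^sup>2)"]
    by (simp add: Un_absorb1 nn_integral_count_space_indicator)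
  also have "(\<integral>\<^sup>+i. ennreal ((norm (c i))\<^sup>2) \<partial>count_space F) = ennreal s"
    using F by (simp add: nn_integral_count_space_finite s_def)
  finally show ?thesis
    unfolding g_def by (subst (asm) ennreal_add_left_cancel_le) simp
qed

end

section \<open>Dyadic sums over level sets of weak l^q sequences\<close>

lemma nn_integral_suminf_dominates:
  fixes h :: "'a \<Rightarrow> ennreal" and g :: "nat \<Rightarrow> 'a \<Rightarrow> ennreal"
  assumes "\<And>k. g k \<in> borel_measurable M" "\<And>x. x \<in> space M \<Longrightarrow> h x > 0 \<Longrightarrow> \<exists>k. h x \<le> g k x"
  shows "(\<integral>\<^sup>+x. h x \<partial>M) \<le> (\<Sum>k. \<integral>\<^sup>+x. g k x \<partial>M)"
proof -
  have "(\<integral>\<^sup>+x. h x \<partial>M) \<le> (\<integral>\<^sup>+x. (\<Sum>k. g k x) \<partial>M)"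
  proof (rule nn_integral_mono)
    fix x assume x: "x \<in> space M"
    show "h x \<le> (\<Sum>k. g k x)"
    proof (cases "h x > 0")
      case True
      then obtain k where "h x \<le> g k x" using assms(2) x by blast
      also have "g k x \<le> (\<Sum>k. g k x)"
        using sum_le_suminf[of "\<lambda>k. g k x" "{k}"] by simp
      finally show ?thesis .
    qed auto
  qed
  also have "\<dots> = (\<Sum>k. \<integral>\<^sup>+x. g k x \<partial>M)"
    by (rule nn_integral_suminf) (rule assms)
  finally show ?thesis .
qed

lemma dyadic_level:
  fixes s y :: real
  assumes "0 < s" "s < y"
  shows "\<exists>k. 2 ^ k * s < y \<and> y \<le> 2 ^ Suc k * s"
proof -
  obtain n where n: "y / s < 2 ^ n" using real_arch_pow[of 2 "y / s"] by auto
  then have ex: "\<exists>n. y \<le> 2 ^ n * s" using assms by (auto simp: field_simps intro: less_imp_le)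
  define m where "m = (LEAST n. y \<le> 2 ^ n * s)"
  have m: "y \<le> 2 ^ m * s" unfolding m_def using ex by (rule LeastI_ex)
  have "m \<noteq> 0" using m assms by (metis mult_1 not_le power_0)
  then obtain k where k: "m = Suc k" using not0_implies_Suc by blast
  then have "\<not> y \<le> 2 ^ k * s" using not_less_Least[of k "\<lambda>n. y \<le> 2 ^ n * s"] unfolding m_def by auto
  then show ?thesis using m k by (intro exI[of _ k]) auto
qed

text \<open>The strict end has moved: this variant is applied with the cut height as
  \<open>y\<close> and a small coefficient as \<open>s\<close>, and after division its strict upper
  end becomes the strict lower end that level sets {> t} ask for.\<close>

lemma dyadic_level':
  fixes s y :: real
  assumes "0 < s" "s \<le> y"
  shows "\<exists>k. 2 ^ k * s \<le> y \<and> y < 2 ^ Suc k * s"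
proof -
  obtain n where n: "y / s < 2 ^ n" using real_arch_pow[of 2 "y / s"] by auto
  then have ex: "\<exists>n. y < 2 ^ n * s" using assms by (auto simp: field_simps)
  define m where "m = (LEAST n. y < 2 ^ n * s)"
  have m: "y < 2 ^ m * s" unfolding m_def using ex by (rule LeastI_ex)
  have "m \<noteq> 0" using m assms by (metis mult_1 not_le power_0)
  then obtain k where k: "m = Suc k" using not0_implies_Suc by blast
  then have "\<not> y < 2 ^ k * s" using not_less_Least[of k "\<lambda>n. y < 2 ^ n * s"] unfolding m_def by auto
  then show ?thesis using m k by (intro exI[of _ k]) auto
qed

lemma suminf_ennreal_geometric:
  assumes "0 \<le> a" "0 \<le> r" "r < 1"
  shows "(\<Sum>k. ennreal (a * r ^ k)) = ennreal (a / (1 - r))"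
proof -
  have "(\<lambda>k. a * r ^ k) sums (a * (1 / (1 - r)))"
    using assms by (intro sums_mult geometric_sums) auto
  then show ?thesis
    using assms by (intro suminf_ennreal_eq) auto
qed

lemma weak_Lq_distribution:
  assumes "0 \<le> W" "0 < t" "ennreal (t powr q) * X \<le> ennreal W"
  shows "X \<le> ennreal (t powr (-q) * W)"
proof -
  have "X = ennreal (t powr (-q)) * (ennreal (t powr q) * X)"
    using assms by (simp add: mult.assoc[symmetric] ennreal_mult[symmetric] powr_add[symmetric])
  also have "\<dots> \<le> ennreal (t powr (-q)) * ennreal W"
    by (intro mult_left_mono assms) simp
  finally show ?thesis using assms by (simp add: ennreal_mult)
qed

text \<open>A coefficient between 2^k s and 2^(k+1) s is charged the upper end, and the weak bound
  allows at most (2^k s)^(-q) W of them. The resulting series has ratio 2^(1-q), below 1 because q >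
  1.\<close>

lemma weak_Lq_large_part:
  fixes c :: "'i \<Rightarrow> complex"
  assumes q: "1 < q" and s: "0 < s" and W: "0 \<le> W"
    and weak: "\<And>t. t > 0 \<Longrightarrow> ennreal (t powr q) * emeasure (count_space I) {i\<in>I. norm (c i) > t} \<le> ennreal W"
  shows "(\<integral>\<^sup>+i. ennreal (norm (c i)) \<partial>count_space {i\<in>I. norm (c i) > s})
           \<le> ennreal (2 / (1 - 2 powr (1 - q)) * s powr (1 - q) * W)"
proof -
  have weak': "emeasure (count_space I) {i\<in>I. norm (c i) > t} \<le> ennreal (t powr (-q) * W)" if "t > 0" for t
    by (rule weak_Lq_distribution[OF W that weak[OF that]])
  have "(\<integral>\<^sup>+i. ennreal (norm (c i)) \<partial>count_space {i\<in>I. norm (c i) > s})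
      = (\<integral>\<^sup>+i. ennreal (norm (c i)) * indicator {i\<in>I. norm (c i) > s} i \<partial>count_space I)"
    by (subst nn_integral_restrict_space[symmetric])
      (auto simp: restrict_count_space intro!: nn_integral_cong_simp arg_cong2[where f=nn_integral] arg_cong[where f=count_space])
  also have "\<dots> \<le> (\<Sum>k. \<integral>\<^sup>+i. ennreal (2 ^ Suc k * s) * indicator {i\<in>I. norm (c i) > 2 ^ k * s} i \<partial>count_space I)"
  proof (rule nn_integral_suminf_dominates, simp)
    fix i assume i: "i \<in> space (count_space I)" and h: "0 < ennreal (norm (c i)) * indicator {i\<in>I. norm (c i) > s} i"
    then have "s < norm (c i)" by (cases "s < norm (c i)") auto
    from dyadic_level[OF s this] obtain k where "2 ^ k * s < norm (c i)" "norm (c i) \<le> 2 ^ Suc k * s" by blast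
    then show "\<exists>k. ennreal (norm (c i)) * indicator {i\<in>I. norm (c i) > s} i
       \<le> ennreal (2 ^ Suc k * s) * indicator {i\<in>I. norm (c i) > 2 ^ k * s} i"
      using i by (intro exI[of _ k]) (auto simp: indicator_def intro!: ennreal_leI)
  qed
  also have "\<dots> \<le> (\<Sum>k. ennreal ((2 * s powr (1 - q) * W) * (2 powr (1 - q)) ^ k))"
  proof (rule suminf_le)
    fix k
    have "(\<integral>\<^sup>+i. ennreal (2 ^ Suc k * s) * indicator {i\<in>I. norm (c i) > 2 ^ k * s} i \<partial>count_space I)
       = ennreal (2 ^ Suc k * s) * emeasure (count_space I) {i\<in>I. norm (c i) > 2 ^ k * s}"
      by (subst nn_integral_cmult_indicator) auto
    also have "\<dots> \<le> ennreal (2 ^ Suc k * s) * ennreal ((2 ^ k * s) powr (-q) * W)"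
      using s by (intro mult_left_mono weak') auto
    also have "\<dots> = ennreal (2 ^ Suc k * s * ((2 ^ k * s) powr (-q) * W))"
      using s W by (simp add: ennreal_mult[symmetric])
    also have "2 ^ Suc k * s * ((2 ^ k * s) powr (-q) * W) = (2 * s powr (1 - q) * W) * (2 powr (1 - q)) ^ k"
    proof -
      have e1: "(2 ^ k * s) powr (1 - q) = (2 ^ k * s) * (2 ^ k * s) powr (-q)"
        using s powr_add[of "2 ^ k * s" 1 "-q"] by simp
      have e2: "(2 ^ k * s) powr (1 - q) = (2 powr (1 - q)) ^ k * s powr (1 - q)"
      proof -
        have "(2 ^ k) powr (1 - q) = (2 powr (1 - q)) ^ k"
          by (simp add: powr_realpow[symmetric] powr_powr mult.commute)
        then show ?thesis using s by (simp add: powr_mult)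
      qed
      have "2 ^ Suc k * s * ((2 ^ k * s) powr (-q) * W) = 2 * W * ((2 ^ k * s) * (2 ^ k * s) powr (-q))"
        by (simp only: power_Suc mult_ac)
      also have "\<dots> = 2 * W * ((2 powr (1 - q)) ^ k * s powr (1 - q))"
        using e1 e2 by simp
      finally show ?thesis by (simp only: mult_ac)
    qed
    finally show "(\<integral>\<^sup>+i. ennreal (2 ^ Suc k * s) * indicator {i\<in>I. norm (c i) > 2 ^ k * s} i \<partial>count_space I)
       \<le> ennreal ((2 * s powr (1 - q) * W) * (2 powr (1 - q)) ^ k)" .
  qed auto
  also have "\<dots> = ennreal ((2 * s powr (1 - q) * W) / (1 - 2 powr (1 - q)))"
    using q W powr_less_mono[of "1 - q" 0 2] by (intro suminf_ennreal_geometric) auto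
  finally show ?thesis by (simp add: mult_ac)
qed

text \<open>Mirror image of the preceding bound, with levels descending from \<open>s\<close>: per
  level the squares gain a factor 1/4 while the counts lose 2^q, so the ratio is 2^(q-2), below 1
  because q < 2. The leading 2^q comes from counting at the lower end s / 2^(k+1) of each
  layer.\<close>

lemma weak_Lq_small_part:
  fixes c :: "'i \<Rightarrow> complex"
  assumes q: "q < 2" and s: "0 < s" and W: "0 \<le> W"
    and weak: "\<And>t. t > 0 \<Longrightarrow> ennreal (t powr q) * emeasure (count_space I) {i\<in>I. norm (c i) > t} \<le> ennreal W"
  shows "(\<integral>\<^sup>+i. ennreal ((norm (c i))\<^sup>2) \<partial>count_space {i\<in>I. norm (c i) \<le> s})
           \<le> ennreal (2 powr q / (1 - 2 powr (q - 2)) * s powr (2 - q) * W)"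
proof -
  have weak': "emeasure (count_space I) {i\<in>I. norm (c i) > t} \<le> ennreal (t powr (-q) * W)" if "t > 0" for t
    by (rule weak_Lq_distribution[OF W that weak[OF that]])
  have "(\<integral>\<^sup>+i. ennreal ((norm (c i))\<^sup>2) \<partial>count_space {i\<in>I. norm (c i) \<le> s})
      = (\<integral>\<^sup>+i. ennreal ((norm (c i))\<^sup>2) * indicator {i\<in>I. norm (c i) \<le> s} i \<partial>count_space I)"
    by (subst nn_integral_restrict_space[symmetric])
      (auto simp: restrict_count_space intro!: nn_integral_cong_simp arg_cong2[where f=nn_integral] arg_cong[where f=count_space])
  also have "\<dots> \<le> (\<Sum>k. \<integral>\<^sup>+i. ennreal ((s / 2 ^ k)\<^sup>2) * indicator {i\<in>I. norm (c i) > s / 2 ^ Suc k} i \<partial>count_space I)"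
  proof (rule nn_integral_suminf_dominates, simp)
    fix i assume i: "i \<in> space (count_space I)" and h: "0 < ennreal ((norm (c i))\<^sup>2) * indicator {i\<in>I. norm (c i) \<le> s} i"
    then have ci: "norm (c i) \<le> s" by (cases "norm (c i) \<le> s") auto
    have ci0: "norm (c i) > 0" using h by (cases "c i = 0") auto
    note ci = ci ci0
    from dyadic_level'[OF ci0 ci(1)] obtain k where
      k: "2 ^ k * norm (c i) \<le> s" "s < 2 ^ Suc k * norm (c i)" by blast
    then have "norm (c i) \<le> s / 2 ^ k" "s / 2 ^ Suc k < norm (c i)"
      by (auto simp: field_simps)
    then show "\<exists>k. ennreal ((norm (c i))\<^sup>2) * indicator {i\<in>I. norm (c i) \<le> s} i
       \<le> ennreal ((s / 2 ^ k)\<^sup>2) * indicator {i\<in>I. norm (c i) > s / 2 ^ Suc k} i"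
      using i ci by (intro exI[of _ k]) (auto simp: indicator_def intro!: ennreal_leI power_mono)
  qed
  also have "\<dots> \<le> (\<Sum>k. ennreal ((2 powr q * s powr (2 - q) * W) * (2 powr (q - 2)) ^ k))"
  proof (rule suminf_le)
    fix k
    have "(\<integral>\<^sup>+i. ennreal ((s / 2 ^ k)\<^sup>2) * indicator {i\<in>I. norm (c i) > s / 2 ^ Suc k} i \<partial>count_space I)
       = ennreal ((s / 2 ^ k)\<^sup>2) * emeasure (count_space I) {i\<in>I. norm (c i) > s / 2 ^ Suc k}"
      by (subst nn_integral_cmult_indicator) auto
    also have "\<dots> \<le> ennreal ((s / 2 ^ k)\<^sup>2) * ennreal ((s / 2 ^ Suc k) powr (-q) * W)"
      using s by (intro mult_left_mono weak') auto
    also have "\<dots> = ennreal ((s / 2 ^ k)\<^sup>2 * ((s / 2 ^ Suc k) powr (-q) * W))"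
      using s W by (simp add: ennreal_mult[symmetric])
    also have "(s / 2 ^ k)\<^sup>2 * ((s / 2 ^ Suc k) powr (-q) * W) = (2 powr q * s powr (2 - q) * W) * (2 powr (q - 2)) ^ k"
    proof -
      let ?u = "s / 2 ^ k"
      have u: "?u > 0" using s by simp
      have e0: "(s / 2 ^ Suc k) powr (-q) = 2 powr q * ?u powr (-q)"
      proof -
        have "s / 2 ^ Suc k = (1 / 2) * ?u" by simp
        then have "(s / 2 ^ Suc k) powr (-q) = (1 / 2) powr (-q) * ?u powr (-q)"
          using u by (metis powr_mult less_imp_le half_gt_zero zero_less_one)
        moreover have "(1 / 2) powr (-q) = 2 powr q" by (simp add: powr_divide powr_minus field_simps)
        ultimately show ?thesis by simp
      qed
      have e1: "?u\<^sup>2 * ?u powr (-q) = ?u powr (2 - q)"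
        using u powr_add[of ?u 2 "-q"] by simp
      have e2: "?u powr (2 - q) = s powr (2 - q) * (2 powr (q - 2)) ^ k"
      proof -
        have "(2 powr (q - 2)) ^ k = (2 ^ k) powr (q - 2)"
          by (simp add: powr_realpow[symmetric] powr_powr mult.commute)
        also have "\<dots> = 1 / (2 ^ k) powr (2 - q)" using powr_minus_divide[of "2 ^ k" "2 - q"] by simp
        finally show ?thesis using s by (simp add: powr_divide)
      qed
      show ?thesis unfolding e0 using e1 e2 by (simp add: algebra_simps)
    qed
    finally show "(\<integral>\<^sup>+i. ennreal ((s / 2 ^ k)\<^sup>2) * indicator {i\<in>I. norm (c i) > s / 2 ^ Suc k} i \<partial>count_space I)
       \<le> ennreal ((2 powr q * s powr (2 - q) * W) * (2 powr (q - 2)) ^ k)" .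
  qed auto
  also have "\<dots> = ennreal ((2 powr q * s powr (2 - q) * W) / (1 - 2 powr (q - 2)))"
    using q W powr_less_mono[of "q - 2" 0 2] by (intro suminf_ennreal_geometric) auto
  finally show ?thesis by (simp add: mult_ac)
qed

text \<open>The 4 is Chebyshev's inequality at height t/2, the second factor belongs to the small
  coefficients, and the base of the last power is twice the constant of the large ones, which enters
  through the choice of the cut height.\<close>

definition weak_type_const :: "real \<Rightarrow> real \<Rightarrow> real" where
  "weak_type_const p q =
     4 * (2 powr q / (1 - 2 powr (q - 2))) * (2 * (2 / (1 - 2 powr (1 - q)))) powr (p - 2)"

lemma weak_type_const_pos: "1 < q \<Longrightarrow> q < 2 \<Longrightarrow> weak_type_const p q > 0"
  using powr_less_mono[of "q - 2" 0 2] powr_less_mono[of "1 - q" 0 2]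
  unfolding weak_type_const_def by auto

lemma conjugate_exponent:
  fixes p q :: real
  assumes "2 < p" "1 / p + 1 / q = 1"
  shows "1 < q" "q < 2" "p = q / (q - 1)" "p / q = p - 1" "1 / (q - 1) = p - 1"
proof -
  \<comment> \<open>Since \<open>1 / 0 = 0\<close>, the value \<open>q = 0\<close> would force
    \<open>p = 1\<close>.\<close>
  have q0: "q \<noteq> 0" using assms by auto
  have e: "p + q = p * q" using assms q0 by (auto simp: field_simps)
  then have e': "q * (p - 1) = p" by (simp add: algebra_simps)
  have q: "q = p / (p - 1)" using e' assms by (auto simp: field_simps)
  show "1 < q" "q < 2" using assms by (auto simp: q field_simps)
  then show "p = q / (q - 1)" "p / q = p - 1" "1 / (q - 1) = p - 1"
    using e by (auto simp: field_simps)
qed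

section \<open>The weak-type Hausdorff-Young inequality\<close>

context parseval_system
begin

lemma weak_type_pos:
  assumes pq: "2 < p" "1 / p + 1 / q = 1" and W: "0 < W" and t: "0 < t"
    and weak: "\<And>t. t > 0 \<Longrightarrow> ennreal (t powr q) * emeasure (count_space I) {i\<in>I. norm (c i) > t} \<le> ennreal W"
  shows "ennreal (t powr p) * emeasure M {x\<in>space M. norm (f x) > t}
           \<le> ennreal (weak_type_const p q * W powr (p - 1))"
proof -
  note q = conjugate_exponent[OF pq]
  note [measurable] = f_measurable
  define \<alpha> where "\<alpha> = 2 / (1 - 2 powr (1 - q))"
  define \<beta> where "\<beta> = 2 powr q / (1 - 2 powr (q - 2))"
  have \<alpha>: "\<alpha> > 0" and \<beta>: "\<beta> > 0"
    using q powr_less_mono[of "q - 2" 0 2] powr_less_mono[of "1 - q" 0 2] unfolding \<alpha>_def \<beta>_def by auto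
  \<comment> \<open>The level \<open>s\<close> is chosen so that the part of \<open>f\<close> carried by the coefficients above \<open>s\<close> is at most \<open>t / 2\<close>.\<close>
  define s where "s = (2 * \<alpha> * W / t) powr (p - 1)"
  have s: "s > 0" using \<alpha> W t by (simp add: s_def)
  have s1: "\<alpha> * s powr (1 - q) * W = t / 2"
  proof -
    have "(p - 1) * (1 - q) = -1" using q by (simp add: field_simps)
    then have "s powr (1 - q) = (2 * \<alpha> * W / t) powr (-1)" by (simp add: s_def powr_powr)
    also have "\<dots> = t / (2 * \<alpha> * W)" using \<alpha> W t by (simp add: powr_minus_divide)
    finally show ?thesis using \<alpha> W by simp
  qed
  have s2: "s powr (2 - q) = (2 * \<alpha> * W / t) powr (p - 2)"
  proof -
    have "(p - 1) * (2 - q) = p - 2" using q by (simp add: field_simps)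
    then show ?thesis by (simp add: s_def powr_powr)
  qed
  define F where "F = {i\<in>I. norm (c i) > s}"
  \<comment> \<open>The weak bound at the single height \<open>s\<close> already limits the number
    of coefficients above it; an infinite set has infinite counting measure.\<close>
  have fin: "finite F"
  proof (rule ccontr)
    assume "infinite F"
    then have "emeasure (count_space I) F = \<infinity>" unfolding F_def by (subst emeasure_count_space) auto
    then have "ennreal (s powr q) * \<infinity> \<le> ennreal W" using weak[OF s] by (simp add: F_def)
    then show False using s by (simp add: ennreal_mult_top top_unique)
  qed
  have FI: "F \<subseteq> I" by (auto simp: F_def)
  have phi [measurable]: "\<phi> i \<in> borel_measurable M" if "i \<in> F" for i
    using phi_measurable that FI by auto
  define g where "g x = (\<Sum>i\<in>F. c i * \<phi> i x)" for x
  have g_meas [measurable]: "g \<in> borel_measurable M" unfolding g_def by measurable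
  have "ennreal (\<Sum>i\<in>F. norm (c i)) = (\<integral>\<^sup>+i. ennreal (norm (c i)) \<partial>count_space F)"
    using fin by (simp add: nn_integral_count_space_finite)
  also have "\<dots> \<le> ennreal (\<alpha> * s powr (1 - q) * W)"
    unfolding F_def \<alpha>_def using q s W by (intro weak_Lq_large_part weak) auto
  finally have sumF: "(\<Sum>i\<in>F. norm (c i)) \<le> t / 2" using t by (simp add: s1)
  have gb: "norm (g x) \<le> t / 2" if "x \<in> space M" for x
  proof -
    have "norm (g x) \<le> (\<Sum>i\<in>F. norm (c i))"
      unfolding g_def
    proof (rule order_trans[OF norm_sum], rule sum_mono)
      fix i assume "i \<in> F"
      then show "norm (c i * \<phi> i x) \<le> norm (c i)"
        using phi_bound[of i x] FI that by (auto simp: norm_mult intro!: mult_left_le)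
    qed
    then show ?thesis using sumF by simp
  qed
  \<comment> \<open>Where \<open>f\<close> exceeds \<open>t\<close> the remainder
    \<open>f - g\<close> is at least t/2, because \<open>g\<close> stays below t/2. What follows is
    Chebyshev's inequality for the squared remainder.\<close>
  have "emeasure M {x\<in>space M. norm (f x) > t} \<le> emeasure M {x\<in>space M. 1 \<le> ennreal ((2 / t)\<^sup>2) * ennreal ((norm (f x - g x))\<^sup>2)}"
  proof (rule emeasure_mono, safe)
    fix x assume x: "x \<in> space M" "t < norm (f x)"
    have "t / 2 \<le> norm (f x - g x)" using norm_triangle_ineq2[of "f x" "g x"] gb[OF x(1)] x(2) by linarith
    then have "1 \<le> (2 / t) * norm (f x - g x)" using t by (simp add: field_simps)
    then have "1 \<le> ((2 / t) * norm (f x - g x))\<^sup>2" by (simp add: one_le_power)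
    then show "1 \<le> ennreal ((2 / t)\<^sup>2) * ennreal ((norm (f x - g x))\<^sup>2)"
      by (simp add: ennreal_mult[symmetric] power_mult_distrib[symmetric] del: ennreal_1 flip: ennreal_1)
  qed measurable
  also have "\<dots> = emeasure M ({x\<in>space M. 1 \<le> ennreal ((2 / t)\<^sup>2) * ennreal ((norm (f x - g x))\<^sup>2)} \<inter> space M)"
    by (intro arg_cong2[where f=emeasure]) auto
  also have "\<dots> \<le> ennreal ((2 / t)\<^sup>2) * (\<integral>\<^sup>+x. ennreal ((norm (f x - g x))\<^sup>2) * indicator (space M) x \<partial>M)"
    using nn_integral_Markov_inequality[of "\<lambda>x. ennreal ((norm (f x - g x))\<^sup>2)" "space M" M "ennreal ((2 / t)\<^sup>2)"]
    by (simp add: Int_def conj_commute)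
  also have "(\<integral>\<^sup>+x. ennreal ((norm (f x - g x))\<^sup>2) * indicator (space M) x \<partial>M)
      = (\<integral>\<^sup>+x. ennreal ((norm (f x - g x))\<^sup>2) \<partial>M)"
    by (intro nn_integral_cong) auto
  also have "\<dots> \<le> (\<integral>\<^sup>+i. ennreal ((norm (c i))\<^sup>2) \<partial>count_space (I - F))"
    unfolding g_def by (rule energy_tail[OF fin FI])
  also have "I - F = {i\<in>I. norm (c i) \<le> s}" by (auto simp: F_def)
  also have "(\<integral>\<^sup>+i. ennreal ((norm (c i))\<^sup>2) \<partial>count_space {i\<in>I. norm (c i) \<le> s})
      \<le> ennreal (\<beta> * s powr (2 - q) * W)"
    unfolding \<beta>_def using q s W by (intro weak_Lq_small_part weak) auto
  finally have "emeasure M {x\<in>space M. norm (f x) > t} \<le> ennreal ((2 / t)\<^sup>2) * ennreal (\<beta> * s powr (2 - q) * W)"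
    by (simp add: mult_left_mono)
  then have "ennreal (t powr p) * emeasure M {x\<in>space M. norm (f x) > t}
     \<le> ennreal (t powr p) * (ennreal ((2 / t)\<^sup>2) * ennreal (\<beta> * s powr (2 - q) * W))"
    by (rule mult_left_mono) simp
  also have "\<dots> = ennreal (t powr p * ((2 / t)\<^sup>2 * (\<beta> * s powr (2 - q) * W)))"
    using t \<beta> W by (simp add: ennreal_mult[symmetric])
  also have "t powr p * ((2 / t)\<^sup>2 * (\<beta> * s powr (2 - q) * W)) = weak_type_const p q * W powr (p - 1)"
  proof -
    \<comment> \<open>The factor t^2 cancels Chebyshev's (2/t)^2, and t^(p-2) cancels the power of t
      contributed by the cut height, so the bound is free of \<open>t\<close>.\<close>
    have a: "t powr p = t powr (p - 2) * t\<^sup>2" using t powr_add[of t "p - 2" 2] by simp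
    have b: "s powr (2 - q) = (2 * \<alpha>) powr (p - 2) * W powr (p - 2) / t powr (p - 2)"
      unfolding s2 using \<alpha> W t by (simp add: powr_mult powr_divide)
    have cc: "W powr (p - 1) = W powr (p - 2) * W" using W powr_add[of W "p - 2" 1] by simp
    show ?thesis
      unfolding a b cc weak_type_const_def \<alpha>_def[symmetric] \<beta>_def[symmetric]
      using t by (simp add: field_simps power2_eq_square)
  qed
  finally show ?thesis .
qed

text \<open>The cut height degenerates for \<open>W = 0\<close>, so that case is a limit of the
  bounds for W + e; the right side is continuous there because p - 1 > 0.\<close>

lemma weak_type:
  assumes pq: "2 < p" "1 / p + 1 / q = 1" and W: "0 \<le> W" and t: "0 < t"
    and weak: "\<And>t. t > 0 \<Longrightarrow> ennreal (t powr q) * emeasure (count_space I) {i\<in>I. norm (c i) > t} \<le> ennreal W"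
  shows "ennreal (t powr p) * emeasure M {x\<in>space M. norm (f x) > t}
           \<le> ennreal (weak_type_const p q * W powr (p - 1))"
proof -
  have "((\<lambda>e. ennreal (weak_type_const p q * (W + e) powr (p - 1)))
      \<longlongrightarrow> ennreal (weak_type_const p q * (W + 0) powr (p - 1))) (at_right 0)"
    using pq W by (intro tendsto_intros) (auto simp: eventually_at_right_less intro: eventually_at_rightI[of 0 1])
  moreover have "eventually (\<lambda>e. ennreal (t powr p) * emeasure M {x\<in>space M. norm (f x) > t}
           \<le> ennreal (weak_type_const p q * (W + e) powr (p - 1))) (at_right 0)"
    unfolding eventually_at_right_field
  proof (intro exI[of _ 1] conjI allI impI)
    fix e :: real assume "0 < e" "e < 1"
    then show "ennreal (t powr p) * emeasure M {x\<in>space M. norm (f x) > t}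
           \<le> ennreal (weak_type_const p q * (W + e) powr (p - 1))"
      using W by (intro weak_type_pos[OF pq _ t]) (auto intro: order_trans[OF weak])
  qed simp
  ultimately show ?thesis
    using tendsto_lowerbound by fastforce
qed

end

text \<open>Between \<open>a\<close> and \<open>2 ^ K * a\<close> lie K dyadic layers. Replacing the
  value by the upper end of its layer costs 2^p, after which each layer is one instance of the weak
  bound.\<close>

lemma weak_to_strong:
  fixes f :: "'a \<Rightarrow> 'b::real_normed_vector"
  assumes [measurable]: "(\<lambda>x. norm (f x)) \<in> borel_measurable M" and a: "0 < a" and p: "0 \<le> p"
    and weak: "\<And>t. t > 0 \<Longrightarrow> ennreal (t powr p) * emeasure M {x\<in>space M. norm (f x) > t} \<le> V"
    and bound: "\<And>x. x \<in> space M \<Longrightarrow> norm (f x) \<le> 2 ^ K * a"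
  shows "(\<integral>\<^sup>+x. ennreal (norm (f x) powr p) * indicator {x\<in>space M. norm (f x) > a} x \<partial>M)
           \<le> ennreal (real K * 2 powr p) * V"
proof -
  define L where "L k = {x\<in>space M. norm (f x) > 2 ^ k * a}" for k :: nat
  have L [measurable]: "L k \<in> sets M" for k unfolding L_def by measurable
  have "(\<integral>\<^sup>+x. ennreal (norm (f x) powr p) * indicator {x\<in>space M. norm (f x) > a} x \<partial>M)
      \<le> (\<integral>\<^sup>+x. (\<Sum>k<K. ennreal ((2 ^ Suc k * a) powr p) * indicator (L k) x) \<partial>M)"
  proof (rule nn_integral_mono)
    fix x assume x: "x \<in> space M"
    show "ennreal (norm (f x) powr p) * indicator {x\<in>space M. norm (f x) > a} x
       \<le> (\<Sum>k<K. ennreal ((2 ^ Suc k * a) powr p) * indicator (L k) x)"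
    proof (cases "a < norm (f x)")
      case True
      from dyadic_level[OF a this] obtain k where k: "2 ^ k * a < norm (f x)" "norm (f x) \<le> 2 ^ Suc k * a" by blast
      have "(2::real) ^ k < 2 ^ K" using order.strict_trans2[OF k(1) bound[OF x]] a by simp
      then have kK: "k < K" by simp
      have "ennreal (norm (f x) powr p) * indicator {x\<in>space M. norm (f x) > a} x
          \<le> ennreal ((2 ^ Suc k * a) powr p) * indicator (L k) x"
        using k x p True by (simp add: L_def) (intro ennreal_leI powr_mono2, auto)
      also have "\<dots> \<le> (\<Sum>k<K. ennreal ((2 ^ Suc k * a) powr p) * indicator (L k) x)"
        using kK by (intro member_le_sum) auto
      finally show ?thesis .
    qed simp
  qed
  also have "\<dots> = (\<Sum>k<K. ennreal ((2 ^ Suc k * a) powr p) * emeasure M (L k))"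
    by (subst nn_integral_sum) (auto simp: nn_integral_cmult_indicator)
  also have "\<dots> \<le> (\<Sum>k<K. ennreal (2 powr p) * V)"
  proof (rule sum_mono)
    fix k
    have "(2 ^ Suc k * a) powr p = 2 powr p * (2 ^ k * a) powr p"
      using a by (simp add: powr_mult mult.assoc)
    then have "ennreal ((2 ^ Suc k * a) powr p) * emeasure M (L k)
      = ennreal (2 powr p) * (ennreal ((2 ^ k * a) powr p) * emeasure M (L k))"
      by (simp add: ennreal_mult mult.assoc)
    also have "\<dots> \<le> ennreal (2 powr p) * V"
      unfolding L_def using a by (intro mult_left_mono weak) auto
    finally show "ennreal ((2 ^ Suc k * a) powr p) * emeasure M (L k) \<le> ennreal (2 powr p) * V" .
  qed
  also have "\<dots> = ennreal (real K * 2 powr p) * V"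
    by (simp add: ennreal_mult mult.assoc ennreal_of_nat_eq_real_of_nat)
  finally show ?thesis .
qed

section \<open>Tensor powers and the sharp constant\<close>

lemma nn_integral_count_space_PiE_prod:
  fixes g :: "'i \<Rightarrow> ennreal"
  assumes "countable I"
  shows "(\<integral>\<^sup>+i. (\<Prod>k<N. g (i k)) \<partial>count_space (PiE {..<N::nat} (\<lambda>_. I))) = (\<integral>\<^sup>+i. g i \<partial>count_space I) ^ N"
proof -
  interpret sigma_finite_measure "count_space I" using assms by (rule sigma_finite_measure_count_space_countable)
  interpret product_sigma_finite "\<lambda>_::nat. count_space I" by standard
  show ?thesis
    using product_nn_integral_prod[of "{..<N}" "\<lambda>_. g"] assms
    by (simp add: count_space_PiM_finite)
qed

text \<open>If x / y were above 1, its powers would grow at most linearly.\<close>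

lemma le_if_powers_le_linear_factor:
  fixes x y A :: real
  assumes x: "0 \<le> x" and y: "0 < y" and A: "0 \<le> A" and le: "\<And>N::nat. x ^ N \<le> y ^ N * (1 + real N * A)"
  shows "x \<le> y"
proof (rule ccontr)
  assume "\<not> x \<le> y"
  define r where "r = x / y"
  have r: "r > 1" using \<open>\<not> x \<le> y\<close> y by (simp add: r_def)
  have "(\<lambda>N. (1 + A) * ((1 + real N) / r ^ N)) \<longlonglongrightarrow> (1 + A) * 0"
    using r by (intro tendsto_mult_left) real_asymp
  moreover have "1 \<le> (1 + A) * ((1 + real N) / r ^ N)" for N
  proof -
    have "r ^ N \<le> 1 + real N * A" using le[of N] y by (simp add: r_def power_divide field_simps)
    also have "\<dots> \<le> (1 + A) * (1 + real N)" using A by (simp add: algebra_simps)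
    finally show ?thesis using r by (simp add: field_simps)
  qed
  ultimately show False using LIMSEQ_le_const by fastforce
qed

context parseval_system
begin

text \<open>Every axiom concerns integrals or sums of products with separated variables, so Fubini's
  theorem on both the probability space and the index set reduces it to the N-th power of the axiom
  for a single factor.\<close>

lemma tensor_power:
  "parseval_system (PiM {..<N::nat} (\<lambda>_. M)) (PiE {..<N} (\<lambda>_. I)) (\<lambda>i x. \<Prod>k<N. \<phi> (i k) (x k))
     (\<lambda>x. \<Prod>k<N. f (x k)) (\<lambda>i. \<Prod>k<N. c (i k)) (B ^ N)"
proof -
  interpret P: product_sigma_finite "\<lambda>_::nat. M" by standard
  note [measurable] = f_measurable
  have comp: "x k \<in> space M" if "x \<in> space (PiM {..<N} (\<lambda>_. M))" "k < N" for x k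
    using that by (auto simp: space_PiM)
  have Imem: "i k \<in> I" if "i \<in> PiE {..<N} (\<lambda>_. I)" "k < N" for i k
    using that by auto
  have iff: "integrable M (\<lambda>x. f x * cnj (\<phi> i x))" if "i \<in> I" for i
  proof (rule integrable_bounded[of _ "B * 1"])
    show "(\<lambda>x. f x * cnj (\<phi> i x)) \<in> borel_measurable M" using phi_measurable[OF that] by measurable
    show "norm (f x * cnj (\<phi> i x)) \<le> B * 1" if "x \<in> space M" for x
      unfolding norm_mult complex_mod_cnj using f_bound phi_bound \<open>i \<in> I\<close> that
      by (intro mult_mono B_nonneg) auto
  qed
  have ipp: "integrable M (\<lambda>x. \<phi> i x * cnj (\<phi> j x))" if "i \<in> I" "j \<in> I" for i j
  proof (rule integrable_bounded[of _ "1 * 1"])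
    show "(\<lambda>x. \<phi> i x * cnj (\<phi> j x)) \<in> borel_measurable M" using phi_measurable that by measurable
    show "norm (\<phi> i x * cnj (\<phi> j x)) \<le> 1 * 1" if "x \<in> space M" for x
      unfolding norm_mult complex_mod_cnj using phi_bound \<open>i \<in> I\<close> \<open>j \<in> I\<close> that
      by (intro mult_mono) auto
  qed
  have fk [measurable]: "(\<lambda>x. g (x k)) \<in> borel_measurable (PiM {..<N} (\<lambda>_. M))"
    if "k < N" "g \<in> borel_measurable M" for g :: "'a \<Rightarrow> complex" and k
    using measurable_compose[OF measurable_component_singleton[of k "{..<N}" "\<lambda>_. M"], of g borel] that by simp
  show ?thesis
  proof (intro parseval_system.intro parseval_system_axioms.intro)
    show "prob_space (PiM {..<N} (\<lambda>_. M))"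
      by (rule prob_space_PiM) unfold_locales
    show "countable (PiE {..<N} (\<lambda>_. I))" by (intro countable_PiE countable_I) auto
    show "(\<lambda>x. \<Prod>k<N. \<phi> (i k) (x k)) \<in> borel_measurable (PiM {..<N} (\<lambda>_. M))"
      if "i \<in> PiE {..<N} (\<lambda>_. I)" for i
      by (intro borel_measurable_prod fk phi_measurable Imem[OF that]) auto
    show "norm (\<Prod>k<N. \<phi> (i k) (x k)) \<le> 1"
      if "i \<in> PiE {..<N} (\<lambda>_. I)" "x \<in> space (PiM {..<N} (\<lambda>_. M))" for i x
      unfolding prod_norm[symmetric]
      by (intro prod_le_1) (auto intro!: phi_bound comp that Imem[OF that(1)])
    show "(LINT x|PiM {..<N} (\<lambda>_. M). (\<Prod>k<N. \<phi> (i k) (x k)) * cnj (\<Prod>k<N. \<phi> (j k) (x k))) = (if i = j then 1 else 0)"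
      if i: "i \<in> PiE {..<N} (\<lambda>_. I)" and j: "j \<in> PiE {..<N} (\<lambda>_. I)" for i j
    proof -
      have "(LINT x|PiM {..<N} (\<lambda>_. M). (\<Prod>k<N. \<phi> (i k) (x k)) * cnj (\<Prod>k<N. \<phi> (j k) (x k)))
          = (LINT x|PiM {..<N} (\<lambda>_. M). (\<Prod>k<N. \<phi> (i k) (x k) * cnj (\<phi> (j k) (x k))))"
        by (simp add: prod.distrib cnj_prod)
      also have "\<dots> = (\<Prod>k<N. LINT x|M. \<phi> (i k) x * cnj (\<phi> (j k) x))"
        by (rule P.product_integral_prod[of "{..<N}" "\<lambda>k x. \<phi> (i k) x * cnj (\<phi> (j k) x)"]) (auto intro!: ipp Imem[OF i] Imem[OF j])
      also have "\<dots> = (\<Prod>k<N. if i k = j k then 1 else 0)"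
        by (intro prod.cong refl orthonormal) (auto intro: Imem[OF i] Imem[OF j])
      also have "\<dots> = (if i = j then 1 else 0)"
      proof (cases "i = j")
        case False
        \<comment> \<open>Members of \<open>PiE\<close> agree outside \<open>{..<N}\<close>, so
          distinct indices differ at some k < N, and there the factor is 0.\<close>
        then obtain k where "k < N" "i k \<noteq> j k"
          using PiE_ext[OF i j] by blast
        then show ?thesis using False by (auto intro!: prod_zero bexI[of _ k])
      qed simp
      finally show ?thesis .
    qed
    show "(\<lambda>x. \<Prod>k<N. f (x k)) \<in> borel_measurable (PiM {..<N} (\<lambda>_. M))"
      by (intro borel_measurable_prod fk f_measurable) auto
    show "norm (\<Prod>k<N. f (x k)) \<le> B ^ N" if "x \<in> space (PiM {..<N} (\<lambda>_. M))" for x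
    proof -
      have "(\<Prod>k<N. norm (f (x k))) \<le> (\<Prod>k<N. B)"
        by (intro prod_mono) (auto intro!: f_bound comp that)
      then show ?thesis by (simp add: prod_norm)
    qed
    show "(LINT x|PiM {..<N} (\<lambda>_. M). (\<Prod>k<N. f (x k)) * cnj (\<Prod>k<N. \<phi> (i k) (x k))) = (\<Prod>k<N. c (i k))"
      if i: "i \<in> PiE {..<N} (\<lambda>_. I)" for i
    proof -
      have "(LINT x|PiM {..<N} (\<lambda>_. M). (\<Prod>k<N. f (x k)) * cnj (\<Prod>k<N. \<phi> (i k) (x k)))
          = (LINT x|PiM {..<N} (\<lambda>_. M). (\<Prod>k<N. f (x k) * cnj (\<phi> (i k) (x k))))"
        by (simp add: prod.distrib cnj_prod)
      also have "\<dots> = (\<Prod>k<N. LINT x|M. f x * cnj (\<phi> (i k) x))"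
        by (rule P.product_integral_prod[of "{..<N}" "\<lambda>k x. f x * cnj (\<phi> (i k) x)"]) (auto intro!: iff Imem[OF i])
      also have "\<dots> = (\<Prod>k<N. c (i k))"
        by (intro prod.cong refl coeff) (auto intro: Imem[OF i])
      finally show ?thesis .
    qed
    have "(\<integral>\<^sup>+x. ennreal ((norm (\<Prod>k<N. f (x k)))\<^sup>2) \<partial>PiM {..<N} (\<lambda>_. M))
       = (\<integral>\<^sup>+x. (\<Prod>k<N. ennreal ((norm (f (x k)))\<^sup>2)) \<partial>PiM {..<N} (\<lambda>_. M))"
      by (simp add: prod_norm[symmetric] prod_power_distrib prod_ennreal)
    also have "\<dots> = (\<integral>\<^sup>+x. ennreal ((norm (f x))\<^sup>2) \<partial>M) ^ N"
      using P.product_nn_integral_prod[of "{..<N}" "\<lambda>_ x. ennreal ((norm (f x))\<^sup>2)"] by simp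
    also have "\<dots> \<le> (\<integral>\<^sup>+i. ennreal ((norm (c i))\<^sup>2) \<partial>count_space I) ^ N"
      by (rule power_mono[OF energy]) simp
    also have "\<dots> = (\<integral>\<^sup>+i. (\<Prod>k<N. ennreal ((norm (c (i k)))\<^sup>2)) \<partial>count_space (PiE {..<N} (\<lambda>_. I)))"
      by (subst nn_integral_count_space_PiE_prod) (auto simp: countable_I)
    also have "\<dots> = (\<integral>\<^sup>+i. ennreal ((norm (\<Prod>k<N. c (i k)))\<^sup>2) \<partial>count_space (PiE {..<N} (\<lambda>_. I)))"
      by (simp add: prod_norm[symmetric] prod_power_distrib prod_ennreal)
    finally show "(\<integral>\<^sup>+x. ennreal ((norm (\<Prod>k<N. f (x k)))\<^sup>2) \<partial>PiM {..<N} (\<lambda>_. M))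
       \<le> (\<integral>\<^sup>+i. ennreal ((norm (\<Prod>k<N. c (i k)))\<^sup>2) \<partial>count_space (PiE {..<N} (\<lambda>_. I)))" .
  qed
qed

lemma weak_le_strong_coeff:
  assumes "0 < q" "0 < t"
  shows "ennreal (t powr q) * emeasure (count_space I) {i\<in>I. norm (c i) > t}
      \<le> (\<integral>\<^sup>+i. ennreal (norm (c i) powr q) \<partial>count_space I)"
proof -
  have "ennreal (t powr q) * emeasure (count_space I) {i\<in>I. norm (c i) > t}
      = (\<integral>\<^sup>+i. ennreal (t powr q) * indicator {i\<in>I. norm (c i) > t} i \<partial>count_space I)"
    by (subst nn_integral_cmult_indicator) auto
  also have "\<dots> \<le> (\<integral>\<^sup>+i. ennreal (norm (c i) powr q) \<partial>count_space I)"
    using assms by (intro nn_integral_mono) (auto simp: indicator_def intro!: ennreal_leI powr_mono2)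
  finally show ?thesis .
qed

text \<open>Passing from the weak-type bound to a bound in \<open>L\<^sup>p\<close> costs a factor logarithmic in the size of
  \<open>f\<close>. For the \<open>N\<close>-fold tensor power of \<open>f\<close> this factor is only linear in \<open>N\<close>, whereas all norms are
  raised to the power \<open>N\<close>; taking \<open>N\<close>-th roots removes every constant.\<close>

lemma hausdorff_young_pos:
  assumes pq: "2 < p" "1 / p + 1 / q = 1" and S: "0 < S"
    and le: "(\<integral>\<^sup>+i. ennreal (norm (c i) powr q) \<partial>count_space I) \<le> ennreal S"
  shows "(\<integral>\<^sup>+x. ennreal (norm (f x) powr p) \<partial>M) \<le> ennreal (S powr (p - 1))"
proof -
  note q = conjugate_exponent[OF pq]
  note [measurable] = f_measurable
  \<comment> \<open>The height with \<open>\<sigma> powr p = S powr (p - 1)\<close>: the part of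
    \<open>f\<close> below it satisfies the claim on its own, the total mass being 1. Only the
    levels from \<open>\<sigma>\<close> up to \<open>B\<close> produce a loss.\<close>
  define \<sigma> where "\<sigma> = S powr (1 / q)"
  have \<sigma>: "\<sigma> > 0" using S by (simp add: \<sigma>_def)
  have \<sigma>p: "\<sigma> powr p = S powr (p - 1)" using q by (simp add: \<sigma>_def powr_powr)
  \<comment> \<open>\<open>k0\<close> doublings lead from \<open>\<sigma>\<close> past
    \<open>B\<close>, hence \<open>k0 * N\<close> doublings from \<open>\<sigma> ^ N\<close> past
    \<open>B ^ N\<close>. This is the source of the factor linear in N.\<close>
  obtain k0 where k0: "B / \<sigma> < 2 ^ k0" using real_arch_pow[of 2 "B / \<sigma>"] by auto
  then have B: "B \<le> 2 ^ k0 * \<sigma>" using \<sigma> by (simp add: field_simps)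
  \<comment> \<open>Finiteness makes the integral a real number \<open>x\<close>, whose powers can
    then be compared.\<close>
  have "(\<integral>\<^sup>+x. ennreal (norm (f x) powr p) \<partial>M) \<le> (\<integral>\<^sup>+x. ennreal (B powr p) \<partial>M)"
    using pq by (intro nn_integral_mono ennreal_leI powr_mono2 f_bound) auto
  also have "\<dots> < \<infinity>" by (simp add: emeasure_space_1)
  finally obtain x where x: "x \<ge> 0" "(\<integral>\<^sup>+x. ennreal (norm (f x) powr p) \<partial>M) = ennreal x"
    by (metis ennreal_cases infinity_ennreal_def less_irrefl)
  define C where "C = weak_type_const p q"
  have C: "C > 0" unfolding C_def using q by (intro weak_type_const_pos)
  have "x \<le> S powr (p - 1)"
  proof (rule le_if_powers_le_linear_factor[OF x(1)])
    show "0 < S powr (p - 1)" using S by simp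
    show "0 \<le> real k0 * 2 powr p * C" using C by simp
    fix N :: nat
    define y where "y = S powr (p - 1)"
    define P where "P = PiM {..<N} (\<lambda>_. M)"
    define fN where "fN x = (\<Prod>k<N. f (x k))" for x
    define cN where "cN i = (\<Prod>k<N. c (i k))" for i
    interpret T: parseval_system P "PiE {..<N} (\<lambda>_. I)" "\<lambda>i x. \<Prod>k<N. \<phi> (i k) (x k)" fN cN "B ^ N"
      unfolding fN_def cN_def P_def by (rule tensor_power)
    interpret PS: product_sigma_finite "\<lambda>_::nat. M" by standard
    note [measurable] = T.f_measurable
    have "(\<integral>\<^sup>+i. ennreal (norm (cN i) powr q) \<partial>count_space (PiE {..<N} (\<lambda>_. I)))
        = (\<integral>\<^sup>+i. (\<Prod>k<N. ennreal (norm (c (i k)) powr q)) \<partial>count_space (PiE {..<N} (\<lambda>_. I)))"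
      by (simp add: cN_def prod_norm[symmetric] prod_powr_distrib prod_ennreal)
    also have "\<dots> = (\<integral>\<^sup>+i. ennreal (norm (c i) powr q) \<partial>count_space I) ^ N"
      by (rule nn_integral_count_space_PiE_prod[OF countable_I])
    also have "\<dots> \<le> ennreal S ^ N" by (rule power_mono[OF le]) simp
    finally have leN: "(\<integral>\<^sup>+i. ennreal (norm (cN i) powr q) \<partial>count_space (PiE {..<N} (\<lambda>_. I))) \<le> ennreal (S ^ N)"
      using S by (simp add: ennreal_power)
    have V: "(S ^ N) powr (p - 1) = y ^ N" "(\<sigma> ^ N) powr p = y ^ N"
    proof -
      have *: "(u ^ N) powr v = (u powr v) ^ N" if "u > 0" for u v :: real
        using that by (simp add: powr_realpow[symmetric] powr_powr mult.commute)
      show "(S ^ N) powr (p - 1) = y ^ N" "(\<sigma> ^ N) powr p = y ^ N"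
        using *[OF S] *[OF \<sigma>] \<sigma>p by (simp_all add: y_def)
    qed
    have weak: "ennreal (t powr p) * emeasure P {x\<in>space P. norm (fN x) > t} \<le> ennreal (C * y ^ N)" if "t > 0" for t
      unfolding C_def V(1)[symmetric]
    proof (rule T.weak_type[OF pq _ that])
      show "ennreal (t powr q) * emeasure (count_space (PiE {..<N} (\<lambda>_. I))) {i \<in> PiE {..<N} (\<lambda>_. I). t < norm (cN i)}
          \<le> ennreal (S ^ N)" if "t > 0" for t
        using T.weak_le_strong_coeff[of q t] leN that q by (auto intro: order_trans)
    qed (use S in auto)
    have bd: "norm (fN x) \<le> 2 ^ (k0 * N) * \<sigma> ^ N" if "x \<in> space P" for x
    proof -
      have "norm (fN x) \<le> B ^ N" by (rule T.f_bound[OF that])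
      also have "\<dots> \<le> (2 ^ k0 * \<sigma>) ^ N" by (intro power_mono B B_nonneg)
      finally show ?thesis by (simp add: power_mult power_mult_distrib)
    qed
    have "ennreal (x ^ N) = (\<integral>\<^sup>+x. (\<Prod>k<N. ennreal (norm (f (x k)) powr p)) \<partial>P)"
      unfolding P_def using PS.product_nn_integral_prod[of "{..<N}" "\<lambda>_ x. ennreal (norm (f x) powr p)"] x
      by (simp add: ennreal_power)
    also have "\<dots> = (\<integral>\<^sup>+x. ennreal (norm (fN x) powr p) \<partial>P)"
      by (simp add: fN_def prod_norm[symmetric] prod_powr_distrib prod_ennreal)
    \<comment> \<open>The first summand equals \<open>y ^ N\<close> and bounds everything below
      height \<open>\<sigma> ^ N\<close>; it accounts for the 1 in the factor 1 + N A.\<close>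
    also have "\<dots> \<le> (\<integral>\<^sup>+x. ennreal ((\<sigma> ^ N) powr p) +
        ennreal (norm (fN x) powr p) * indicator {x\<in>space P. norm (fN x) > \<sigma> ^ N} x \<partial>P)"
      using pq by (intro nn_integral_mono)
        (auto simp: indicator_def not_less intro!: ennreal_leI powr_mono2 add_increasing)
    also have "\<dots> = ennreal ((\<sigma> ^ N) powr p) +
        (\<integral>\<^sup>+x. ennreal (norm (fN x) powr p) * indicator {x\<in>space P. norm (fN x) > \<sigma> ^ N} x \<partial>P)"
      by (subst nn_integral_add) (auto simp: T.emeasure_space_1)
    also have "\<dots> \<le> ennreal (y ^ N) + ennreal (real (k0 * N) * 2 powr p) * ennreal (C * y ^ N)"
      unfolding V(2) using \<sigma> pq by (intro add_left_mono weak_to_strong weak bd) auto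
    also have "\<dots> = ennreal (y ^ N * (1 + real N * (real k0 * 2 powr p * C)))"
      using C by (simp add: y_def ennreal_mult[symmetric] ennreal_plus[symmetric] algebra_simps del: ennreal_plus)
    finally show "x ^ N \<le> (S powr (p - 1)) ^ N * (1 + real N * (real k0 * 2 powr p * C))"
      unfolding y_def using C by (subst (asm) ennreal_le_iff) auto
  qed
  then show ?thesis using x by (simp add: ennreal_leI)
qed

lemma hausdorff_young:
  assumes pq: "2 < p" "1 / p + 1 / q = 1" and S: "0 \<le> S"
    and le: "(\<integral>\<^sup>+i. ennreal (norm (c i) powr q) \<partial>count_space I) \<le> ennreal S"
  shows "(\<integral>\<^sup>+x. ennreal (norm (f x) powr p) \<partial>M) \<le> ennreal (S powr (p - 1))"
proof -
  have "((\<lambda>e. ennreal ((S + e) powr (p - 1))) \<longlongrightarrow> ennreal ((S + 0) powr (p - 1))) (at_right 0)"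
    using pq S by (intro tendsto_intros) (auto simp: eventually_at_right_less intro: eventually_at_rightI[of 0 1])
  moreover have "eventually (\<lambda>e. (\<integral>\<^sup>+x. ennreal (norm (f x) powr p) \<partial>M)
           \<le> ennreal ((S + e) powr (p - 1))) (at_right 0)"
    unfolding eventually_at_right_field
  proof (intro exI[of _ 1] conjI allI impI)
    fix e :: real assume "0 < e" "e < 1"
    then show "(\<integral>\<^sup>+x. ennreal (norm (f x) powr p) \<partial>M) \<le> ennreal ((S + e) powr (p - 1))"
      using S by (intro hausdorff_young_pos[OF pq]) (auto intro: order_trans[OF le])
  qed simp
  ultimately show ?thesis
    using tendsto_lowerbound by fastforce
qed

end

section \<open>Fourier analysis on the unit cube\<close>

text \<open>Half-open, so that the lattice translates tile space and every point has a unique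
  lattice part, its \<open>floor_vec\<close>. Together with \<open>lborel\<close> this gives exact
  unfolding formulas; the closed cube behind \<open>torus\<close> differs by a null set.\<close>

definition unit_cube :: "(real ^ 'n) set" where
  "unit_cube = {x. \<forall>i. 0 \<le> x $ i \<and> x $ i < 1}"

definition cube_measure :: "(real ^ 'n) measure" where
  "cube_measure = restrict_space lborel unit_cube"

definition floor_vec :: "real ^ 'n \<Rightarrow> real ^ 'n" where
  "floor_vec x = (\<chi> i. of_int \<lfloor>x $ i\<rfloor>)"

definition character :: "real ^ 'n \<Rightarrow> real ^ 'n \<Rightarrow> complex" where
  "character n x = cis (2 * pi * (n \<bullet> x))"

lemma One_nth: "(\<Sum>b\<in>Basis. (b :: real ^ 'n) $ i) = 1"
proof -
  have "(\<Sum>b\<in>Basis. (b :: real ^ 'n) $ i) = (\<Sum>b\<in>Basis. if (b :: real ^ 'n) = axis i 1 then 1 else 0)"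
    by (intro sum.cong refl) (simp add: cart_eq_inner_axis inner_Basis)
  also have "\<dots> = 1" by (subst sum.delta) auto
  finally show ?thesis .
qed

lemma unit_cube_subset_cbox: "unit_cube \<subseteq> cbox 0 (One :: real ^ 'n)"
  by (auto simp: mem_box_cart One_nth unit_cube_def less_imp_le)

lemma box_subset_unit_cube: "box 0 (One :: real ^ 'n) \<subseteq> unit_cube"
  by (auto simp: mem_box_cart One_nth unit_cube_def less_imp_le)

lemma unit_cube_measurable [measurable]: "(unit_cube :: (real ^ 'n) set) \<in> sets borel"
proof -
  have "unit_cube = (\<Inter>i. {x::real^'n. 0 \<le> x $ i} \<inter> {x. x $ i < 1})" by (auto simp: unit_cube_def)
  moreover have "{x::real^'n. 0 \<le> x $ i} \<inter> {x. x $ i < 1} \<in> sets borel" for i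
    by (intro sets.Int borel_closed borel_open closed_Collect_le open_Collect_less continuous_intros)
  ultimately show ?thesis using sets.finite_INT[of "UNIV :: 'n set" "\<lambda>i. {x::real^'n. 0 \<le> x $ i} \<inter> {x. x $ i < 1}" borel] by simp
qed

lemma emeasure_cbox_box_One: "emeasure lborel (cbox 0 (One::real^'n)) = 1" "emeasure lborel (box 0 (One::real^'n)) = 1"
proof -
  have 1: "(\<Prod>b\<in>Basis. (One - 0 :: real ^ 'n) \<bullet> b) = 1"
    by (intro prod.neutral) (auto simp: inner_sum_left inner_Basis sum.delta)
  have 2: "(0 :: real ^ 'n) \<bullet> b \<le> One \<bullet> b" if "b \<in> Basis" for b
    using that by (auto simp: inner_sum_left inner_Basis sum.delta)
  show "emeasure lborel (cbox 0 (One::real^'n)) = 1" "emeasure lborel (box 0 (One::real^'n)) = 1"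
    using 2 1 by (subst emeasure_lborel_cbox emeasure_lborel_box; simp)+
qed

lemma emeasure_unit_cube: "emeasure lborel (unit_cube :: (real ^ 'n) set) = 1"
proof (rule antisym)
  show "emeasure lborel (unit_cube :: (real ^ 'n) set) \<le> 1"
    using emeasure_mono[OF unit_cube_subset_cbox, of lborel] by (simp add: emeasure_cbox_box_One)
  show "emeasure lborel (unit_cube :: (real ^ 'n) set) \<ge> 1"
    using emeasure_mono[OF box_subset_unit_cube, of lborel] by (simp add: emeasure_cbox_box_One)
qed

lemma space_cube_measure [simp]: "space cube_measure = unit_cube"
  by (simp add: cube_measure_def space_restrict_space)

lemma borel_measurable_cube_measure:
  "g \<in> measurable borel N \<Longrightarrow> g \<in> measurable cube_measure N"
  unfolding cube_measure_def by (rule measurable_restrict_space1) simp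

interpretation cube: prob_space "cube_measure :: (real ^ 'n) measure"
  by standard (simp add: cube_measure_def emeasure_restrict_space emeasure_unit_cube space_restrict_space)

lemma measure_cube_unit_cube: "measure cube_measure unit_cube = 1"
  using cube.prob_space by simp

lemma cube_integrable:
  fixes g :: "real ^ 'n \<Rightarrow> 'b :: {banach, second_countable_topology}"
  assumes "g \<in> borel_measurable borel" "\<And>x. norm (g x) \<le> b"
  shows "integrable cube_measure g"
  using assms by (intro cube.integrable_const_bound[of g b] borel_measurable_cube_measure) auto

lemma integral_cube_measure:
  fixes g :: "real ^ 'n \<Rightarrow> 'b :: {banach, second_countable_topology}"
  shows "(LINT x|cube_measure. g x) = (LINT x|lborel. indicator unit_cube x *\<^sub>R g x)"
  unfolding cube_measure_def by (subst integral_restrict_space) (auto simp: space_restrict_space)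

lemma AE_cbox_unit_cube:
  "AE x in lborel. x \<in> cbox 0 (One :: real ^ 'n) \<longleftrightarrow> x \<in> unit_cube"
proof -
  have "emeasure lborel (cbox 0 One - (unit_cube :: (real ^ 'n) set)) = 0"
    by (subst emeasure_Diff) (auto simp: emeasure_unit_cube emeasure_cbox_box_One unit_cube_subset_cbox)
  then have "AE x in lborel. x \<notin> cbox 0 One - (unit_cube :: (real ^ 'n) set)"
    by (intro AE_not_in) (auto simp: null_sets_def)
  then show ?thesis
    by eventually_elim (use unit_cube_subset_cbox in auto)
qed

text \<open>For arbitrary \<open>g\<close>: completing the measure leaves non-negative integrals
  unchanged, and the closed and the half-open cube differ by a null set.\<close>

lemma nn_integral_torus: "(\<integral>\<^sup>+x. g x \<partial>torus) = (\<integral>\<^sup>+x. g x \<partial>cube_measure)"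
proof -
  have "(\<integral>\<^sup>+x. g x \<partial>torus) = (\<integral>\<^sup>+x. g x * indicator (cbox 0 One) x \<partial>lborel)"
    unfolding torus_def by (simp add: nn_integral_restrict_space nn_integral_completion)
  also have "\<dots> = (\<integral>\<^sup>+x. g x * indicator unit_cube x \<partial>lborel)"
    by (rule nn_integral_cong_AE) (use AE_cbox_unit_cube in eventually_elim, auto simp: indicator_def)
  finally show ?thesis
    by (simp add: cube_measure_def nn_integral_restrict_space)
qed

lemma emeasure_torus:
  fixes g :: "real ^ 'n \<Rightarrow> real"
  assumes [measurable]: "g \<in> borel_measurable borel"
  shows "emeasure torus {x\<in>space torus. g x > t} = emeasure cube_measure {x\<in>space cube_measure. g x > t}"
proof -
  have "emeasure torus {x\<in>space torus. g x > t} = (\<integral>\<^sup>+x. indicator {x. g x > t} x \<partial>torus)"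
  proof -
    have m: "g \<in> borel_measurable torus"
      unfolding torus_def by (intro measurable_restrict_space1 measurable_completion) simp
    then have "{x\<in>space torus. g x > t} \<in> sets torus" by measurable
    then show ?thesis
      by (subst nn_integral_indicator[symmetric]) (auto intro!: nn_integral_cong simp: indicator_def simp del: nn_integral_indicator)
  qed
  also have "\<dots> = (\<integral>\<^sup>+x. indicator {x. g x > t} x \<partial>cube_measure)" by (rule nn_integral_torus)
  also have "\<dots> = emeasure cube_measure {x\<in>space cube_measure. g x > t}"
  proof -
    have "g \<in> borel_measurable cube_measure" by (rule borel_measurable_cube_measure) simp
    then have "{x\<in>space cube_measure. g x > t} \<in> sets cube_measure" by measurable
    then show ?thesis
      by (subst nn_integral_indicator[symmetric]) (auto intro!: nn_integral_cong simp: indicator_def simp del: nn_integral_indicator)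
  qed
  finally show ?thesis .
qed

section \<open>Integer lattice and unfolding of integrals over the cube\<close>

lemma int_lattice_0 [simp]: "0 \<in> int_lattice"
  and int_lattice_add: "k \<in> int_lattice \<Longrightarrow> l \<in> int_lattice \<Longrightarrow> k + l \<in> int_lattice"
  and int_lattice_diff: "k \<in> int_lattice \<Longrightarrow> l \<in> int_lattice \<Longrightarrow> k - l \<in> int_lattice"
  and int_lattice_uminus: "k \<in> int_lattice \<Longrightarrow> - k \<in> int_lattice"
  by (auto simp: int_lattice_def)

lemma floor_vec_lattice: "floor_vec x \<in> int_lattice"
  by (auto simp: floor_vec_def int_lattice_def)

lemma diff_floor_vec_in_cube: "x - floor_vec x \<in> unit_cube"
  by (auto simp: floor_vec_def unit_cube_def) linarith+

lemma diff_in_cube_iff: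
  assumes "k \<in> int_lattice"
  shows "x - k \<in> unit_cube \<longleftrightarrow> k = floor_vec x"
proof
  assume *: "x - k \<in> unit_cube"
  show "k = floor_vec x"
    unfolding vec_eq_iff
  proof
    fix i
    from assms obtain m where m: "k $ i = of_int m" by (auto simp: int_lattice_def Ints_def)
    have "0 \<le> x $ i - of_int m" "x $ i - of_int m < 1" using * m by (auto simp: unit_cube_def dest!: spec[of _ i])
    then have "\<lfloor>x $ i\<rfloor> = m" by linarith
    then show "k $ i = floor_vec x $ i" by (simp add: m floor_vec_def)
  qed
qed (simp add: diff_floor_vec_in_cube)

lemma int_lattice_eq_range: "int_lattice = range (\<lambda>a::'n \<Rightarrow> int. (\<chi> i. of_int (a i)) :: real ^ 'n)"
proof (rule set_eqI, rule iffI)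
  fix k :: "real ^ 'n" assume k: "k \<in> int_lattice"
  then have "k = (\<chi> i. of_int \<lfloor>k $ i\<rfloor>)"
    by (auto simp: int_lattice_def vec_eq_iff Ints_def)
  then show "k \<in> range (\<lambda>a::'n \<Rightarrow> int. \<chi> i. of_int (a i))" using rangeI[of "\<lambda>a::'n \<Rightarrow> int. (\<chi> i. of_int (a i)) :: real ^ 'n" "\<lambda>i. \<lfloor>k $ i\<rfloor>"] by simp
qed (auto simp: int_lattice_def)

lemma countable_int_lattice: "countable (int_lattice :: (real ^ 'n) set)"
proof -
  have "countable (PiE (UNIV :: 'n set) (\<lambda>_. UNIV :: int set))" by (intro countable_PiE) auto
  then show ?thesis unfolding int_lattice_eq_range by (simp add: PiE_UNIV_domain)
qed

lemma lattice_box_card: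
  fixes m :: nat
  defines "L \<equiv> {k \<in> int_lattice :: (real ^ 'n) set. \<forall>i. \<bar>k $ i\<bar> \<le> real m}"
  shows "finite L" "card L \<le> (2 * m + 1) ^ CARD('n)"
proof -
  let ?A = "PiE (UNIV :: 'n set) (\<lambda>_. {- int m..int m})"
  have fin: "finite ?A" by (intro finite_PiE) auto
  have card: "card ?A = (2 * m + 1) ^ CARD('n)" by (simp add: card_PiE nat_add_distrib nat_mult_distrib)
  have sub: "L \<subseteq> (\<lambda>a. (\<chi> i. of_int (a i)) :: real ^ 'n) ` ?A"
  proof
    fix k assume "k \<in> L"
    then obtain a where a: "k = (\<chi> i. of_int (a i))" and le: "\<And>i. \<bar>k $ i\<bar> \<le> real m"
      unfolding L_def int_lattice_eq_range by auto
    have "a i \<in> {- int m..int m}" for i using le[of i] unfolding a by auto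
    then show "k \<in> (\<lambda>a. (\<chi> i. of_int (a i)) :: real ^ 'n) ` ?A" using a by (auto simp: PiE_UNIV_domain)
  qed
  show "finite L" by (rule finite_subset[OF sub finite_imageI[OF fin]])
  show "card L \<le> (2 * m + 1) ^ CARD('n)"
    using order_trans[OF card_mono[OF finite_imageI[OF fin] sub] card_image_le[OF fin]] card by simp
qed

lemma unit_cube_nth_bounds: "x \<in> unit_cube \<Longrightarrow> \<bar>x $ i\<bar> \<le> 1"
  unfolding unit_cube_def by (auto dest!: spec[of _ i])

text \<open>A point of the cube shifts each coordinate by at most 1, whence \<open>r + 1\<close>.
  Finiteness keeps all sums over translates finite; the count, polynomial in \<open>r\<close>, later
  bounds the discrepancy polynomially in the dilation and so yields the logarithm.\<close>

lemma translates_card: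
  fixes U :: "(real ^ 'n) set"
  assumes U: "\<And>x. x \<in> U \<Longrightarrow> norm x \<le> r"
  defines "F \<equiv> {k \<in> int_lattice. \<exists>x\<in>unit_cube. x + k \<in> U}"
  shows "finite F" "card F \<le> (2 * nat \<lceil>r + 1\<rceil> + 1) ^ CARD('n)"
proof -
  have sub: "F \<subseteq> {k \<in> int_lattice :: (real ^ 'n) set. \<forall>i. \<bar>k $ i\<bar> \<le> real (nat \<lceil>r + 1\<rceil>)}"
  proof
    fix k assume "k \<in> F"
    then obtain x where x: "k \<in> int_lattice" "x \<in> unit_cube" "x + k \<in> U" by (auto simp: F_def)
    have "\<bar>k $ i\<bar> \<le> real (nat \<lceil>r + 1\<rceil>)" for i
    proof -
      have "\<bar>(x + k) $ i\<bar> \<le> r" using component_le_norm_cart[of "x + k" i] U[OF x(3)] by linarith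
      then have "\<bar>k $ i\<bar> \<le> r + 1" using unit_cube_nth_bounds[OF x(2), of i] by auto
      then show ?thesis by linarith
    qed
    then show "k \<in> {k \<in> int_lattice. \<forall>i. \<bar>k $ i\<bar> \<le> real (nat \<lceil>r + 1\<rceil>)}" using x by simp
  qed
  show "finite F" by (rule finite_subset[OF sub lattice_box_card(1)])
  show "card F \<le> (2 * nat \<lceil>r + 1\<rceil> + 1) ^ CARD('n)"
    by (rule order_trans[OF card_mono[OF lattice_box_card(1) sub] lattice_box_card(2)])
qed

lemma finite_translates:
  assumes "bounded U"
  shows "finite {k \<in> int_lattice. \<exists>x\<in>unit_cube. x + k \<in> U}"
proof -
  from assms obtain r where "\<And>x. x \<in> U \<Longrightarrow> norm x \<le> r" by (auto simp: bounded_iff)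
  then show ?thesis by (rule translates_card(1))
qed

lemma lborel_integral_shift:
  fixes h :: "'a::euclidean_space \<Rightarrow> 'b :: {banach, second_countable_topology}"
  assumes [measurable]: "h \<in> borel_measurable borel"
  shows "(LINT x|lborel. h (x + k)) = (LINT x|lborel. h x)"
proof -
  have "(LINT x|lborel. h x) = (LINT x|distr lborel borel ((+) k). h x)" by (simp add: lborel_distr_plus)
  also have "\<dots> = (LINT x|lborel. h (k + x))" by (rule integral_distr) auto
  finally show ?thesis by (simp add: add.commute)
qed

text \<open>Every point is x + k for exactly one x in the cube and one lattice point k. Translating
  each tile back to the cube gives the sum, which is finite because the support of \<open>g\<close>
  meets only the tiles indexed by \<open>F\<close>.\<close>

lemma integral_unfold_cube:
  fixes g :: "real ^ 'n \<Rightarrow> 'b :: {banach, second_countable_topology}"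
  assumes g: "integrable lborel g" and F: "finite F" "F \<subseteq> int_lattice" "\<And>x. g x \<noteq> 0 \<Longrightarrow> floor_vec x \<in> F"
  shows "(LINT x|lborel. g x) = (LINT x|cube_measure. (\<Sum>k\<in>F. g (x + k)))"
proof -
  have gm [measurable]: "g \<in> borel_measurable borel" using g by auto
  have dec: "g x = (\<Sum>k\<in>F. indicator unit_cube (x - k) *\<^sub>R g x)" for x
  proof (cases "g x = 0")
    case False
    have "(\<Sum>k\<in>F. indicator unit_cube (x - k) *\<^sub>R g x) = (\<Sum>k\<in>F. if k = floor_vec x then g x else 0)"
      using F by (intro sum.cong refl) (auto simp: indicator_def diff_in_cube_iff subset_iff)
    also have "\<dots> = g x" using F False by (subst sum.delta) auto
    finally show ?thesis by simp
  qed simp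
  have int: "integrable lborel (\<lambda>x. indicator unit_cube (x - k) *\<^sub>R g x)" for k
    by (rule Bochner_Integration.integrable_bound[OF g]) (auto simp: indicator_def)
  have int': "integrable lborel (\<lambda>x. indicator unit_cube x *\<^sub>R g (x + k))" for k
  proof -
    have "integrable (distr lborel borel ((+) k)) (\<lambda>x. indicator unit_cube (x - k) *\<^sub>R g x)"
      using int[of k] by (simp add: lborel_distr_plus)
    then show ?thesis by (subst (asm) integrable_distr_eq) (auto simp: add.commute)
  qed
  have "(LINT x|lborel. g x) = (\<Sum>k\<in>F. LINT x|lborel. indicator unit_cube (x - k) *\<^sub>R g x)"
    by (subst dec, subst Bochner_Integration.integral_sum) (auto intro: int)
  also have "\<dots> = (\<Sum>k\<in>F. LINT x|lborel. indicator unit_cube x *\<^sub>R g (x + k))"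
  proof (intro sum.cong refl)
    fix k
    show "(LINT x|lborel. indicator unit_cube (x - k) *\<^sub>R g x) = (LINT x|lborel. indicator unit_cube x *\<^sub>R g (x + k))"
      by (subst lborel_integral_shift[of _ k, symmetric]) auto
  qed
  also have "\<dots> = (LINT x|lborel. (\<Sum>k\<in>F. indicator unit_cube x *\<^sub>R g (x + k)))"
    by (subst Bochner_Integration.integral_sum) (auto intro: int')
  finally show ?thesis by (simp add: integral_cube_measure scaleR_sum_right)
qed

section \<open>Periodic functions and characters\<close>

definition lattice_periodic :: "(real ^ 'n \<Rightarrow> 'b) \<Rightarrow> bool" where
  "lattice_periodic f \<longleftrightarrow> (\<forall>k\<in>int_lattice. \<forall>x. f (x + k) = f x)"

text \<open>The left side is the integral of \<open>f\<close> over the translated cube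
  \<open>U\<close>. Folding it back to the unit cube, exactly one lattice translate of each x lies
  in \<open>U\<close>, and periodicity makes the value there equal to f x.\<close>

lemma cube_integral_shift:
  fixes f :: "real ^ 'n \<Rightarrow> 'b :: {banach, second_countable_topology}"
  assumes [measurable]: "f \<in> borel_measurable borel" and b: "\<And>x. norm (f x) \<le> b" and per: "lattice_periodic f"
  shows "(LINT x|cube_measure. f (x + h)) = (LINT x|cube_measure. f x)"
proof -
  define U where "U = (\<lambda>x. x + h) ` unit_cube"
  have U: "x \<in> U \<longleftrightarrow> x - h \<in> unit_cube" for x unfolding U_def by (auto simp: image_iff intro: bexI[of _ "x - h"])
  define F where "F = {k \<in> int_lattice. \<exists>x\<in>unit_cube. x + k \<in> U}"
  have "bounded (unit_cube :: (real ^ 'n) set)"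
    using bounded_cbox bounded_subset unit_cube_subset_cbox by blast
  then have "bounded U" unfolding U_def using bounded_translation[of unit_cube h] by (simp add: add.commute)
  then have fin: "finite F" unfolding F_def by (rule finite_translates)
  define g where "g y = indicator unit_cube (y - h) *\<^sub>R f y" for y
  have [measurable]: "g \<in> borel_measurable borel" unfolding g_def by measurable
  have ig: "integrable lborel g"
  proof (rule integrableI_bounded)
    have "(\<integral>\<^sup>+x. ennreal (norm (g x)) \<partial>lborel) \<le> (\<integral>\<^sup>+x. ennreal b * indicator U x \<partial>lborel)"
      using b by (intro nn_integral_mono) (auto simp: g_def indicator_def U intro!: ennreal_leI)
    also have "U \<in> sets borel"
    proof -
      have "U = (\<lambda>x. x - h) -` unit_cube \<inter> space borel" by (auto simp: U)
      also have "\<dots> \<in> sets borel" by measurable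
      finally show ?thesis .
    qed
    then have "(\<integral>\<^sup>+x. ennreal b * indicator U x \<partial>lborel) = ennreal b * emeasure lborel U"
      by (subst nn_integral_cmult_indicator) auto
    also have "\<dots> < \<infinity>"
      using emeasure_bounded_finite[OF \<open>bounded U\<close>] by (simp add: ennreal_mult_less_top)
    finally show "(\<integral>\<^sup>+x. ennreal (norm (g x)) \<partial>lborel) < \<infinity>" .
  qed simp
  have "(LINT x|cube_measure. f (x + h)) = (LINT x|lborel. g (x + h))"
    by (simp add: integral_cube_measure g_def)
  also have "\<dots> = (LINT x|lborel. g x)" by (rule lborel_integral_shift) simp
  also have "\<dots> = (LINT x|cube_measure. (\<Sum>k\<in>F. g (x + k)))"
  proof (rule integral_unfold_cube[OF ig fin])
    show "F \<subseteq> int_lattice" by (auto simp: F_def)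
    fix x assume "g x \<noteq> 0"
    then have "x \<in> U" by (auto simp: g_def U indicator_def split: if_splits)
    then show "floor_vec x \<in> F"
      unfolding F_def using floor_vec_lattice diff_floor_vec_in_cube[of x] by (auto intro!: bexI[of _ "x - floor_vec x"])
  qed
  also have "\<dots> = (LINT x|cube_measure. f x)"
  proof (rule Bochner_Integration.integral_cong[OF refl])
    fix x :: "real ^ 'n" assume x: "x \<in> space cube_measure"
    define l where "l = - floor_vec (x - h)"
    have l: "l \<in> int_lattice" by (simp add: l_def int_lattice_uminus floor_vec_lattice)
    have lF: "l \<in> F" using x l diff_floor_vec_in_cube[of "x - h"] by (auto simp: F_def U l_def algebra_simps intro!: bexI[of _ x])
    have eq: "x + k - h \<in> unit_cube \<longleftrightarrow> k = l" if "k \<in> F" for k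
      using diff_in_cube_iff[of "- k" "x - h"] that
      by (auto simp: F_def l_def int_lattice_uminus algebra_simps minus_equation_iff[of k])
    have "(\<Sum>k\<in>F. g (x + k)) = (\<Sum>k\<in>F. if k = l then f x else 0)"
      using per by (intro sum.cong refl) (auto simp: g_def indicator_def eq, auto simp: lattice_periodic_def F_def)
    also have "\<dots> = f x" using fin lF by (subst sum.delta) auto
    finally show "(\<Sum>k\<in>F. g (x + k)) = f x" .
  qed
  finally show ?thesis .
qed

lemma inner_lattice_Ints: "k \<in> int_lattice \<Longrightarrow> n \<in> int_lattice \<Longrightarrow> n \<bullet> k \<in> \<int>"
  by (auto simp: inner_vec_def int_lattice_def intro!: Ints_sum)

lemma character_periodic:
  fixes n :: "real ^ 'n"
  shows "n \<in> int_lattice \<Longrightarrow> lattice_periodic (character n)"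
  unfolding lattice_periodic_def
proof safe
  fix k x :: "real ^ 'n" assume "n \<in> int_lattice" "k \<in> int_lattice"
  then have "n \<bullet> k \<in> \<int>" by (rule inner_lattice_Ints[rotated])
  then have "cis (2 * pi * (n \<bullet> k)) = 1" by (rule cis_multiple_2pi)
  then show "character n (x + k) = character n x"
    unfolding character_def inner_add_right distrib_left cis_mult[symmetric] by simp
qed

lemma character_add_right: "character n (x + y) = character n x * character n y"
  unfolding character_def cis_mult inner_add_right distrib_left ..

lemma character_add_left: "character (n + m) x = character n x * character m x"
  unfolding character_def cis_mult inner_add_left distrib_left ..

lemma cnj_character: "cnj (character n x) = character (- n) x"
  by (simp add: character_def cis_cnj)

lemma character_minus_right: "character n (- x) = character (- n) x"
  by (simp add: character_def)

lemma norm_character [simp]: "norm (character n x) = 1"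
  by (simp add: character_def)

lemma character_0 [simp]: "character 0 x = 1"
  by (simp add: character_def)

lemmas character_simps = character_add_right character_add_left cnj_character character_minus_right

lemma character_measurable [measurable]: "character n \<in> borel_measurable borel"
  unfolding character_def by (intro borel_measurable_continuous_onI continuous_intros)

lemma integral_character:
  fixes n :: "real ^ 'n"
  assumes n: "n \<in> int_lattice"
  shows "(LINT x|cube_measure. character n x) = (if n = 0 then 1 else 0)"
proof (cases "n = 0")
  case True
  then show ?thesis by (simp add: measure_cube_unit_cube)
next
  case False
  then obtain i where i: "n $ i \<noteq> 0" by (auto simp: vec_eq_iff)
  \<comment> \<open>Half a period of the character along a coordinate where \<open>n\<close> does
    not vanish: the shift multiplies the character by -1, so its integral equals its own
    negative.\<close>
  define h :: "real ^ 'n" where "h = axis i (1 / (2 * n $ i))"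
  have "n \<bullet> h = 1 / 2" using i by (simp add: h_def inner_axis)
  then have h: "character n h = -1" by (simp add: character_def del: eq_divide_eq_numeral1)
  have "(LINT x|cube_measure. character n x) = (LINT x|cube_measure. character n (x + h))"
    by (rule cube_integral_shift[symmetric, where b = 1]) (auto simp: character_simps character_periodic n)
  also have "\<dots> = - (LINT x|cube_measure. character n x)"
    by (simp add: character_simps h)
  finally show ?thesis using False by simp
qed

lemma character_orthonormal:
  assumes "n \<in> int_lattice" "m \<in> int_lattice"
  shows "(LINT x|cube_measure. character n x * cnj (character m x)) = (if n = m then 1 else 0)"
proof -
  have "character n x * cnj (character m x) = character (n - m) x" for x
    using character_add_left[of n "- m" x] by (simp add: cnj_character)
  then show ?thesis using assms by (simp add: integral_character int_lattice_diff)
qed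

section \<open>Lattice point counting\<close>

definition lattice_count :: "(real ^ 'n) set \<Rightarrow> real ^ 'n \<Rightarrow> real" where
  "lattice_count U x = real (card {k \<in> int_lattice. x + k \<in> U})"

lemma finite_lattice_count:
  assumes "bounded U"
  shows "finite {k \<in> int_lattice. x + k \<in> U}"
proof (rule finite_subset)
  show "{k \<in> int_lattice. x + k \<in> U} \<subseteq> {k \<in> int_lattice. \<exists>y\<in>unit_cube. y + k \<in> (\<lambda>u. u - floor_vec x) ` U}"
    by (auto intro!: bexI[of _ "x - floor_vec x"] image_eqI[of _ _ "x + _"] diff_floor_vec_in_cube)
  show "finite {k \<in> int_lattice. \<exists>y\<in>unit_cube. y + k \<in> (\<lambda>u. u - floor_vec x) ` U}"
    by (intro finite_translates bounded_translation_minus assms)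
qed

lemma lattice_count_periodic: "lattice_periodic (lattice_count (U :: (real ^ 'n) set))"
  unfolding lattice_periodic_def
proof safe
  fix l x :: "real ^ 'n" assume l: "l \<in> int_lattice"
  have "bij_betw (\<lambda>k. l + k) {k \<in> int_lattice. x + l + k \<in> U} {k \<in> int_lattice. x + k \<in> U}"
    by (rule bij_betwI[where g = "\<lambda>k. k - l"]) (auto simp: l int_lattice_add int_lattice_diff add.assoc)
  then show "lattice_count U (x + l) = lattice_count U x"
    unfolding lattice_count_def by (simp only: bij_betw_same_card)
qed

text \<open>The finitely many lattice points in \<open>U\<close> stay there under small shifts
  because \<open>U\<close> is open, so the count cannot drop nearby. The inequality needs no
  epsilon, which is stronger than general lower semicontinuity.\<close>

lemma lattice_count_lsc:
  assumes "bounded U" "open U"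
  shows "eventually (\<lambda>y. lattice_count U x \<le> lattice_count U y) (nhds x)"
proof -
  have "eventually (\<lambda>y. \<forall>k\<in>{k \<in> int_lattice. x + k \<in> U}. y + k \<in> U) (nhds x)"
  proof (intro eventually_ball_finite ballI finite_lattice_count assms)
    fix k assume k: "k \<in> {k \<in> int_lattice. x + k \<in> U}"
    have "((\<lambda>y. y + k) \<longlongrightarrow> x + k) (nhds x)"
      by (intro tendsto_intros filterlim_ident)
    then show "eventually (\<lambda>y. y + k \<in> U) (nhds x)"
      using topological_tendstoD[OF _ assms(2)] k by blast
  qed
  then show ?thesis
  proof eventually_elim
    case (elim y)
    have "card {k \<in> int_lattice. x + k \<in> U} \<le> card {k \<in> int_lattice. y + k \<in> U}"
      by (intro card_mono finite_lattice_count assms) (use elim in auto)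
    then show ?case by (simp add: lattice_count_def)
  qed
qed

lemma borel_measurable_lsc:
  fixes P :: "'a::topological_space \<Rightarrow> real"
  assumes "\<And>x. eventually (\<lambda>y. P x \<le> P y) (nhds x)"
  shows "P \<in> borel_measurable borel"
proof (rule borel_measurableI_greater)
  fix a
  have "open {x. a < P x}"
  proof (subst open_subopen, safe)
    fix x assume "a < P x"
    obtain S where "open S" "x \<in> S" "\<forall>y\<in>S. P x \<le> P y"
      using assms[of x] unfolding eventually_nhds by blast
    then show "\<exists>T. open T \<and> x \<in> T \<and> T \<subseteq> {x. a < P x}"
      using \<open>a < P x\<close> by (intro exI[of _ S]) force
  qed
  then show "{x \<in> space borel. a < P x} \<in> sets borel" by simp
qed

lemma lattice_count_cube:
  assumes "bounded U" "x \<in> unit_cube"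
  shows "lattice_count U x = (\<Sum>k\<in>{k \<in> int_lattice. \<exists>x\<in>unit_cube. x + k \<in> U}. indicator U (x + k))"
proof -
  let ?F = "{k \<in> int_lattice. \<exists>x\<in>unit_cube. x + k \<in> U}"
  have "{k \<in> int_lattice. x + k \<in> U} = {k \<in> ?F. x + k \<in> U}" using assms by auto
  then have "lattice_count U x = (\<Sum>k\<in>{k \<in> ?F. x + k \<in> U}. 1)" by (simp add: lattice_count_def)
  also have "\<dots> = (\<Sum>k\<in>?F. if x + k \<in> U then 1 else 0)"
    using finite_translates[OF assms(1)] by (subst sum.inter_filter) auto
  finally show ?thesis by (simp add: indicator_def of_bool_def)
qed

lemma lattice_count_le:
  fixes U :: "(real ^ 'n) set"
  assumes "\<And>x. x \<in> U \<Longrightarrow> norm x \<le> r"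
  shows "lattice_count U x \<le> (2 * real (nat \<lceil>r + 1\<rceil>) + 1) ^ CARD('n)"
proof -
  let ?F = "{k \<in> int_lattice. \<exists>x\<in>unit_cube. x + k \<in> U}"
  have "lattice_count U x = lattice_count U ((x - floor_vec x) + floor_vec x)" by simp
  also have "\<dots> = lattice_count U (x - floor_vec x)"
    using lattice_count_periodic floor_vec_lattice unfolding lattice_periodic_def by blast
  also have "\<dots> \<le> real (card ?F)"
    unfolding lattice_count_def using diff_floor_vec_in_cube[of x] assms
    by (intro of_nat_mono card_mono translates_card(1)[of U r]) auto
  also have "\<dots> \<le> real ((2 * nat \<lceil>r + 1\<rceil> + 1) ^ CARD('n))"
    using translates_card(2)[of U r] assms by (intro of_nat_mono) auto
  finally show ?thesis by (simp add: add.commute)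
qed

lemma lattice_count_nonneg: "0 \<le> lattice_count U x"
  by (simp add: lattice_count_def)

text \<open>Unfold the integral of the character cut off to \<open>U\<close>: the character is the
  same on all translates and factors out, and the remaining sum of indicators is the count.\<close>

lemma lattice_count_coeff:
  fixes U :: "(real ^ 'n) set"
  assumes U: "bounded U" "open U" and n: "n \<in> int_lattice"
  shows "(LINT x|cube_measure. complex_of_real (lattice_count U x) * cnj (character n x))
       = (LINT y|lborel. indicator U y *\<^sub>R cnj (character n y))"
proof -
  let ?F = "{k \<in> int_lattice. \<exists>x\<in>unit_cube. x + k \<in> U}"
  have [measurable]: "U \<in> sets borel" using U by simp
  define g where "g y = indicator U y *\<^sub>R cnj (character n y)" for y
  have "(LINT y|lborel. g y) = (LINT x|cube_measure. (\<Sum>k\<in>?F. g (x + k)))"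
  proof (rule integral_unfold_cube)
    show "integrable lborel g"
    proof (rule integrableI_bounded)
      show "g \<in> borel_measurable lborel" unfolding g_def by measurable
      have "(\<integral>\<^sup>+x. ennreal (norm (g x)) \<partial>lborel) = (\<integral>\<^sup>+x. indicator U x \<partial>lborel)"
        by (intro nn_integral_cong) (auto simp: g_def indicator_def)
      also have "\<dots> < \<infinity>" using emeasure_bounded_finite[OF U(1)] by simp
      finally show "(\<integral>\<^sup>+x. ennreal (norm (g x)) \<partial>lborel) < \<infinity>" .
    qed
    show "finite ?F" by (rule finite_translates[OF U(1)])
    fix x assume "g x \<noteq> 0"
    then have "x \<in> U" by (auto simp: g_def indicator_def split: if_splits)
    then show "floor_vec x \<in> ?F"
      using floor_vec_lattice diff_floor_vec_in_cube[of x] by (auto intro!: bexI[of _ "x - floor_vec x"])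
  qed auto
  also have "\<dots> = (LINT x|cube_measure. complex_of_real (lattice_count U x) * cnj (character n x))"
  proof (rule Bochner_Integration.integral_cong[OF refl])
    fix x :: "real ^ 'n" assume "x \<in> space cube_measure"
    then have x: "x \<in> unit_cube" by simp
    have "g (x + k) = complex_of_real (indicator U (x + k)) * cnj (character n x)" if "k \<in> ?F" for k
      using character_periodic[OF n] that by (auto simp: g_def lattice_periodic_def scaleR_conv_of_real)
    then show "(\<Sum>k\<in>?F. g (x + k)) = complex_of_real (lattice_count U x) * cnj (character n x)"
      by (simp add: lattice_count_cube[OF U(1) x] sum_distrib_right)
  qed
  finally show ?thesis by (simp add: g_def)
qed

section \<open>The Fejer kernel and Parseval's inequality\<close>

definition freq_box :: "nat \<Rightarrow> (real ^ 'n) set" where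
  "freq_box N = (\<lambda>a. \<chi> i. real (a i)) ` {a::'n \<Rightarrow> nat. \<forall>i. a i < N}"

text \<open>The product of the one-dimensional Fejer kernels, written as a squared exponential sum
  to make positivity immediate. The frequency box starts at the origin instead of being centred,
  since only differences of frequencies matter.\<close>

definition fejer :: "nat \<Rightarrow> real ^ 'n \<Rightarrow> real" where
  "fejer N y = (norm (\<Sum>j\<in>freq_box N. character j y))\<^sup>2 / real N ^ CARD('n)"

lemma card_nat_box:
  fixes b :: "'i::finite \<Rightarrow> nat"
  shows "finite {a. \<forall>i. a i < b i}" "card {a. \<forall>i. a i < b i} = (\<Prod>i\<in>UNIV. b i)"
proof -
  have eq: "{a. \<forall>i. a i < b i} = PiE UNIV (\<lambda>i. {..<b i})" by (auto simp: PiE_UNIV_domain)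
  show "finite {a. \<forall>i. a i < b i}" unfolding eq by (intro finite_PiE) auto
  show "card {a. \<forall>i. a i < b i} = (\<Prod>i\<in>UNIV. b i)" unfolding eq by (subst card_PiE) auto
qed

lemma inj_nat_vec: "inj (\<lambda>a::'n \<Rightarrow> nat. (\<chi> i. real (a i)) :: real ^ 'n)"
  by (auto simp: inj_on_def vec_eq_iff)

lemma freq_box: "finite (freq_box N :: (real ^ 'n) set)" "card (freq_box N :: (real ^ 'n) set) = N ^ CARD('n)"
  "freq_box N \<subseteq> (int_lattice :: (real ^ 'n) set)"
proof -
  show "finite (freq_box N :: (real ^ 'n) set)" unfolding freq_box_def by (intro finite_imageI card_nat_box)
  show "card (freq_box N :: (real ^ 'n) set) = N ^ CARD('n)"
    unfolding freq_box_def by (subst card_image) (auto intro: inj_on_subset[OF inj_nat_vec] simp: card_nat_box)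
  show "freq_box N \<subseteq> (int_lattice :: (real ^ 'n) set)" by (auto simp: freq_box_def int_lattice_def)
qed

lemma freq_box_shift_card:
  fixes i :: "'n::finite"
  assumes "N > 0"
  shows "(real N - 1) * real N ^ (CARD('n) - 1) \<le> real (card {j \<in> freq_box N. j + axis i 1 \<in> (freq_box N :: (real ^ 'n) set)})"
proof -
  \<comment> \<open>In direction \<open>i\<close> the last frequency is left out, so that adding 1
    stays in the box; the other coordinates are free.\<close>
  define b where "b l = (if l = i then N - 1 else N)" for l
  let ?v = "\<lambda>a::'n \<Rightarrow> nat. (\<chi> i. real (a i)) :: real ^ 'n"
  have "?v ` {a. \<forall>l. a l < b l} \<subseteq> {j \<in> freq_box N. j + axis i 1 \<in> freq_box N}"
  proof safe
    fix a :: "'n \<Rightarrow> nat" assume a: "\<forall>l. a l < b l"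
    have "a l < N" for l using a[rule_format, of l] assms by (auto simp: b_def split: if_splits)
    then show "?v a \<in> freq_box N" by (auto simp: freq_box_def)
    have "?v a + axis i 1 = ?v (a(i := Suc (a i)))" by (auto simp: vec_eq_iff axis_def)
    moreover have "(a(i := Suc (a i))) l < N" for l
      using a[rule_format, of l] assms by (auto simp: b_def split: if_splits)
    ultimately show "?v a + axis i 1 \<in> freq_box N" unfolding freq_box_def by blast
  qed
  then have "card (?v ` {a. \<forall>l. a l < b l}) \<le> card {j \<in> freq_box N. j + axis i 1 \<in> (freq_box N :: (real ^ 'n) set)}"
    by (intro card_mono) (auto simp: freq_box)
  moreover have "card (?v ` {a. \<forall>l. a l < b l}) = (\<Prod>l\<in>UNIV. b l)"
    by (subst card_image) (auto intro: inj_on_subset[OF inj_nat_vec] simp: card_nat_box)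
  moreover have "(\<Prod>l\<in>UNIV. b l) = (N - 1) * N ^ (CARD('n) - 1)"
    by (subst prod.remove[of UNIV i]) (auto simp: b_def prod_constant card_Diff_singleton)
  ultimately have "real ((N - 1) * N ^ (CARD('n) - 1)) \<le> real (card {j \<in> freq_box N. j + axis i 1 \<in> (freq_box N :: (real ^ 'n) set)})"
    by (simp only: of_nat_le_iff)
  then show ?thesis using assms by (simp add: of_nat_diff)
qed

lemma fejer_nonneg: "0 \<le> fejer N y"
  by (simp add: fejer_def)

lemma fejer_le: "fejer N (y :: real ^ 'n) \<le> (real N ^ CARD('n))\<^sup>2 / real N ^ CARD('n)"
proof -
  have "norm (\<Sum>j\<in>freq_box N. character j y) \<le> (\<Sum>j\<in>(freq_box N :: (real ^ 'n) set). 1)"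
    by (rule order_trans[OF norm_sum]) simp
  then show ?thesis unfolding fejer_def by (intro divide_right_mono power_mono) (auto simp: freq_box)
qed

lemma fejer_measurable [measurable]: "fejer N \<in> borel_measurable borel"
  unfolding fejer_def by measurable

lemma fejer_periodic: "lattice_periodic (fejer N :: real ^ 'n \<Rightarrow> real)"
  unfolding lattice_periodic_def
proof safe
  fix k x :: "real ^ 'n" assume k: "k \<in> int_lattice"
  have "(\<Sum>j\<in>freq_box N. character j (x + k)) = (\<Sum>j\<in>freq_box N. character j x)"
    using character_periodic freq_box(3) k unfolding lattice_periodic_def by (intro sum.cong refl) blast
  then show "fejer N (x + k) = fejer N x" by (simp only: fejer_def)
qed

lemma fejer_expand:
  "complex_of_real (fejer N (y :: real ^ 'n))
     = (\<Sum>j\<in>freq_box N. \<Sum>k\<in>freq_box N. character (j - k) y) / of_nat N ^ CARD('n)"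
proof -
  have "complex_of_real ((norm (\<Sum>j\<in>freq_box N. character j y))\<^sup>2)
      = (\<Sum>j\<in>freq_box N. character j y) * cnj (\<Sum>j\<in>freq_box N. character j y)"
    by (rule complex_norm_square)
  also have "\<dots> = (\<Sum>j\<in>freq_box N. \<Sum>k\<in>freq_box N. character (j - k) y)"
    unfolding cnj_sum sum_product
    using character_add_left[of _ "- _" y] by (intro sum.cong refl) (simp add: cnj_character)
  finally show ?thesis by (simp add: fejer_def)
qed

text \<open>After expanding the square, orthogonality keeps only the pairs with k = j + m, so the
  coefficient is the fraction of the box that stays inside it under the shift by
  \<open>m\<close>.\<close>

lemma integral_fejer_character:
  fixes m :: "real ^ 'n"
  assumes m: "m \<in> int_lattice"
  shows "(LINT y|cube_measure. complex_of_real (fejer N y) * character m y)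
     = of_nat (card {j \<in> freq_box N. j + m \<in> freq_box N}) / of_nat N ^ CARD('n)"
proof -
  have int: "integrable cube_measure (character n)" for n :: "real ^ 'n"
    by (rule cube_integrable[where b = 1]) auto
  have "complex_of_real (fejer N y) * character m y
      = (\<Sum>j\<in>freq_box N. \<Sum>k\<in>freq_box N. character (j + m - k) y) / of_nat N ^ CARD('n)" for y
  proof -
    have "character (j - k) y * character m y = character (j + m - k) y" for j k
      unfolding character_add_left[symmetric] by (simp add: algebra_simps)
    then show ?thesis by (simp add: fejer_expand sum_distrib_right)
  qed
  then have "(LINT y|cube_measure. complex_of_real (fejer N y) * character m y)
    = (LINT y|cube_measure. (\<Sum>j\<in>freq_box N. \<Sum>k\<in>freq_box N. character (j + m - k) y)) / of_nat N ^ CARD('n)"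
    by simp
  also have "(LINT y|cube_measure. (\<Sum>j\<in>freq_box N. \<Sum>k\<in>freq_box N. character (j + m - k) y))
    = (\<Sum>j\<in>freq_box N. \<Sum>k\<in>freq_box N. LINT y|cube_measure. character (j + m - k) y)"
    using int by (simp add: Bochner_Integration.integral_sum)
  also have "\<dots> = (\<Sum>j\<in>freq_box N. \<Sum>k\<in>freq_box N. if k = j + m then 1 else 0)"
    using m freq_box(3)[of N] by (intro sum.cong refl)
      (subst integral_character, auto intro!: int_lattice_add int_lattice_diff)
  also have "\<dots> = (\<Sum>j\<in>freq_box N. if j + m \<in> freq_box N then 1 else 0)"
    by (intro sum.cong refl) (simp add: sum.delta freq_box)
  also have "\<dots> = of_nat (card {j \<in> freq_box N. j + m \<in> freq_box N})"
    by (subst sum.inter_filter[symmetric]) (auto simp: freq_box)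
  finally show ?thesis .
qed

lemma integral_fejer:
  assumes "N > 0"
  shows "(LINT y|cube_measure. fejer N (y :: real ^ 'n)) = 1"
proof -
  have "complex_of_real (LINT y|cube_measure. fejer N (y :: real ^ 'n)) = (LINT y|cube_measure. complex_of_real (fejer N (y :: real ^ 'n)) * character 0 y)"
    by simp
  also have "\<dots> = 1" using assms by (subst integral_fejer_character) (auto simp: freq_box)
  finally show ?thesis by (metis of_real_eq_1_iff)
qed

text \<open>This measures the concentration of the kernel near the lattice. The integral is 1 minus
  the coefficient at a unit vector, and a unit shift pushes at most a fraction 1/N of the box
  outside.\<close>

lemma integral_fejer_cos:
  fixes i :: "'n::finite"
  assumes N: "N > 0"
  shows "(LINT y|cube_measure. fejer N y * (1 - cos (2 * pi * (y $ i)))) \<le> 1 / real N"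
proof -
  let ?m = "axis i 1 :: real ^ 'n"
  have m: "?m \<in> int_lattice" by (auto simp: int_lattice_def axis_def)
  have if1: "integrable cube_measure (fejer N :: real ^ 'n \<Rightarrow> real)"
    by (rule cube_integrable[where b = "(real N ^ CARD('n))\<^sup>2 / real N ^ CARD('n)"]) (auto simp: fejer_nonneg fejer_le)
  have if2: "integrable cube_measure (\<lambda>y. complex_of_real (fejer N y) * character ?m y)"
    by (rule cube_integrable[where b = "(real N ^ CARD('n))\<^sup>2 / real N ^ CARD('n)"]) (auto simp: norm_mult fejer_nonneg fejer_le)
  have cos: "fejer N y * cos (2 * pi * (y $ i)) = Re (complex_of_real (fejer N y) * character ?m y)" for y :: "real ^ 'n"
    by (simp add: character_def inner_axis')
  have "(LINT y|cube_measure. fejer N y * (1 - cos (2 * pi * (y $ i))))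
      = (LINT y|cube_measure. fejer N y - Re (complex_of_real (fejer N y) * character ?m y))"
    by (simp add: right_diff_distrib cos del: Re_complex_of_real)
  also have "\<dots> = 1 - Re (LINT y|cube_measure. complex_of_real (fejer N y) * character ?m y)"
    using integrable_Re[OF if2]
    by (subst Bochner_Integration.integral_diff[OF if1]) (auto simp only: integral_fejer[OF N] integral_Re[OF if2])
  also have "\<dots> = 1 - real (card {j \<in> freq_box N. j + ?m \<in> freq_box N}) / real N ^ CARD('n)"
    unfolding integral_fejer_character[OF m] by (simp add: Re_divide_of_nat flip: of_nat_power)
  also have "\<dots> \<le> 1 - ((real N - 1) * real N ^ (CARD('n) - 1)) / real N ^ CARD('n)"
    using freq_box_shift_card[OF N, of i] by (simp add: divide_right_mono)
  also have "\<dots> = 1 / real N"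
  proof -
    have "real N ^ CARD('n) = real N * real N ^ (CARD('n) - 1)"
      by (metis power_eq_if zero_less_card_finite less_irrefl)
    then show ?thesis using N by (simp add: field_simps)
  qed
  finally show ?thesis .
qed

interpretation cube_pair: pair_prob_space "cube_measure :: (real ^ 'n) measure" "cube_measure :: (real ^ 'n) measure"
  by standard

lemma borel_measurable_cube_pair:
  assumes "f \<in> measurable (borel \<Otimes>\<^sub>M borel) N"
  shows "f \<in> measurable (cube_measure \<Otimes>\<^sub>M cube_measure) N"
proof -
  have id: "(\<lambda>x. x) \<in> measurable cube_measure borel" by (rule borel_measurable_cube_measure) simp
  have "(\<lambda>z. (fst z, snd z)) \<in> measurable (cube_measure \<Otimes>\<^sub>M cube_measure) (borel \<Otimes>\<^sub>M borel)"
    by (intro measurable_Pair measurable_compose[OF measurable_fst id] measurable_compose[OF measurable_snd id])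
  from measurable_compose[OF this assms] show ?thesis by simp
qed

locale lsc_periodic =
  fixes P :: "real ^ 'n \<Rightarrow> real" and b :: real
  assumes P_nonneg: "\<And>x. 0 \<le> P x" and P_le: "\<And>x. P x \<le> b"
    and P_lsc: "\<And>x. eventually (\<lambda>y. P x \<le> P y) (nhds x)"
    and P_periodic: "lattice_periodic P"
begin

lemma P_measurable [measurable]: "P \<in> borel_measurable borel"
  by (rule borel_measurable_lsc) (rule P_lsc)

lemma b_nonneg: "0 \<le> b"
  using P_nonneg P_le order_trans by blast

text \<open>Its Fourier coefficients are the squared moduli of those of \<open>P\<close>, and its
  value at 0 is the energy of \<open>P\<close>, so Parseval's inequality becomes a statement about
  one point value.\<close>

definition autocorr :: "real ^ 'n \<Rightarrow> real" where
  "autocorr y = (LINT x|cube_measure. P x * P (x + y))"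

lemma PP_le: "P x * P y \<le> b * b"
  by (intro mult_mono P_le P_nonneg b_nonneg)

lemma integrable_PP: "integrable cube_measure (\<lambda>x. P x * P (x + y))"
  by (rule cube_integrable[where b = "b * b"]) (auto simp: P_nonneg PP_le)

lemma autocorr_nonneg: "0 \<le> autocorr y"
  unfolding autocorr_def by (intro Bochner_Integration.integral_nonneg) (simp add: P_nonneg)

lemma autocorr_periodic: "lattice_periodic autocorr"
  using P_periodic unfolding lattice_periodic_def autocorr_def by (simp add: add.assoc[symmetric])

text \<open>Along shifts tending to 0, \<open>P (x + Y j)\<close> need not converge to
  \<open>P x\<close>, but it is eventually not smaller. Truncated at \<open>P x\<close> it becomes
  eventually constant in j, and dominated convergence applies to this lower bound.\<close>

lemma autocorr_lsc_0:
  assumes e: "e > 0"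
  shows "\<exists>\<delta>>0. \<forall>y. norm y < \<delta> \<longrightarrow> autocorr 0 - e \<le> autocorr y"
proof (rule ccontr)
  assume "\<not> ?thesis"
  then have "\<exists>y. norm y < inverse (real (Suc j)) \<and> autocorr y < autocorr 0 - e" for j
    by (metis inverse_positive_iff_positive not_le of_nat_0_less_iff zero_less_Suc)
  then obtain Y where Y: "\<And>j. norm (Y j) < inverse (real (Suc j))" "\<And>j. autocorr (Y j) < autocorr 0 - e"
    by metis
  have Y0: "Y \<longlonglongrightarrow> 0"
    by (rule Lim_null_comparison[OF always_eventually LIMSEQ_inverse_real_of_nat]) (use Y(1) less_imp_le in blast)
  define h where "h j x = P x * min (P x) (P (x + Y j))" for j x
  have [measurable]: "h j \<in> borel_measurable borel" for j unfolding h_def by measurable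
  have hb: "norm (h j x) \<le> b * b" for j x
    unfolding h_def using P_nonneg P_le b_nonneg by (auto simp: abs_mult min_def intro!: mult_mono)
  have "(\<lambda>j. LINT x|cube_measure. h j x) \<longlonglongrightarrow> (LINT x|cube_measure. P x * P x)"
  proof (rule integral_dominated_convergence[where w = "\<lambda>_. b * b"])
    show "AE x in cube_measure. (\<lambda>j. h j x) \<longlonglongrightarrow> P x * P x"
    proof (rule AE_I2)
      fix x
      have "((\<lambda>j. x + Y j) \<longlongrightarrow> x + 0) sequentially" by (intro tendsto_intros Y0)
      then have "eventually (\<lambda>j. P x \<le> P (x + Y j)) sequentially"
        using P_lsc[of x] by (auto simp: filterlim_iff)
      then have "eventually (\<lambda>j. h j x = P x * P x) sequentially"
        by eventually_elim (simp add: h_def)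
      then show "(\<lambda>j. h j x) \<longlonglongrightarrow> P x * P x" by (rule tendsto_eventually)
    qed
  qed (auto intro!: borel_measurable_cube_measure AE_I2 hb[simplified])
  moreover have "(LINT x|cube_measure. h j x) \<le> autocorr 0 - e" for j
  proof -
    have "(LINT x|cube_measure. h j x) \<le> autocorr (Y j)"
      unfolding autocorr_def
      by (intro integral_mono integrable_PP cube_integrable[where b = "b * b"] hb)
        (auto simp: h_def intro!: mult_left_mono P_nonneg)
    then show ?thesis using Y(2)[of j] by simp
  qed
  ultimately have "(LINT x|cube_measure. P x * P x) \<le> autocorr 0 - e"
    by (intro LIMSEQ_le_const2) auto
  then show False using e by (simp add: autocorr_def)
qed

text \<open>Lower semicontinuity at the origin only enters through this minorant, whose integral against
  the Fejer kernel can be computed from the Fourier coefficients of the kernel.\<close>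

lemma autocorr_minorant:
  assumes e: "e > 0"
  shows "\<exists>C\<ge>0. \<forall>y. autocorr 0 - e - C * (\<Sum>i\<in>UNIV. 1 - cos (2 * pi * (y $ i))) \<le> autocorr y"
proof -
  from autocorr_lsc_0[OF e] obtain \<delta> where \<delta>: "\<delta> > 0" "\<And>y. norm y < \<delta> \<Longrightarrow> autocorr 0 - e \<le> autocorr y" by blast
  \<comment> \<open>The bound 1/2 keeps 2 pi \<eta> within [0, pi], where the cosine decreases; the
    other term makes a vector with all coordinates at most \<eta> shorter than \<delta>, by
    comparison with the l^1 norm.\<close>
  define \<eta> where "\<eta> = min (1 / 2) (\<delta> / (2 * real CARD('n)))"
  have \<eta>: "\<eta> > 0" "\<eta> \<le> 1 / 2" "real CARD('n) * \<eta> < \<delta>"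
  proof -
    show "\<eta> > 0" "\<eta> \<le> 1 / 2" using \<delta> by (auto simp: \<eta>_def)
    have "real CARD('n) * \<eta> \<le> real CARD('n) * (\<delta> / (2 * real CARD('n)))"
      by (intro mult_left_mono) (auto simp: \<eta>_def)
    also have "\<dots> < \<delta>" using \<delta> by simp
    finally show "real CARD('n) * \<eta> < \<delta>" .
  qed
  define \<kappa> where "\<kappa> = 1 - cos (2 * pi * \<eta>)"
  have \<kappa>: "\<kappa> > 0"
    unfolding \<kappa>_def using cos_monotone_0_pi[of 0 "2 * pi * \<eta>"] \<eta> by (simp add: field_simps)
  have C: "autocorr 0 / \<kappa> \<ge> 0" using \<kappa> autocorr_nonneg by simp
  have nn: "0 \<le> (\<Sum>i\<in>UNIV. 1 - cos (2 * pi * (y $ i)))" for y :: "real ^ 'n"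
    by (intro sum_nonneg) simp
  have "autocorr 0 - e - autocorr 0 / \<kappa> * (\<Sum>i\<in>UNIV. 1 - cos (2 * pi * (y $ i))) \<le> autocorr y" for y
  proof -
    \<comment> \<open>The nearest lattice point. Close to it semicontinuity applies; otherwise some
      summand is at least \<open>\<kappa>\<close>, and the constant
      \<open>autocorr 0 / \<kappa>\<close> pushes the left side below 0.\<close>
    define k :: "real ^ 'n" where "k = (\<chi> i. of_int (round (y $ i)))"
    have k: "k \<in> int_lattice" by (simp add: k_def int_lattice_def)
    show ?thesis
    proof (cases "\<forall>i. \<bar>(y - k) $ i\<bar> \<le> \<eta>")
      case True
      have "norm (y - k) \<le> (\<Sum>i\<in>UNIV. \<bar>(y - k) $ i\<bar>)" by (rule norm_le_l1_cart)
      also have "\<dots> \<le> (\<Sum>i\<in>(UNIV::'n set). \<eta>)" using True by (intro sum_mono) auto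
      also have "\<dots> < \<delta>" using \<eta> by simp
      finally have "autocorr 0 - e \<le> autocorr (y - k)" by (rule \<delta>)
      also have "autocorr (y - k) = autocorr y"
        using autocorr_periodic k int_lattice_uminus[OF k] unfolding lattice_periodic_def
        by (metis diff_conv_add_uminus)
      finally show ?thesis using mult_nonneg_nonneg[OF C nn[of y]] by linarith
    next
      case False
      then obtain i where i: "\<eta> < \<bar>(y - k) $ i\<bar>" by (auto simp: not_le)
      define z where "z = (y - k) $ i"
      have z: "\<bar>z\<bar> \<le> 1 / 2"
        using of_int_round_abs_le[of "y $ i"] by (simp add: z_def k_def abs_minus_commute)
      have "cos (2 * pi * (y $ i)) = cos (2 * pi * z + 2 * pi * of_int (round (y $ i)))"
        by (simp add: z_def k_def algebra_simps)
      also have "\<dots> = cos (2 * pi * z)"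
        by (simp add: cos_add)
      also have "\<dots> = cos (2 * pi * \<bar>z\<bar>)" by (cases "z \<ge> 0") auto
      also have "\<dots> \<le> cos (2 * pi * \<eta>)"
        using \<eta> i z unfolding z_def[symmetric] by (intro cos_monotone_0_pi_le) (auto simp: field_simps)
      finally have "\<kappa> \<le> 1 - cos (2 * pi * (y $ i))" by (simp add: \<kappa>_def)
      also have "\<dots> \<le> (\<Sum>i\<in>UNIV. 1 - cos (2 * pi * (y $ i)))"
        by (intro member_le_sum) auto
      finally have "autocorr 0 / \<kappa> * \<kappa> \<le> autocorr 0 / \<kappa> * (\<Sum>i\<in>UNIV. 1 - cos (2 * pi * (y $ i)))"
        using C by (intro mult_left_mono)
      then have "autocorr 0 \<le> autocorr 0 / \<kappa> * (\<Sum>i\<in>UNIV. 1 - cos (2 * pi * (y $ i)))" using \<kappa> by simp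
      then show ?thesis using autocorr_nonneg[of y] e by linarith
    qed
  qed
  then show ?thesis using C by blast
qed

definition fcoeff :: "real ^ 'n \<Rightarrow> complex" where
  "fcoeff n = (LINT x|cube_measure. complex_of_real (P x) * cnj (character n x))"

lemma fcoeff_minus: "(LINT y|cube_measure. character n y * complex_of_real (P y)) = cnj (fcoeff n)"
proof -
  have "integrable cube_measure (\<lambda>x. complex_of_real (P x) * cnj (character n x))"
    by (rule cube_integrable[where b = b]) (auto simp: norm_mult P_nonneg P_le)
  from integral_bounded_linear[OF bounded_linear_cnj this] show ?thesis
    by (simp add: fcoeff_def mult.commute)
qed

lemma autocorr_measurable: "autocorr \<in> borel_measurable cube_measure"
proof -
  have "(\<lambda>y. LINT x|cube_measure. P x * P (x + y)) \<in> borel_measurable cube_measure"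
    by (rule cube.borel_measurable_lebesgue_integral, rule borel_measurable_cube_pair) measurable
  then show ?thesis by (simp add: autocorr_def[abs_def])
qed

text \<open>Shifting the variable of integration by \<open>x\<close> moves the dependence on
  \<open>x\<close> into the kernel, where it separates because characters are
  multiplicative.\<close>

lemma fejer_convolution:
  "complex_of_real (LINT y|cube_measure. fejer N y * P (x + y))
     = (\<Sum>j\<in>freq_box N. \<Sum>k\<in>freq_box N. cnj (character (j - k) x) * cnj (fcoeff (j - k))) / of_nat N ^ CARD('n)"
proof -
  define K where "K = (real N ^ CARD('n))\<^sup>2 / real N ^ CARD('n)"
  have fK: "0 \<le> fejer N z" "fejer N z \<le> K" for z :: "real ^ 'n"
    unfolding K_def by (auto simp: fejer_nonneg fejer_le)
  have "(LINT y|cube_measure. fejer N y * P (x + y)) = (LINT y|cube_measure. fejer N (y + x - x) * P (y + x))"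
    by (simp add: add.commute)
  also have "\<dots> = (LINT y|cube_measure. fejer N (y - x) * P y)"
  proof (rule cube_integral_shift[where b = "K * b" and f = "\<lambda>y. fejer N (y - x) * P y"])
    show "norm (fejer N (y - x) * P y) \<le> K * b" for y
      using fK[of "y - x"] P_nonneg[of y] P_le[of y] b_nonneg by (auto simp: abs_mult intro!: mult_mono)
    show "lattice_periodic (\<lambda>y. fejer N (y - x) * P y)"
      using P_periodic fejer_periodic[of N] unfolding lattice_periodic_def by (metis add_diff_eq add.commute)
  qed measurable
  finally have "complex_of_real (LINT y|cube_measure. fejer N y * P (x + y))
      = (LINT y|cube_measure. complex_of_real (fejer N (y - x)) * complex_of_real (P y))"
    by (simp flip: integral_complex_of_real)
  also have "\<dots> = (LINT y|cube_measure. (\<Sum>j\<in>freq_box N. \<Sum>k\<in>freq_box N.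
      cnj (character (j - k) x) * (character (j - k) y * complex_of_real (P y))) / of_nat N ^ CARD('n))"
  proof (rule Bochner_Integration.integral_cong[OF refl])
    fix y
    have "character n (y - x) = cnj (character n x) * character n y" for n :: "real ^ 'n"
      using character_add_right[of n y "- x"] by (simp add: character_minus_right cnj_character mult.commute)
    then show "complex_of_real (fejer N (y - x)) * complex_of_real (P y) = (\<Sum>j\<in>freq_box N. \<Sum>k\<in>freq_box N.
      cnj (character (j - k) x) * (character (j - k) y * complex_of_real (P y))) / of_nat N ^ CARD('n)"
      by (simp add: fejer_expand sum_distrib_right mult.assoc)
  qed
  also have "\<dots> = (\<Sum>j\<in>freq_box N. \<Sum>k\<in>freq_box N.
      cnj (character (j - k) x) * (LINT y|cube_measure. character (j - k) y * complex_of_real (P y))) / of_nat N ^ CARD('n)"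
  proof -
    have "integrable cube_measure (\<lambda>y. character n y * complex_of_real (P y))" for n
      by (rule cube_integrable[where b = b]) (auto simp: norm_mult P_nonneg P_le)
    then show ?thesis by (simp add: Bochner_Integration.integral_sum)
  qed
  finally show ?thesis by (simp only: fcoeff_minus)
qed

text \<open>By Fubini, the other factor of \<open>P\<close> pairs with the separated characters and
  completes the squares. The double sum is not collected by differences j - k with multiplicities,
  because it is later bounded row by row.\<close>

lemma fejer_autocorr:
  "complex_of_real (LINT y|cube_measure. fejer N y * autocorr y)
     = (\<Sum>j\<in>freq_box N. \<Sum>k\<in>freq_box N. complex_of_real ((norm (fcoeff (j - k)))\<^sup>2)) / of_nat N ^ CARD('n)"
proof -
  define K where "K = (real N ^ CARD('n))\<^sup>2 / real N ^ CARD('n)"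
  have fK: "0 \<le> fejer N z" "fejer N z \<le> K" for z :: "real ^ 'n"
    unfolding K_def by (auto simp: fejer_nonneg fejer_le)
  have "(LINT y|cube_measure. fejer N y * autocorr y) = (LINT y|cube_measure. (LINT x|cube_measure. fejer N y * (P x * P (x + y))))"
    unfolding autocorr_def by simp
  also have "\<dots> = (LINT x|cube_measure. (LINT y|cube_measure. fejer N y * (P x * P (x + y))))"
  proof (rule cube_pair.Fubini_integral)
    show "integrable (cube_measure \<Otimes>\<^sub>M cube_measure) (\<lambda>(x, y). fejer N y * (P x * P (x + y)))"
    proof (rule cube_pair.P.integrable_const_bound[where B = "K * (b * b)"])
      show "(\<lambda>(x, y). fejer N y * (P x * P (x + y))) \<in> borel_measurable (cube_measure \<Otimes>\<^sub>M cube_measure)"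
        by (rule borel_measurable_cube_pair) measurable
      have "norm (fejer N y * (P x * P (x + y))) \<le> K * (b * b)" for x y
        using fK[of y] P_nonneg PP_le b_nonneg by (auto simp: abs_mult intro!: mult_mono P_le)
      then show "AE z in cube_measure \<Otimes>\<^sub>M cube_measure. norm (case z of (x, y) \<Rightarrow> fejer N y * (P x * P (x + y))) \<le> K * (b * b)"
        by (auto intro!: AE_I2)
    qed
  qed
  also have "\<dots> = (LINT x|cube_measure. P x * (LINT y|cube_measure. fejer N y * P (x + y)))"
    by (simp add: mult.left_commute)
  finally have "complex_of_real (LINT y|cube_measure. fejer N y * autocorr y)
      = (LINT x|cube_measure. complex_of_real (P x) * complex_of_real (LINT y|cube_measure. fejer N y * P (x + y)))"
    by (simp only: integral_complex_of_real[symmetric] of_real_mult)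
  also have "\<dots> = (LINT x|cube_measure. (\<Sum>j\<in>freq_box N. \<Sum>k\<in>freq_box N.
       cnj (fcoeff (j - k)) * (complex_of_real (P x) * cnj (character (j - k) x))) / of_nat N ^ CARD('n))"
    unfolding fejer_convolution by (simp add: sum_distrib_left mult_ac)
  also have "\<dots> = (\<Sum>j\<in>freq_box N. \<Sum>k\<in>freq_box N. cnj (fcoeff (j - k)) * fcoeff (j - k)) / of_nat N ^ CARD('n)"
  proof -
    have "integrable cube_measure (\<lambda>x. complex_of_real (P x) * cnj (character n x))" for n
      by (rule cube_integrable[where b = b]) (auto simp: norm_mult P_nonneg P_le)
    then show ?thesis by (simp add: Bochner_Integration.integral_sum fcoeff_def[symmetric])
  qed
  also have "\<dots> = (\<Sum>j\<in>freq_box N. \<Sum>k\<in>freq_box N. complex_of_real ((norm (fcoeff (j - k)))\<^sup>2)) / of_nat N ^ CARD('n)"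
    unfolding complex_norm_square by (simp only: mult.commute)
  finally show ?thesis .
qed

text \<open>The Fejer mean of the autocorrelation is at most \<open>S\<close>, while integrating the
  minorant bounds it below by \<open>autocorr 0\<close> minus e/2 and an error of order 1/N.\<close>

lemma parseval_le:
  "(\<integral>\<^sup>+x. ennreal ((P x)\<^sup>2) \<partial>cube_measure) \<le> (\<integral>\<^sup>+n. ennreal ((norm (fcoeff n))\<^sup>2) \<partial>count_space int_lattice)"
  (is "_ \<le> ?S")
proof (cases "?S = \<infinity>")
  case False
  then obtain S where S: "S \<ge> 0" "?S = ennreal S" by (cases ?S) auto
  have fin: "(\<Sum>n\<in>A. (norm (fcoeff n))\<^sup>2) \<le> S" if "finite A" "A \<subseteq> int_lattice" for A
  proof -
    have "ennreal (\<Sum>n\<in>A. (norm (fcoeff n))\<^sup>2) = (\<integral>\<^sup>+n. ennreal ((norm (fcoeff n))\<^sup>2) \<partial>count_space A)"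
      using that by (simp add: nn_integral_count_space_finite)
    also have "\<dots> \<le> ?S"
      using that by (auto simp: nn_integral_count_space_indicator intro!: nn_integral_mono split: split_indicator)
    finally show ?thesis using S by simp
  qed
  have upper: "(LINT y|cube_measure. fejer N y * autocorr y) \<le> S" if N: "N > 0" for N
  proof -
    let ?J = "freq_box N :: (real ^ 'n) set"
    have "complex_of_real (LINT y|cube_measure. fejer N y * autocorr y)
       = complex_of_real ((\<Sum>k\<in>?J. \<Sum>j\<in>?J. (norm (fcoeff (j - k)))\<^sup>2) / real N ^ CARD('n))"
      unfolding fejer_autocorr by (subst sum.swap) simp
    then have eq: "(LINT y|cube_measure. fejer N y * autocorr y) = (\<Sum>k\<in>?J. \<Sum>j\<in>?J. (norm (fcoeff (j - k)))\<^sup>2) / real N ^ CARD('n)"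
      by (simp only: of_real_eq_iff)
    \<comment> \<open>For fixed k the differences j - k are distinct lattice points, so the row is a
      partial sum of the series. The number of rows cancels the normalisation of the kernel.\<close>
    have "(\<Sum>j\<in>?J. (norm (fcoeff (j - k)))\<^sup>2) \<le> S" if "k \<in> ?J" for k
    proof -
      have "(\<Sum>j\<in>?J. (norm (fcoeff (j - k)))\<^sup>2) = (\<Sum>n\<in>(\<lambda>j. j - k) ` ?J. (norm (fcoeff n))\<^sup>2)"
        by (subst sum.reindex) (auto simp: inj_on_def)
      also have "\<dots> \<le> S"
        using that freq_box(3)[of N] by (intro fin finite_imageI freq_box) (auto intro!: int_lattice_diff)
      finally show ?thesis .
    qed
    then have "(\<Sum>k\<in>?J. \<Sum>j\<in>?J. (norm (fcoeff (j - k)))\<^sup>2) \<le> (\<Sum>k\<in>?J. S)" by (rule sum_mono)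
    also have "\<dots> = S * real N ^ CARD('n)" by (simp add: freq_box)
    finally show ?thesis unfolding eq using N by (simp add: field_simps)
  qed
  have "autocorr 0 \<le> S"
  proof (rule field_le_epsilon)
    fix e :: real assume e: "0 < e"
    then have e2: "e / 2 > 0" by simp
    from autocorr_minorant[OF e2] obtain C where C: "C \<ge> 0"
      "\<And>y. autocorr 0 - e / 2 - C * (\<Sum>i\<in>UNIV. 1 - cos (2 * pi * (y $ i))) \<le> autocorr y" by blast
    obtain N :: nat where N: "2 * C * CARD('n) / e < real N" using reals_Archimedean2 by blast
    have "0 \<le> 2 * C * CARD('n) / e" using C e by simp
    then have N0: "N > 0" using N by (cases N) auto
    have fint: "integrable cube_measure (fejer N :: real ^ 'n \<Rightarrow> real)"
      by (rule cube_integrable[where b = "(real N ^ CARD('n))\<^sup>2 / real N ^ CARD('n)"]) (auto simp: fejer_nonneg fejer_le)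
    have cint: "integrable cube_measure (\<lambda>y::real ^ 'n. fejer N y * (1 - cos (2 * pi * (y $ i))))" for i
    proof (rule cube_integrable[where b = "(real N ^ CARD('n))\<^sup>2 / real N ^ CARD('n) * 2"])
      show "norm (fejer N y * (1 - cos (2 * pi * (y $ i)))) \<le> (real N ^ CARD('n))\<^sup>2 / real N ^ CARD('n) * 2" for y :: "real ^ 'n"
        unfolding norm_mult using cos_ge_minus_one[of "2 * pi * (y $ i)"]
        by (intro mult_mono) (auto simp: fejer_nonneg fejer_le)
    qed measurable
    have aint: "integrable cube_measure (\<lambda>y. fejer N y * autocorr y)"
    proof (rule cube.integrable_const_bound[where B = "(real N ^ CARD('n))\<^sup>2 / real N ^ CARD('n) * (b * b)"])
      have "autocorr y \<le> b * b" for y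
        unfolding autocorr_def using integral_mono[OF integrable_PP, of "\<lambda>_. b * b" y] PP_le
        by (simp add: measure_cube_unit_cube)
      then show "AE y in cube_measure. norm (fejer N y * autocorr y) \<le> (real N ^ CARD('n))\<^sup>2 / real N ^ CARD('n) * (b * b)"
        using autocorr_nonneg b_nonneg
        unfolding norm_mult by (intro AE_I2 mult_mono) (auto simp: fejer_nonneg fejer_le)
      show "(\<lambda>y. fejer N y * autocorr y) \<in> borel_measurable cube_measure"
        by (intro borel_measurable_times autocorr_measurable borel_measurable_cube_measure) simp
    qed
    have "(autocorr 0 - e / 2) - C * (CARD('n) / real N)
       \<le> (autocorr 0 - e / 2) * (LINT y|cube_measure. fejer N (y :: real ^ 'n))
        - C * (\<Sum>i\<in>(UNIV::'n set). (LINT y|cube_measure. fejer N y * (1 - cos (2 * pi * (y $ i)))))"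
    proof -
      have "(\<Sum>i\<in>(UNIV::'n set). (LINT y|cube_measure. fejer N y * (1 - cos (2 * pi * (y $ i))))) \<le> (\<Sum>i\<in>(UNIV::'n set). 1 / real N)"
        by (intro sum_mono integral_fejer_cos N0)
      then show ?thesis using mult_left_mono[OF _ C(1)] by (fastforce simp: integral_fejer[OF N0])
    qed
    also have "\<dots> = (LINT y|cube_measure. (autocorr 0 - e / 2) * fejer N (y :: real ^ 'n) - C * (\<Sum>i\<in>UNIV. fejer N y * (1 - cos (2 * pi * (y $ i)))))"
    proof -
      have "(LINT y|cube_measure. (autocorr 0 - e / 2) * fejer N (y :: real ^ 'n) - C * (\<Sum>i\<in>UNIV. fejer N y * (1 - cos (2 * pi * (y $ i)))))
          = (LINT y|cube_measure. (autocorr 0 - e / 2) * fejer N (y :: real ^ 'n))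
            - (LINT y|cube_measure. C * (\<Sum>i\<in>(UNIV::'n set). fejer N y * (1 - cos (2 * pi * (y $ i)))))"
        by (intro Bochner_Integration.integral_diff integrable_mult_right Bochner_Integration.integrable_sum fint cint)
      also have "(LINT y|cube_measure. C * (\<Sum>i\<in>(UNIV::'n set). fejer N y * (1 - cos (2 * pi * (y $ i)))))
          = C * (LINT y|cube_measure. (\<Sum>i\<in>(UNIV::'n set). fejer N y * (1 - cos (2 * pi * (y $ i)))))"
        by (rule integral_mult_right_zero)
      also have "(LINT y|cube_measure. (\<Sum>i\<in>(UNIV::'n set). fejer N y * (1 - cos (2 * pi * (y $ i)))))
          = (\<Sum>i\<in>(UNIV::'n set). (LINT y|cube_measure. fejer N y * (1 - cos (2 * pi * (y $ i)))))"
        by (intro Bochner_Integration.integral_sum cint)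
      finally show ?thesis by simp
    qed
    also have "\<dots> \<le> (LINT y|cube_measure. fejer N y * autocorr y)"
    proof (intro integral_mono aint Bochner_Integration.integrable_diff integrable_mult_right Bochner_Integration.integrable_sum fint cint)
      fix y :: "real ^ 'n"
      have "(autocorr 0 - e / 2) * fejer N y - C * (\<Sum>i\<in>UNIV. fejer N y * (1 - cos (2 * pi * (y $ i))))
         = fejer N y * (autocorr 0 - e / 2 - C * (\<Sum>i\<in>UNIV. 1 - cos (2 * pi * (y $ i))))"
        unfolding sum_distrib_left[symmetric] by (simp only: algebra_simps)
      also have "\<dots> \<le> fejer N y * autocorr y" by (intro mult_left_mono C fejer_nonneg)
      finally show "(autocorr 0 - e / 2) * fejer N y - C * (\<Sum>i\<in>UNIV. fejer N y * (1 - cos (2 * pi * (y $ i)))) \<le> fejer N y * autocorr y" .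
    qed
    also have "\<dots> \<le> S" by (rule upper[OF N0])
    finally have "autocorr 0 \<le> S + e / 2 + C * (CARD('n) / real N)" by simp
    moreover have "C * (CARD('n) / real N) \<le> e / 2" using N N0 e by (simp add: field_simps)
    ultimately show "autocorr 0 \<le> S + e" by linarith
  qed
  moreover have "(\<integral>\<^sup>+x. ennreal ((P x)\<^sup>2) \<partial>cube_measure) = ennreal (autocorr 0)"
    unfolding autocorr_def using integrable_PP[of 0]
    by (subst nn_integral_eq_integral[symmetric]) (auto simp: power2_eq_square P_nonneg)
  ultimately show ?thesis using S by (simp add: ennreal_leI)
qed simp

end

section \<open>The discrepancy of a dilated domain\<close>

lemma lborel_integral_scale:
  fixes g :: "'a::euclidean_space \<Rightarrow> complex"
  assumes [measurable]: "g \<in> borel_measurable borel" and R: "R > 0"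
  shows "(LINT y|lborel. g y) = of_real (R ^ DIM('a)) * (LINT y|lborel. g (R *\<^sub>R y))"
proof -
  have "(LINT y|lborel. g y) = (LINT y|density (distr lborel borel (\<lambda>x. 0 + R *\<^sub>R x)) (\<lambda>_. ennreal (\<bar>R\<bar> ^ DIM('a))). g y)"
    using lborel_affine[of R "0 :: 'a"] R by simp
  also have "\<dots> = (LINT y|distr lborel borel (\<lambda>x. 0 + R *\<^sub>R x). (\<bar>R\<bar> ^ DIM('a)) *\<^sub>R g y)"
    by (subst integral_density) auto
  also have "\<dots> = (LINT y|lborel. (\<bar>R\<bar> ^ DIM('a)) *\<^sub>R g (0 + R *\<^sub>R y))"
    by (subst integral_distr) auto
  finally show ?thesis using R by (simp add: scaleR_conv_of_real)
qed

locale dilated_domain =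
  fixes \<Omega> :: "(real ^ 'n) set" and R :: real
  assumes bounded_dom: "bounded \<Omega>" and open_dom: "open \<Omega>" and R_pos: "R > 0"
begin

definition U :: "(real ^ 'n) set" where "U = (\<lambda>y. R *\<^sub>R y) ` \<Omega>"

definition coef :: "real ^ 'n \<Rightarrow> complex" where
  "coef n = of_real (R ^ CARD('n)) * ft_char \<Omega> (R *\<^sub>R n)"

lemma U: "bounded U" "open U"
  unfolding U_def using bounded_dom open_dom R_pos by (auto intro: bounded_scaling open_scaling)

lemma scaleR_in_U: "R *\<^sub>R y \<in> U \<longleftrightarrow> y \<in> \<Omega>"
  using R_pos by (auto simp: U_def)

lemma discrepancy_eq: "discrepancy \<Omega> R x = lattice_count U x - R ^ CARD('n) * measure lebesgue \<Omega>"
proof -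
  have "{k \<in> int_lattice. k \<in> (\<lambda>y. R *\<^sub>R y - x) ` \<Omega>} = {k \<in> int_lattice. x + k \<in> U}"
    by (auto simp: U_def image_iff algebra_simps)
  then show ?thesis by (simp add: discrepancy_def lattice_count_def)
qed

lemma count_coeff:
  assumes n: "n \<in> int_lattice"
  shows "(LINT x|cube_measure. complex_of_real (lattice_count U x) * cnj (character n x)) = coef n"
proof -
  have [measurable]: "U \<in> sets borel" "\<Omega> \<in> sets borel" using U open_dom by auto
  have "(LINT x|cube_measure. complex_of_real (lattice_count U x) * cnj (character n x))
      = (LINT y|lborel. indicator U y *\<^sub>R cnj (character n y))"
    by (rule lattice_count_coeff[OF U n])
  also have "\<dots> = of_real (R ^ CARD('n)) * (LINT y|lborel. indicator U (R *\<^sub>R y) *\<^sub>R cnj (character n (R *\<^sub>R y)))"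
    using R_pos by (subst lborel_integral_scale[of _ R]) auto
  also have "(LINT y|lborel. indicator U (R *\<^sub>R y) *\<^sub>R cnj (character n (R *\<^sub>R y)))
      = (LINT y|lborel. indicator \<Omega> y *\<^sub>R cis (- 2 * pi * ((R *\<^sub>R n) \<bullet> y)))"
    by (intro Bochner_Integration.integral_cong refl)
      (auto simp: indicator_def scaleR_in_U character_def cis_cnj mult_ac)
  also have "\<dots> = ft_char \<Omega> (R *\<^sub>R n)"
  proof -
    have "(\<lambda>y. indicator \<Omega> y *\<^sub>R cis (- 2 * pi * ((R *\<^sub>R n) \<bullet> y))) \<in> borel_measurable borel"
      by (intro borel_measurable_scaleR borel_measurable_indicator borel_measurable_continuous_onI continuous_intros) auto
    then show ?thesis
      unfolding ft_char_def set_lebesgue_integral_def by (subst integral_completion) auto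
  qed
  finally show ?thesis by (simp add: coef_def)
qed

lemma coef_0: "coef 0 = of_real (R ^ CARD('n) * measure lebesgue \<Omega>)"
proof -
  have "ft_char \<Omega> 0 = of_real (measure lebesgue \<Omega>)"
    unfolding ft_char_def set_lebesgue_integral_def using open_dom
    by (simp add: scaleR_conv_of_real)
  then show ?thesis by (simp add: coef_def)
qed

lemma count_bound: "\<exists>r. \<forall>x. lattice_count U x \<le> r"
proof -
  from U(1) obtain r where "\<And>x. x \<in> U \<Longrightarrow> norm x \<le> r" by (auto simp: bounded_iff)
  from lattice_count_le[OF this] show ?thesis by blast
qed

lemma count_measurable [measurable]: "lattice_count U \<in> borel_measurable borel"
  by (rule borel_measurable_lsc) (rule lattice_count_lsc[OF U])

lemma discrepancy_measurable [measurable]: "discrepancy \<Omega> R \<in> borel_measurable borel"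
  unfolding discrepancy_eq[abs_def] by measurable

text \<open>The mean \<open>m\<close> of the count is its zeroth coefficient. Passing to the
  discrepancy takes m^2 off the energy and the term n = 0 off the series.\<close>

lemma energy_le:
  "(\<integral>\<^sup>+x. ennreal ((discrepancy \<Omega> R x)\<^sup>2) \<partial>cube_measure)
     \<le> (\<integral>\<^sup>+n. ennreal ((norm (coef n))\<^sup>2) \<partial>count_space (int_lattice - {0}))"
proof -
  obtain b where b: "\<And>x. lattice_count U x \<le> b" using count_bound by blast
  interpret P: lsc_periodic "lattice_count U" b
    by standard (auto simp: lattice_count_nonneg b lattice_count_periodic lattice_count_lsc[OF U])
  define m where "m = R ^ CARD('n) * measure lebesgue \<Omega>"
  have fc: "P.fcoeff n = coef n" if "n \<in> int_lattice" for n
    unfolding P.fcoeff_def using count_coeff[OF that] .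
  have i1: "integrable cube_measure (lattice_count U)"
    by (rule cube_integrable[where b = b]) (auto simp: lattice_count_nonneg b)
  have i2: "integrable cube_measure (\<lambda>x. (lattice_count U x)\<^sup>2)"
    by (rule cube_integrable[where b = "b\<^sup>2"]) (auto simp: lattice_count_nonneg b intro!: power_mono)
  have "complex_of_real (LINT x|cube_measure. lattice_count U x) = of_real m"
    using count_coeff[of 0] by (simp add: coef_0 m_def)
  then have mean: "(LINT x|cube_measure. lattice_count U x) = m" by (simp only: of_real_eq_iff)
  have D2: "(discrepancy \<Omega> R x)\<^sup>2 = (lattice_count U x)\<^sup>2 - 2 * m * lattice_count U x + m\<^sup>2" for x
    by (simp add: discrepancy_eq m_def power2_diff algebra_simps)
  have i3: "integrable cube_measure (\<lambda>x. (discrepancy \<Omega> R x)\<^sup>2)"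
    unfolding D2 using i1 i2 by auto
  have "(LINT x|cube_measure. (discrepancy \<Omega> R x)\<^sup>2) = (LINT x|cube_measure. (lattice_count U x)\<^sup>2) - m\<^sup>2"
    unfolding D2 using i1 i2 by (simp add: mean measure_cube_unit_cube power2_eq_square)
  then have sum: "m\<^sup>2 + (LINT x|cube_measure. (discrepancy \<Omega> R x)\<^sup>2) = (LINT x|cube_measure. (lattice_count U x)\<^sup>2)"
    by simp
  have "ennreal (m\<^sup>2) + (\<integral>\<^sup>+x. ennreal ((discrepancy \<Omega> R x)\<^sup>2) \<partial>cube_measure)
      = (\<integral>\<^sup>+x. ennreal ((lattice_count U x)\<^sup>2) \<partial>cube_measure)"
    using i2 i3 by (simp add: nn_integral_eq_integral sum[symmetric])
  also have "\<dots> \<le> (\<integral>\<^sup>+n. ennreal ((norm (P.fcoeff n))\<^sup>2) \<partial>count_space int_lattice)" by (rule P.parseval_le)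
  also have "\<dots> = (\<integral>\<^sup>+n. ennreal ((norm (coef n))\<^sup>2) \<partial>count_space int_lattice)"
    by (intro nn_integral_cong) (simp add: fc)
  also have "\<dots> = (\<integral>\<^sup>+n. ennreal ((norm (coef n))\<^sup>2) \<partial>count_space {0}) + (\<integral>\<^sup>+n. ennreal ((norm (coef n))\<^sup>2) \<partial>count_space (int_lattice - {0}))"
    using nn_integral_disjoint_pair_countspace[of "{0}" "int_lattice - {0}" "\<lambda>n. ennreal ((norm (coef n))\<^sup>2)"]
    by (simp add: insert_absorb nn_integral_count_space_indicator del: nn_integral_indicator_singleton')
  also have "(\<integral>\<^sup>+n. ennreal ((norm (coef n))\<^sup>2) \<partial>count_space {0}) = ennreal (m\<^sup>2)"
    by (simp add: nn_integral_count_space_finite coef_0 m_def del: of_real_mult)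
  finally show ?thesis by (subst (asm) ennreal_add_left_cancel_le) simp
qed

lemma disc_coeff:
  assumes n: "n \<in> int_lattice - {0}"
  shows "(LINT x|cube_measure. complex_of_real (discrepancy \<Omega> R x) * cnj (character n x)) = coef n"
proof -
  obtain b where b: "\<And>x. lattice_count U x \<le> b" using count_bound by blast
  define m where "m = R ^ CARD('n) * measure lebesgue \<Omega>"
  have i1: "integrable cube_measure (\<lambda>x. complex_of_real (lattice_count U x) * cnj (character n x))"
    by (rule cube_integrable[where b = b]) (auto simp: norm_mult lattice_count_nonneg b)
  have i2: "integrable cube_measure (\<lambda>x. complex_of_real m * cnj (character n x))"
    by (rule cube_integrable[where b = "\<bar>m\<bar>"]) (auto simp: norm_mult)
  have "(LINT x|cube_measure. complex_of_real (discrepancy \<Omega> R x) * cnj (character n x))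
      = (LINT x|cube_measure. complex_of_real (lattice_count U x) * cnj (character n x) - complex_of_real m * cnj (character n x))"
    by (simp add: discrepancy_eq m_def left_diff_distrib)
  also have "\<dots> = coef n - (LINT x|cube_measure. complex_of_real m * character (- n) x)"
    using n count_coeff[of n] by (subst Bochner_Integration.integral_diff[OF i1 i2]) (auto simp: cnj_character)
  also have "(LINT x|cube_measure. complex_of_real m * character (- n) x) = 0"
    using n by (simp add: integral_character int_lattice_uminus)
  finally show ?thesis by simp
qed

lemma parseval_system_discrepancy:
  assumes B: "\<And>x. \<bar>discrepancy \<Omega> R x\<bar> \<le> B"
  shows "parseval_system cube_measure (int_lattice - {0}) character (\<lambda>x. complex_of_real (discrepancy \<Omega> R x)) coef B"
proof (intro parseval_system.intro parseval_system_axioms.intro)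
  show "prob_space (cube_measure :: (real ^ 'n) measure)" by (rule cube.prob_space_axioms)
  show "countable (int_lattice - {0} :: (real ^ 'n) set)" using countable_int_lattice by auto
  show "(LINT x|cube_measure. character i x * cnj (character j x)) = (if i = j then 1 else 0)"
    if "i \<in> int_lattice - {0}" "j \<in> int_lattice - {0}" for i j :: "real ^ 'n"
    using that by (intro character_orthonormal) auto
qed (use energy_le disc_coeff B in \<open>auto intro!: borel_measurable_cube_measure\<close>)

lemma discrepancy_bounded: "\<exists>B. \<forall>x. \<bar>discrepancy \<Omega> R x\<bar> \<le> B"
proof -
  obtain b where b: "\<And>x. lattice_count U x \<le> b" using count_bound by blast
  have "\<bar>discrepancy \<Omega> R x\<bar> \<le> b + R ^ CARD('n) * measure lebesgue \<Omega>" for x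
    unfolding discrepancy_eq using b[of x] lattice_count_nonneg[of U x] R_pos by (simp add: abs_le_iff add_increasing)
  then show ?thesis by blast
qed

text \<open>Two discrepancies differ by the difference of two integer counts, here at most 1/2 in
  modulus.\<close>

lemma discrepancy_small_unique:
  assumes "\<bar>discrepancy \<Omega> R x\<bar> \<le> 1 / 4" "\<bar>discrepancy \<Omega> R y\<bar> \<le> 1 / 4"
  shows "discrepancy \<Omega> R x = discrepancy \<Omega> R y"
proof -
  define a b where "a = card {k \<in> int_lattice. x + k \<in> U}" and "b = card {k \<in> int_lattice. y + k \<in> U}"
  have "\<bar>real a - real b\<bar> < 1"
    using assms unfolding discrepancy_eq lattice_count_def a_def[symmetric] b_def[symmetric] by linarith
  then have "a = b" by linarith
  then show ?thesis by (simp add: discrepancy_eq lattice_count_def a_def b_def)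
qed

end

section \<open>Roots of extended non-negative reals\<close>

lemma ennreal_not_top: "x \<noteq> \<top> \<Longrightarrow> \<exists>T\<ge>0. x = ennreal T"
  by (cases x) auto

lemma enn_root_ennreal: "0 \<le> x \<Longrightarrow> enn_root r (ennreal x) = ennreal (x powr (1 / r))"
  by (simp add: enn_root_def)

lemma enn_root_top [simp]: "enn_root r \<infinity> = \<infinity>" "enn_root r \<top> = \<infinity>"
  by (simp_all add: enn_root_def)

lemma enn_root_le:
  assumes "X \<le> ennreal x" "0 \<le> x" "0 < r"
  shows "enn_root r X \<le> ennreal (x powr (1 / r))"
proof -
  have "X \<noteq> \<top>" using assms(1) by (auto simp: top_unique)
  then obtain y where y: "0 \<le> y" "X = ennreal y" by (cases X) auto
  then have "y \<le> x" using assms by simp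
  then show ?thesis using y assms by (simp add: enn_root_ennreal ennreal_leI powr_mono2)
qed

lemma enn_root_ge:
  assumes "ennreal (x powr r) \<le> X" "0 \<le> x" "0 < r"
  shows "ennreal x \<le> enn_root r X"
proof (cases X)
  case (real y)
  then have "x powr r \<le> y" using assms by simp
  then have "(x powr r) powr (1 / r) \<le> y powr (1 / r)" using assms by (intro powr_mono2) auto
  then show ?thesis using real assms by (simp add: enn_root_ennreal powr_powr ennreal_leI)
qed simp

section \<open>The norm estimates for the discrepancy\<close>

context dilated_domain
begin

lemma norm_coef: "norm (coef n) = R ^ CARD('n) * norm (ft_char \<Omega> (R *\<^sub>R n))"
  using R_pos by (simp add: coef_def norm_mult norm_power)

lemma norm_coef_eq_ft_seq: "n \<in> int_lattice - {0} \<Longrightarrow> norm (coef n) = R ^ CARD('n) * norm (ft_seq \<Omega> R n)"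
  by (simp add: norm_coef ft_seq_def)

lemma Rd_pos: "R ^ CARD('n) > 0"
  using R_pos by simp

lemma Lp_norm_discrepancy:
  "Lp_norm p torus (discrepancy \<Omega> R) = enn_root p (\<integral>\<^sup>+x. ennreal (norm (complex_of_real (discrepancy \<Omega> R x)) powr p) \<partial>cube_measure)"
  by (simp add: Lp_norm_def nn_integral_torus)

lemma coef_strong_sum:
  assumes "q > 0" "T \<ge> 0" "(\<integral>\<^sup>+n. ennreal (norm (ft_seq \<Omega> R n) powr q) \<partial>lattice_measure) = ennreal T"
  shows "(\<integral>\<^sup>+n. ennreal (norm (coef n) powr q) \<partial>count_space (int_lattice - {0})) \<le> ennreal ((R ^ CARD('n)) powr q * T)"
proof -
  have "(\<integral>\<^sup>+n. ennreal (norm (coef n) powr q) \<partial>count_space (int_lattice - {0}))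
     = (\<integral>\<^sup>+n. ennreal ((R ^ CARD('n)) powr q) * ennreal (norm (ft_seq \<Omega> R n) powr q) \<partial>count_space (int_lattice - {0}))"
    using R_pos by (intro nn_integral_cong) (simp add: norm_coef_eq_ft_seq powr_mult ennreal_mult)
  also have "\<dots> = ennreal ((R ^ CARD('n)) powr q) * (\<integral>\<^sup>+n. ennreal (norm (ft_seq \<Omega> R n) powr q) \<partial>count_space (int_lattice - {0}))"
    by (rule nn_integral_cmult) simp
  also have "\<dots> \<le> ennreal ((R ^ CARD('n)) powr q) * (\<integral>\<^sup>+n. ennreal (norm (ft_seq \<Omega> R n) powr q) \<partial>lattice_measure)"
    unfolding lattice_measure_def
    by (intro mult_left_mono) (auto simp: nn_integral_count_space_indicator intro!: nn_integral_mono split: split_indicator)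
  also have "\<dots> = ennreal ((R ^ CARD('n)) powr q * T)"
    using assms by (simp add: ennreal_mult)
  finally show ?thesis .
qed

lemma coef_weak:
  assumes q: "q > 0" and T: "T \<ge> 0" and t: "t > 0"
    and weak: "(SUP t\<in>{0<..}. ennreal (t powr q) * emeasure lattice_measure {n \<in> space lattice_measure. norm (ft_seq \<Omega> R n) > t}) = ennreal T"
  shows "ennreal (t powr q) * emeasure (count_space (int_lattice - {0})) {n \<in> int_lattice - {0}. norm (coef n) > t}
     \<le> ennreal ((R ^ CARD('n)) powr q * T)"
proof -
  define u where "u = t / R ^ CARD('n)"
  have u: "u > 0" using t Rd_pos by (simp add: u_def)
  have tu: "t powr q = (R ^ CARD('n)) powr q * u powr q"
    using t R_pos u by (simp add: powr_mult[symmetric] u_def)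
  \<comment> \<open>The origin lies in neither set: \<open>ft_seq\<close> vanishes there and
    \<open>u\<close> is positive.\<close>
  have "{n \<in> int_lattice - {0}. norm (coef n) > t} = {n \<in> int_lattice. norm (ft_seq \<Omega> R n) > u}"
    using Rd_pos u by (auto simp: norm_coef_eq_ft_seq u_def field_simps ft_seq_def norm_coef split: if_splits)
  then have eq: "emeasure (count_space (int_lattice - {0})) {n \<in> int_lattice - {0}. norm (coef n) > t}
     = emeasure lattice_measure {n \<in> space lattice_measure. norm (ft_seq \<Omega> R n) > u}"
  proof -
    have "emeasure (count_space (int_lattice - {0})) {n \<in> int_lattice - {0}. norm (coef n) > t}
       = emeasure (count_space int_lattice) {n \<in> int_lattice - {0}. norm (coef n) > t}"
      by (subst (1 2) emeasure_count_space) auto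
    then show ?thesis using \<open>{n \<in> int_lattice - {0}. norm (coef n) > t} = _\<close> by (simp add: lattice_measure_def)
  qed
  have "ennreal (t powr q) * emeasure (count_space (int_lattice - {0})) {n \<in> int_lattice - {0}. norm (coef n) > t}
     = ennreal ((R ^ CARD('n)) powr q) * (ennreal (u powr q) * emeasure lattice_measure {n \<in> space lattice_measure. norm (ft_seq \<Omega> R n) > u})"
    unfolding eq tu by (simp add: ennreal_mult mult.assoc)
  also have "\<dots> \<le> ennreal ((R ^ CARD('n)) powr q) * ennreal T"
    unfolding weak[symmetric] using u by (intro mult_left_mono SUP_upper) auto
  finally show ?thesis using T by (simp add: ennreal_mult)
qed

text \<open>Returns from powers to norms: p-th powers are bounded by the (p - 1)-st power of a q-th
  power sum, and (p - 1) / p = 1 / q.\<close>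

lemma powr_conjugate:
  assumes "p > 1" "1 / p + 1 / q = 1" "T \<ge> 0"
  shows "(((R ^ CARD('n)) powr q * T) powr (p - 1)) powr (1 / p) = R ^ CARD('n) * T powr (1 / q)"
proof -
  have q: "q \<noteq> 0" using assms by auto
  have "(p - 1) * (1 / p) = 1 / q" using assms by (simp add: field_simps)
  then have "(((R ^ CARD('n)) powr q * T) powr (p - 1)) powr (1 / p) = ((R ^ CARD('n)) powr q * T) powr (1 / q)"
    by (simp only: powr_powr)
  also have "\<dots> = R ^ CARD('n) * T powr (1 / q)"
    using assms R_pos q by (simp add: powr_mult powr_powr)
  finally show ?thesis .
qed

lemma discrepancy_strong:
  assumes pq: "2 \<le> p" "1 / p + 1 / q = 1"
  shows "Lp_norm p torus (discrepancy \<Omega> R) \<le> ennreal (R ^ CARD('n)) * Lp_norm q lattice_measure (ft_seq \<Omega> R)"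
proof (cases "(\<integral>\<^sup>+n. ennreal (norm (ft_seq \<Omega> R n) powr q) \<partial>lattice_measure) = \<top>")
  case True
  then have "Lp_norm q lattice_measure (ft_seq \<Omega> R) = \<top>" by (simp add: Lp_norm_def)
  then show ?thesis using R_pos by (simp add: ennreal_mult_top)
next
  case False
  obtain T where T: "T \<ge> 0" "(\<integral>\<^sup>+n. ennreal (norm (ft_seq \<Omega> R n) powr q) \<partial>lattice_measure) = ennreal T"
    using ennreal_not_top[OF False] by blast
  obtain B where B: "\<And>x. \<bar>discrepancy \<Omega> R x\<bar> \<le> B" using discrepancy_bounded by blast
  interpret S: parseval_system cube_measure "int_lattice - {0}" character "\<lambda>x. complex_of_real (discrepancy \<Omega> R x)" coef B
    by (rule parseval_system_discrepancy[OF B])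
  have q: "q > 0"
  proof -
    have "1 / p \<le> 1 / 2" using pq by simp
    then have "0 < 1 / q" using pq by linarith
    then show ?thesis by simp
  qed
  define X where "X = (R ^ CARD('n)) powr q * T"
  have X: "X \<ge> 0" using T by (simp add: X_def)
  have sum: "(\<integral>\<^sup>+n. ennreal (norm (coef n) powr q) \<partial>count_space (int_lattice - {0})) \<le> ennreal X"
    unfolding X_def by (rule coef_strong_sum[OF q T])
  have "(\<integral>\<^sup>+x. ennreal (norm (complex_of_real (discrepancy \<Omega> R x)) powr p) \<partial>cube_measure) \<le> ennreal (X powr (p - 1))"
  \<comment> \<open>At p = q = 2 the geometric ratio 2^(q-2) behind the weak-type constant reaches
    1, and the claim is Parseval's inequality itself.\<close>
  proof (cases "p = 2")
    case True
    then have q2: "q = 2" using pq q by (auto simp: field_simps)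
    show ?thesis using S.energy sum X unfolding True q2 by (simp add: powr_numeral)
  next
    case False
    then show ?thesis using pq X sum by (intro S.hausdorff_young[of p q]) auto
  qed
  then have "Lp_norm p torus (discrepancy \<Omega> R) \<le> ennreal ((X powr (p - 1)) powr (1 / p))"
    unfolding Lp_norm_discrepancy using pq by (intro enn_root_le) auto
  also have "\<dots> = ennreal (R ^ CARD('n) * T powr (1 / q))"
    unfolding X_def using pq T by (subst powr_conjugate) auto
  finally show ?thesis
    using T R_pos by (simp add: Lp_norm_def enn_root_ennreal ennreal_mult)
qed

lemma discrepancy_weak_bound:
  assumes pq: "2 < p" "1 / p + 1 / q = 1" and T: "T \<ge> 0"
    and weak: "(SUP t\<in>{0<..}. ennreal (t powr q) * emeasure lattice_measure {n \<in> space lattice_measure. norm (ft_seq \<Omega> R n) > t}) = ennreal T"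
    and t: "t > 0"
  shows "ennreal (t powr p) * emeasure cube_measure {x \<in> space cube_measure. norm (discrepancy \<Omega> R x) > t}
     \<le> ennreal (weak_type_const p q * ((R ^ CARD('n)) powr q * T) powr (p - 1))"
proof -
  obtain B where B: "\<And>x. \<bar>discrepancy \<Omega> R x\<bar> \<le> B" using discrepancy_bounded by blast
  interpret S: parseval_system cube_measure "int_lattice - {0}" character "\<lambda>x. complex_of_real (discrepancy \<Omega> R x)" coef B
    by (rule parseval_system_discrepancy[OF B])
  note q = conjugate_exponent[OF pq]
  have "ennreal (t powr p) * emeasure cube_measure {x \<in> space cube_measure. norm (complex_of_real (discrepancy \<Omega> R x)) > t}
     \<le> ennreal (weak_type_const p q * ((R ^ CARD('n)) powr q * T) powr (p - 1))"
    using q T by (intro S.weak_type[OF pq _ t] coef_weak[OF _ T _ weak]) auto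
  then show ?thesis by (simp only: norm_of_real real_norm_def)
qed

lemma discrepancy_weak:
  assumes pq: "2 < p" "1 / p + 1 / q = 1"
  shows "weak_Lp_norm p torus (discrepancy \<Omega> R)
    \<le> ennreal (weak_type_const p q powr (1 / p)) * ennreal (R ^ CARD('n)) * weak_Lp_norm q lattice_measure (ft_seq \<Omega> R)"
proof (cases "(SUP t\<in>{0<..}. ennreal (t powr q) * emeasure lattice_measure {n \<in> space lattice_measure. norm (ft_seq \<Omega> R n) > t}) = \<top>")
  case True
  have "weak_Lp_norm q lattice_measure (ft_seq \<Omega> R) = \<top>" unfolding weak_Lp_norm_def True by simp
  then show ?thesis
    using R_pos weak_type_const_pos[of q p] conjugate_exponent[OF pq] by (simp add: ennreal_mult_top ennreal_mult[symmetric])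
next
  case False
  obtain T where T: "T \<ge> 0" "(SUP t\<in>{0<..}. ennreal (t powr q) * emeasure lattice_measure {n \<in> space lattice_measure. norm (ft_seq \<Omega> R n) > t}) = ennreal T"
    using ennreal_not_top[OF False] by blast
  note q = conjugate_exponent[OF pq]
  define K where "K = weak_type_const p q"
  have K: "K > 0" unfolding K_def using q by (intro weak_type_const_pos)
  define X where "X = ((R ^ CARD('n)) powr q * T) powr (p - 1)"
  have m: "(\<lambda>x. norm (discrepancy \<Omega> R x)) \<in> borel_measurable borel" by measurable
  have "weak_Lp_norm p torus (discrepancy \<Omega> R) \<le> ennreal ((K * X) powr (1 / p))"
    unfolding weak_Lp_norm_def
  proof (intro enn_root_le SUP_least)
    fix t :: real assume "t \<in> {0<..}"
    then show "ennreal (t powr p) * emeasure torus {x \<in> space torus. t < norm (discrepancy \<Omega> R x)} \<le> ennreal (K * X)"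
      unfolding emeasure_torus[OF m] K_def X_def by (intro discrepancy_weak_bound[OF pq T]) auto
  qed (use K pq in \<open>auto simp: X_def\<close>)
  also have "(K * X) powr (1 / p) = K powr (1 / p) * (R ^ CARD('n) * T powr (1 / q))"
    using K pq T powr_conjugate[of p q T] by (simp add: powr_mult X_def)
  finally show ?thesis
    using T R_pos K by (simp add: weak_Lp_norm_def enn_root_ennreal ennreal_mult K_def mult.assoc)
qed

text \<open>Since the counting function is integer valued, the discrepancy is constant where it is at most
  \<open>1 / 4\<close> in modulus; hence no lower bound on the Fourier coefficients is needed to start the dyadic
  decomposition at the fixed height \<open>1 / 4\<close>.\<close>

lemma discrepancy_small_part:
  assumes p: "p > 0"
    and weak: "\<And>t. t > 0 \<Longrightarrow> ennreal (t powr p) * emeasure cube_measure {x \<in> space cube_measure. norm (discrepancy \<Omega> R x) > t} \<le> V"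
  shows "(\<integral>\<^sup>+x. ennreal (norm (discrepancy \<Omega> R x) powr p) * indicator {x. norm (discrepancy \<Omega> R x) \<le> 1 / 4} x \<partial>cube_measure)
     \<le> ennreal (2 powr p) * V"
proof (cases "\<exists>x. discrepancy \<Omega> R x \<noteq> 0 \<and> \<bar>discrepancy \<Omega> R x\<bar> \<le> 1 / 4")
  case False
  then have "(\<integral>\<^sup>+x. ennreal (norm (discrepancy \<Omega> R x) powr p) * indicator {x. norm (discrepancy \<Omega> R x) \<le> 1 / 4} x \<partial>cube_measure) = (\<integral>\<^sup>+x. 0 \<partial>(cube_measure :: (real ^ 'n) measure))"
    by (intro nn_integral_cong) (auto simp: indicator_def)
  then show ?thesis by simp
next
  case True
  then obtain x0 where x0: "discrepancy \<Omega> R x0 \<noteq> 0" "\<bar>discrepancy \<Omega> R x0\<bar> \<le> 1 / 4" by blast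
  define e where "e = \<bar>discrepancy \<Omega> R x0\<bar>"
  have e: "e > 0" using x0 by (simp add: e_def)
  \<comment> \<open>Half the height \<open>e\<close>, because the weak bound speaks of strict level
    sets and the discrepancy has modulus exactly \<open>e\<close> on the part in question. The price
    is the factor 2^p.\<close>
  define L where "L = {x \<in> space cube_measure. norm (discrepancy \<Omega> R x) > e / 2}"
  have Lm: "L \<in> sets cube_measure"
  proof -
    have "(\<lambda>x. norm (discrepancy \<Omega> R x)) \<in> borel_measurable cube_measure"
      by (rule borel_measurable_cube_measure) measurable
    then show ?thesis unfolding L_def by measurable
  qed
  have "(\<integral>\<^sup>+x. ennreal (norm (discrepancy \<Omega> R x) powr p) * indicator {x. norm (discrepancy \<Omega> R x) \<le> 1 / 4} x \<partial>cube_measure)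
    \<le> (\<integral>\<^sup>+x. ennreal (e powr p) * indicator L x \<partial>cube_measure)"
  proof (rule nn_integral_mono)
    fix x :: "real ^ 'n" assume x: "x \<in> space cube_measure"
    show "ennreal (norm (discrepancy \<Omega> R x) powr p) * indicator {x. norm (discrepancy \<Omega> R x) \<le> 1 / 4} x
      \<le> ennreal (e powr p) * indicator L x"
    proof (cases "\<bar>discrepancy \<Omega> R x\<bar> \<le> 1 / 4")
      case True
      then have "\<bar>discrepancy \<Omega> R x\<bar> = e" using discrepancy_small_unique[OF True x0(2)] by (simp add: e_def)
      then show ?thesis using x e True by (simp add: L_def)
    qed simp
  qed
  also have "\<dots> = ennreal (e powr p) * emeasure cube_measure L"
    by (rule nn_integral_cmult_indicator[OF Lm])
  also have "e powr p = 2 powr p * (e / 2) powr p"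
    using e by (simp add: powr_mult[symmetric])
  also have "ennreal (2 powr p * (e / 2) powr p) * emeasure cube_measure L
      = ennreal (2 powr p) * (ennreal ((e / 2) powr p) * emeasure cube_measure L)"
    by (simp add: ennreal_mult mult.assoc)
  also have "\<dots> \<le> ennreal (2 powr p) * V"
    unfolding L_def using e by (intro mult_left_mono weak) auto
  finally show ?thesis .
qed

text \<open>\<open>K\<close> dyadic levels lead from 1/4 up to the maximum of the discrepancy, and
  the part below 1/4 costs as much as one more level, whence 1 + K.\<close>

lemma discrepancy_log:
  assumes pq: "2 < p" "1 / p + 1 / q = 1"
    and K: "\<And>x. \<bar>discrepancy \<Omega> R x\<bar> \<le> 2 ^ K * (1 / 4)" and A: "1 + real K \<le> A"
  shows "Lp_norm p torus (discrepancy \<Omega> R)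
    \<le> ennreal ((2 powr p * weak_type_const p q * A) powr (1 / p)) * ennreal (R ^ CARD('n)) * weak_Lp_norm q lattice_measure (ft_seq \<Omega> R)"
proof (cases "(SUP t\<in>{0<..}. ennreal (t powr q) * emeasure lattice_measure {n \<in> space lattice_measure. norm (ft_seq \<Omega> R n) > t}) = \<top>")
  case True
  have "weak_Lp_norm q lattice_measure (ft_seq \<Omega> R) = \<top>" unfolding weak_Lp_norm_def True by simp
  then show ?thesis
    using R_pos weak_type_const_pos[of q p] conjugate_exponent[OF pq] A by (simp add: ennreal_mult_top ennreal_mult[symmetric])
next
  case False
  obtain T where T: "T \<ge> 0" "(SUP t\<in>{0<..}. ennreal (t powr q) * emeasure lattice_measure {n \<in> space lattice_measure. norm (ft_seq \<Omega> R n) > t}) = ennreal T"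
    using ennreal_not_top[OF False] by blast
  note q = conjugate_exponent[OF pq]
  define C where "C = weak_type_const p q"
  have C: "C > 0" unfolding C_def using q by (intro weak_type_const_pos)
  define X where "X = ((R ^ CARD('n)) powr q * T) powr (p - 1)"
  have X: "X \<ge> 0" by (simp add: X_def)
  have weak: "ennreal (t powr p) * emeasure cube_measure {x \<in> space cube_measure. norm (discrepancy \<Omega> R x) > t} \<le> ennreal (C * X)"
    if "t > 0" for t
    unfolding C_def X_def by (rule discrepancy_weak_bound[OF pq T that])
  have m: "(\<lambda>x. norm (discrepancy \<Omega> R x)) \<in> borel_measurable cube_measure"
    by (rule borel_measurable_cube_measure) measurable
  have m1: "(\<lambda>x. ennreal (norm (discrepancy \<Omega> R x) powr p)) \<in> borel_measurable cube_measure"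
    by (rule borel_measurable_cube_measure) measurable
  have m2: "{x\<in>space cube_measure. norm (discrepancy \<Omega> R x) > 1 / 4} \<in> sets cube_measure"
    using m by measurable
  have mI1: "(\<lambda>x. ennreal (norm (discrepancy \<Omega> R x) powr p) * indicator {x. norm (discrepancy \<Omega> R x) \<le> 1 / 4} x) \<in> borel_measurable cube_measure"
    by (rule borel_measurable_cube_measure) measurable
  have mI2: "(\<lambda>x. ennreal (norm (discrepancy \<Omega> R x) powr p) * indicator {x\<in>space cube_measure. norm (discrepancy \<Omega> R x) > 1 / 4} x) \<in> borel_measurable cube_measure"
    by (intro borel_measurable_times_ennreal borel_measurable_indicator m1 m2)
  have "(\<integral>\<^sup>+x. ennreal (norm (complex_of_real (discrepancy \<Omega> R x)) powr p) \<partial>cube_measure)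
     = (\<integral>\<^sup>+x. ennreal (norm (discrepancy \<Omega> R x) powr p) * indicator {x. norm (discrepancy \<Omega> R x) \<le> 1 / 4} x
        + ennreal (norm (discrepancy \<Omega> R x) powr p) * indicator {x\<in>space cube_measure. norm (discrepancy \<Omega> R x) > 1 / 4} x \<partial>cube_measure)"
    by (intro nn_integral_cong) (auto simp: indicator_def)
  also have "\<dots> = (\<integral>\<^sup>+x. ennreal (norm (discrepancy \<Omega> R x) powr p) * indicator {x. norm (discrepancy \<Omega> R x) \<le> 1 / 4} x \<partial>cube_measure)
     + (\<integral>\<^sup>+x. ennreal (norm (discrepancy \<Omega> R x) powr p) * indicator {x\<in>space cube_measure. norm (discrepancy \<Omega> R x) > 1 / 4} x \<partial>cube_measure)"
    by (rule nn_integral_add[OF mI1 mI2])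
  also have "\<dots> \<le> ennreal (2 powr p) * ennreal (C * X) + ennreal (real K * 2 powr p) * ennreal (C * X)"
    using pq by (intro add_mono discrepancy_small_part weak weak_to_strong m) (auto simp: K[simplified])
  also have "\<dots> = ennreal ((1 + real K) * (2 powr p * C * X))"
    using C X by (simp add: ennreal_mult[symmetric] ennreal_plus[symmetric] algebra_simps del: ennreal_plus)
  also have "\<dots> \<le> ennreal (A * (2 powr p * C * X))"
    using C X A by (intro ennreal_leI mult_right_mono) auto
  also have "A * (2 powr p * C * X) = 2 powr p * C * A * X" by simp
  finally have "Lp_norm p torus (discrepancy \<Omega> R) \<le> ennreal ((2 powr p * C * A * X) powr (1 / p))"
    unfolding Lp_norm_discrepancy using C X A pq by (intro enn_root_le) auto
  also have "(2 powr p * C * A * X) powr (1 / p) = (2 powr p * C * A) powr (1 / p) * (R ^ CARD('n) * T powr (1 / q))"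
    using C A X pq T powr_conjugate[of p q T] by (subst powr_mult) (auto simp: X_def)
  finally show ?thesis
    using T R_pos by (simp add: weak_Lp_norm_def enn_root_ennreal ennreal_mult C_def mult.assoc)
qed

lemma coef_le_L1:
  assumes "n \<in> int_lattice - {0}"
  shows "norm (coef n) \<le> (LINT x|cube_measure. \<bar>discrepancy \<Omega> R x\<bar>)"
proof -
  have "norm (coef n) \<le> (LINT x|cube_measure. norm (complex_of_real (discrepancy \<Omega> R x) * cnj (character n x)))"
    unfolding disc_coeff[OF assms, symmetric] by (rule integral_norm_bound)
  then show ?thesis by (simp add: norm_mult)
qed

lemma discrepancy_integrable: "integrable cube_measure (discrepancy \<Omega> R)"
proof -
  obtain B where "\<And>x. \<bar>discrepancy \<Omega> R x\<bar> \<le> B" using discrepancy_bounded by blast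
  then show ?thesis by (intro cube_integrable[where b = B]) auto
qed

lemma L1_le_Lp:
  assumes p: "1 \<le> p"
  shows "ennreal (LINT x|cube_measure. \<bar>discrepancy \<Omega> R x\<bar>) \<le> Lp_norm p torus (discrepancy \<Omega> R)"
proof -
  define l where "l = (LINT x|cube_measure. \<bar>discrepancy \<Omega> R x\<bar>)"
  have l0: "l \<ge> 0" unfolding l_def by simp
  obtain B where B: "\<And>x. \<bar>discrepancy \<Omega> R x\<bar> \<le> B" using discrepancy_bounded by blast
  have ip: "integrable cube_measure (\<lambda>x. \<bar>discrepancy \<Omega> R x\<bar> powr p)"
    using B p by (intro cube_integrable[where b = "B powr p"]) (auto intro!: powr_mono2)
  have "l powr p \<le> (LINT x|cube_measure. \<bar>discrepancy \<Omega> R x\<bar> powr p)"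
  proof (cases "l = 0")
    case False
    then have l: "l > 0" using l0 by simp
    \<comment> \<open>This is the tangent line of y^p at the mean \<open>l\<close>, in the form
      given by Young's inequality with weights 1/p and 1 - 1/p. Integrating it yields Jensen's
      inequality.\<close>
    have young: "y \<le> y powr p * l powr (1 - p) / p + (1 - 1 / p) * l" if "y \<ge> 0" for y
    proof (cases "y = 0")
      case False
      have "(y powr p * l powr (1 - p)) powr (1 / p) * l powr (1 - 1 / p) = y"
      proof -
        have "(1 - p) / p + (1 - 1 / p) = 0" using p by (simp add: field_simps)
        then have "l powr ((1 - p) / p) * l powr (1 - 1 / p) = 1" using l by (simp add: powr_add[symmetric])
        then show ?thesis using p that l by (simp add: powr_mult powr_powr mult.assoc)
      qed
      then show ?thesis
        using Youngs_inequality_0[of "1 / p" "1 - 1 / p" "y powr p * l powr (1 - p)" l] p l False that by simp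
    qed (use l p in simp)
    have "l \<le> (LINT x|cube_measure. \<bar>discrepancy \<Omega> R x\<bar> powr p * (l powr (1 - p) / p) + (1 - 1 / p) * l)"
      unfolding l_def[of, symmetric] using young ip discrepancy_integrable
      by (subst l_def) (intro integral_mono, auto)
    also have "\<dots> = (LINT x|cube_measure. \<bar>discrepancy \<Omega> R x\<bar> powr p) * (l powr (1 - p) / p) + (1 - 1 / p) * l"
      using ip by (simp add: measure_cube_unit_cube)
    finally have "l / p \<le> (LINT x|cube_measure. \<bar>discrepancy \<Omega> R x\<bar> powr p) * (l powr (1 - p) / p)"
      by (simp add: algebra_simps)
    then have "l \<le> (LINT x|cube_measure. \<bar>discrepancy \<Omega> R x\<bar> powr p) * l powr (1 - p)"
      using p by (simp add: divide_le_cancel)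
    then have "l * l powr (p - 1) \<le> (LINT x|cube_measure. \<bar>discrepancy \<Omega> R x\<bar> powr p) * l powr (1 - p) * l powr (p - 1)"
      by (intro mult_right_mono) auto
    also have "\<dots> = (LINT x|cube_measure. \<bar>discrepancy \<Omega> R x\<bar> powr p)"
      using l by (simp add: mult.assoc powr_add[symmetric])
    also have "l * l powr (p - 1) = l powr p" using l powr_add[of l 1 "p - 1"] by simp
    finally show ?thesis .
  qed simp
  then have "ennreal (l powr p) \<le> (\<integral>\<^sup>+x. ennreal (norm (complex_of_real (discrepancy \<Omega> R x)) powr p) \<partial>cube_measure)"
    using ip by (simp add: nn_integral_eq_integral ennreal_leI)
  then show ?thesis
    unfolding Lp_norm_discrepancy l_def[symmetric] using l0 p by (intro enn_root_ge) auto
qed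

lemma L1_le_Linf: "ennreal (LINT x|cube_measure. \<bar>discrepancy \<Omega> R x\<bar>) \<le> Linf_norm torus (discrepancy \<Omega> R)"
  unfolding Linf_norm_def
proof (rule Inf_greatest, clarify)
  fix c assume c: "AE x in torus. ennreal (norm (discrepancy \<Omega> R x)) \<le> c"
  have "ennreal (LINT x|cube_measure. \<bar>discrepancy \<Omega> R x\<bar>) = (\<integral>\<^sup>+x. ennreal \<bar>discrepancy \<Omega> R x\<bar> \<partial>torus)"
    using discrepancy_integrable by (simp add: nn_integral_eq_integral nn_integral_torus)
  also have "\<dots> \<le> (\<integral>\<^sup>+x. c \<partial>(torus :: (real ^ 'n) measure))"
    using c by (intro nn_integral_mono_AE) simp
  also have "\<dots> = c"
    unfolding nn_integral_torus by (simp add: cube.emeasure_space_1[unfolded space_cube_measure])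
  finally show "ennreal (LINT x|cube_measure. \<bar>discrepancy \<Omega> R x\<bar>) \<le> c" .
qed

lemma coef_SUP_le_L1:
  "(SUP n\<in>int_lattice - {0}. ennreal (R ^ CARD('n) * norm (ft_char \<Omega> (R *\<^sub>R n))))
     \<le> ennreal (LINT x|cube_measure. \<bar>discrepancy \<Omega> R x\<bar>)"
  by (intro SUP_least ennreal_leI) (simp add: coef_le_L1 flip: norm_coef)

end

text \<open>The discrepancy is bounded by a polynomial in R, and a polynomial bound is reached from
  1/4 after a number of doublings proportional to log(2 + R).\<close>

lemma discrepancy_log_height:
  fixes \<Omega> :: "(real ^ 'n) set"
  assumes "bounded \<Omega>" "open \<Omega>"
  shows "\<exists>A>0. \<forall>R>0. \<exists>K. (\<forall>x. \<bar>discrepancy \<Omega> R x\<bar> \<le> 2 ^ K * (1 / 4)) \<and> 1 + real K \<le> A * ln (2 + R)"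
proof -
  obtain r where r: "r > 0" "\<And>x. x \<in> \<Omega> \<Longrightarrow> norm x \<le> r" using assms by (auto simp: bounded_pos)
  define m where "m = measure lebesgue \<Omega>"
  have m: "m \<ge> 0" by (simp add: m_def)
  \<comment> \<open>The 4 offsets the bottom height 1/4, 1 + m joins the count and the volume term,
    and 2 r + 3 makes (2 r + 3)(2 + R) dominate both R and the side length 2 R r + 5 of the lattice
    box.\<close>
  define E where "E = 4 * (1 + m) * (2 * r + 3) ^ CARD('n)"
  have E: "E \<ge> 1"
  proof -
    have "1 \<le> (2 * r + 3) ^ CARD('n)" using r by (intro one_le_power) auto
    then have "1 * 1 \<le> (4 * (1 + m)) * (2 * r + 3) ^ CARD('n)" using m by (intro mult_mono) auto
    then show ?thesis by (simp add: E_def)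
  qed
  define A where "A = (2 + log 2 E + CARD('n)) / ln 2"
  have lE: "log 2 E \<ge> 0" using E by simp
  have "\<exists>K. (\<forall>x. \<bar>discrepancy \<Omega> R x\<bar> \<le> 2 ^ K * (1 / 4)) \<and> 1 + real K \<le> A * ln (2 + R)" if R: "R > 0" for R
  proof -
    interpret dilated_domain \<Omega> R using assms R by unfold_locales
    define y where "y = (2 * r + 3) * (2 + R)"
    define Y where "Y = E * (2 + R) ^ CARD('n)"
    have Y4: "Y = 4 * ((1 + m) * y ^ CARD('n))" by (simp add: Y_def E_def y_def power_mult_distrib)
    have Ry: "R \<le> y" using r R by (simp add: y_def algebra_simps)
    have bound: "\<bar>discrepancy \<Omega> R x\<bar> \<le> Y / 4" for x
    proof -
      have "lattice_count U x \<le> (2 * real (nat \<lceil>R * r + 1\<rceil>) + 1) ^ CARD('n)"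
        using r R by (intro lattice_count_le) (auto simp: U_def)
      also have "\<dots> \<le> y ^ CARD('n)"
      proof (rule power_mono)
        have "R * r > 0" using R r by simp
        then have "real (nat \<lceil>R * r + 1\<rceil>) \<le> R * r + 2" by linarith
        then have "2 * real (nat \<lceil>R * r + 1\<rceil>) + 1 \<le> 2 * (R * r) + 5" by simp
        also have "\<dots> \<le> y" using r R by (simp add: y_def algebra_simps)
        finally show "2 * real (nat \<lceil>R * r + 1\<rceil>) + 1 \<le> y" .
      qed simp
      finally have 1: "lattice_count U x \<le> y ^ CARD('n)" .
      have 2: "R ^ CARD('n) * m \<le> y ^ CARD('n) * m" using Ry R m by (intro mult_right_mono power_mono) auto
      have "0 \<le> R ^ CARD('n) * m" using R m by simp
      then have "\<bar>discrepancy \<Omega> R x\<bar> \<le> y ^ CARD('n) + y ^ CARD('n) * m"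
        unfolding discrepancy_eq m_def[symmetric] using 1 2 lattice_count_nonneg[of U x] by linarith
      then show ?thesis by (simp add: Y4 algebra_simps)
    qed
    have Y1: "Y \<ge> 1"
    proof -
      have "1 * 1 \<le> E * (2 + R) ^ CARD('n)" using E R by (intro mult_mono one_le_power) auto
      then show ?thesis by (simp add: Y_def)
    qed
    define K where "K = nat \<lceil>log 2 Y\<rceil>"
    have "log 2 Y \<ge> 0" using Y1 by simp
    then have K: "log 2 Y \<le> real K" "real K \<le> log 2 Y + 1" unfolding K_def by linarith+
    have "Y = 2 powr (log 2 Y)" using Y1 by simp
    also have "\<dots> \<le> 2 powr (real K)" using K by (intro powr_mono) auto
    finally have YK: "Y \<le> 2 ^ K" by (simp add: powr_realpow)
    define L where "L = log 2 (2 + R)"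
    \<comment> \<open>The 2 in 2 + R matters here: it keeps \<open>L\<close> at least 1, so the
      additive constants can be absorbed into multiples of \<open>L\<close>.\<close>
    have L: "L \<ge> 1" unfolding L_def using R by (subst one_le_log_cancel_iff) auto
    have "log 2 Y = log 2 E + real CARD('n) * L"
      unfolding Y_def L_def using E R by (subst log_mult) (auto simp: log_nat_power)
    then have "1 + real K \<le> 2 + log 2 E + real CARD('n) * L" using K by simp
    also have "\<dots> \<le> 2 * L + log 2 E * L + real CARD('n) * L"
      using L lE by (intro add_mono) (auto simp: mult_left_le mult_le_cancel_left1)
    also have "\<dots> = A * ln (2 + R)" by (simp add: A_def L_def log_def field_simps)
    finally have "1 + real K \<le> A * ln (2 + R)" .
    moreover have "\<bar>discrepancy \<Omega> R x\<bar> \<le> 2 ^ K * (1 / 4)" for x using bound[of x] YK by simp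
    ultimately show ?thesis by blast
  qed
  moreover have "A > 0" using lE by (simp add: A_def add_pos_nonneg)
  ultimately show ?thesis by blast
qed

theorem theorem2:
  fixes \<Omega> :: "(real ^ 'n) set"
  assumes "bounded \<Omega>" and "open \<Omega>"
  shows
   "(\<forall>p q. 2 \<le> p \<and> 1 / p + 1 / q = 1 \<longrightarrow>
       (\<forall>R > 0. Lp_norm p torus (discrepancy \<Omega> R)
                 \<le> ennreal (R ^ CARD('n)) * Lp_norm q lattice_measure (ft_seq \<Omega> R)))
    \<and> (\<forall>p q. 2 < p \<and> 1 / p + 1 / q = 1 \<longrightarrow>
       (\<exists>C::real. \<forall>R > 0. weak_Lp_norm p torus (discrepancy \<Omega> R)
                 \<le> ennreal C * ennreal (R ^ CARD('n)) * weak_Lp_norm q lattice_measure (ft_seq \<Omega> R)))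
    \<and> (\<forall>p q. 2 < p \<and> 1 / p + 1 / q = 1 \<longrightarrow>
       (\<exists>C::real. \<forall>R > 0. Lp_norm p torus (discrepancy \<Omega> R)
                 \<le> ennreal C * ennreal (R ^ CARD('n) * ln (2 + R) powr (1 / p))
                   * weak_Lp_norm q lattice_measure (ft_seq \<Omega> R)))
    \<and> (\<forall>p \<ge> 1. \<forall>R > 0.
         (SUP n\<in>int_lattice - {0}. ennreal (R ^ CARD('n) * norm (ft_char \<Omega> (R *\<^sub>R n))))
           \<le> Lp_norm p torus (discrepancy \<Omega> R))
    \<and> (\<forall>R > 0.
         (SUP n\<in>int_lattice - {0}. ennreal (R ^ CARD('n) * norm (ft_char \<Omega> (R *\<^sub>R n))))
           \<le> Linf_norm torus (discrepancy \<Omega> R))"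
proof -
  have dom: "dilated_domain \<Omega> R" if "R > 0" for R
    using assms that by unfold_locales
  show ?thesis
  proof (intro conjI allI impI)
    fix p q R :: real assume "2 \<le> p \<and> 1 / p + 1 / q = 1" "R > 0"
    then show "Lp_norm p torus (discrepancy \<Omega> R) \<le> ennreal (R ^ CARD('n)) * Lp_norm q lattice_measure (ft_seq \<Omega> R)"
      using dilated_domain.discrepancy_strong[OF dom] by blast
  next
    fix p q :: real assume "2 < p \<and> 1 / p + 1 / q = 1"
    then show "\<exists>C::real. \<forall>R > 0. weak_Lp_norm p torus (discrepancy \<Omega> R)
                 \<le> ennreal C * ennreal (R ^ CARD('n)) * weak_Lp_norm q lattice_measure (ft_seq \<Omega> R)"
      using dilated_domain.discrepancy_weak[OF dom] by blast
  next
    fix p q :: real assume pq: "2 < p \<and> 1 / p + 1 / q = 1"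
    obtain A where A: "A > 0" and
      K: "\<And>R. R > 0 \<Longrightarrow> \<exists>K. (\<forall>x. \<bar>discrepancy \<Omega> R x\<bar> \<le> 2 ^ K * (1 / 4)) \<and> 1 + real K \<le> A * ln (2 + R)"
      using discrepancy_log_height[OF assms] by blast
    have W: "weak_type_const p q > 0" using conjugate_exponent[of p q] pq by (intro weak_type_const_pos) auto
    \<comment> \<open>The p-th root is taken of the whole product, so the logarithm leaves it with
      exponent 1/p and the factors free of R remain.\<close>
    define C where "C = (2 powr p * weak_type_const p q * A) powr (1 / p)"
    have "Lp_norm p torus (discrepancy \<Omega> R)
                 \<le> ennreal C * ennreal (R ^ CARD('n) * ln (2 + R) powr (1 / p))
                   * weak_Lp_norm q lattice_measure (ft_seq \<Omega> R)" if R: "R > 0" for R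
    proof -
      from K[OF R] obtain k where "\<And>x. \<bar>discrepancy \<Omega> R x\<bar> \<le> 2 ^ k * (1 / 4)" "1 + real k \<le> A * ln (2 + R)" by blast
      then have "Lp_norm p torus (discrepancy \<Omega> R)
         \<le> ennreal ((2 powr p * weak_type_const p q * (A * ln (2 + R))) powr (1 / p)) * ennreal (R ^ CARD('n)) * weak_Lp_norm q lattice_measure (ft_seq \<Omega> R)"
        using dilated_domain.discrepancy_log[OF dom[OF R]] pq by blast
      also have "(2 powr p * weak_type_const p q * (A * ln (2 + R))) powr (1 / p) = C * ln (2 + R) powr (1 / p)"
      proof -
        have "(2 powr p * weak_type_const p q * (A * ln (2 + R))) = (2 powr p * weak_type_const p q * A) * ln (2 + R)" by simp
        then show ?thesis unfolding C_def using W A R by (simp only: powr_mult)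
      qed
      finally show ?thesis
        using R by (simp add: C_def ennreal_mult mult_ac)
    qed
    then show "\<exists>C::real. \<forall>R > 0. Lp_norm p torus (discrepancy \<Omega> R)
                 \<le> ennreal C * ennreal (R ^ CARD('n) * ln (2 + R) powr (1 / p))
                   * weak_Lp_norm q lattice_measure (ft_seq \<Omega> R)" by blast
  next
    fix p R :: real assume "p \<ge> 1" "R > 0"
    then show "(SUP n\<in>int_lattice - {0}. ennreal (R ^ CARD('n) * norm (ft_char \<Omega> (R *\<^sub>R n))))
           \<le> Lp_norm p torus (discrepancy \<Omega> R)"
      using order_trans[OF dilated_domain.coef_SUP_le_L1 dilated_domain.L1_le_Lp, OF dom dom] by blast
  next
    fix R :: real assume "R > 0"
    then show "(SUP n\<in>int_lattice - {0}. ennreal (R ^ CARD('n) * norm (ft_char \<Omega> (R *\<^sub>R n))))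
           \<le> Linf_norm torus (discrepancy \<Omega> R)"
      using order_trans[OF dilated_domain.coef_SUP_le_L1 dilated_domain.L1_le_Linf, OF dom dom] by blast
  qed
qed

end
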